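(* Let $n,m$ be positive integers and let $\mathbf i,\mathbf i'\in[n]^m$. Suppose that the Bott manifolds $\mathcal{B}_{\mathbf i}$ and $\mathcal{B}_{\mathbf i'}$ are indecomposable. Then $\mathcal{B}_{\mathbf i}$ and $\mathcal{B}_{\mathbf i'}$ are isomorphic (as toric varieties) if and only if either $\mathrm{st}(\mathbf i')$ or $\mathrm{st}(\iota_n(\mathbf i'))$ is obtained from $\mathrm{st}(\mathbf i)$ via a sequence of $2$-moves.
   Context: Notation: $[n]=\{1,\dots,n\}$. A Bott matrix of size $m$ is an $m\times m$ lower triangular integer matrix with all diagonal entries equal to $-1$. The Bott manifold determined by a Bott matrix $B$ is the smooth projective toric variety (of dimension $m$) whose fan in $\mathbb{R}^m$ (lattice $\mathbb{Z}^m$) has primitive ray generators $\mathbf e_1,\dots,\mathbf e_m$ (standard basis) and $\mathbf v_1,\dots,\mathbf v_m$ (the columns of $B$), and whose maximal cones are spanned by the $m$-element sets $S$ of ray generators with $\{\mathbf e_i,\mathbf v_i\}\not\subseteq S$ for all $i\in[m]$. For $\mathbf i=(i_1,\dots,i_m)\in[n]^m$, $\mathcal{B}_{\mathbf i}$ is the Bott manifold determined by the Bott matrix $B_{\mathbf i}=[b_{j,k}]$ with, for $1\le k<j\le m$, $b_{j,k}=-2$ if $i_j=i_k$, $b_{j,k}=1$ if $|i_j-i_k|=1$, $b_{j,k}=0$ otherwise, together with $b_{k,j}=0$ and $b_{j,j}=-1$. A Bott manifold is indecomposable if it is not isomorphic (as a toric variety) to a product of lower-dimensional Bott manifolds. For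 $\mathbf i=(i_1,\dots,i_m)\in[n]^m$: the standardization is $\mathrm{st}(\mathbf i)=(i_1-k+1,\dots,i_m-k+1)$, where $k$ is the smallest integer in $\mathbf i$; $\iota_n(\mathbf i)=(n+1-i_1,\dots,n+1-i_m)$. For $j\in[m-1]$, $s_j\cdot\mathbf i$ is the sequence obtained from $\mathbf i$ by exchanging the entries $i_j$ and $i_{j+1}$; if $|i_j-i_{j+1}|>1$, the operation sending $\mathbf i$ to $s_j\cdot\mathbf i$ is called a $2$-move. A sequence of $2$-moves may be empty. *)

theory Defs
  imports Complex_Main "HOL-Algebra.Group" "Jordan_Normal_Form.Matrix"
begin

section \<open>Complex varieties given by affine charts\<close>

text \<open>
  A variety over the complex numbers is presented in the classical way, as a space with
  functions: by a set of affine charts \<open>(U, A)\<close>, where \<open>U\<close> is a set of points and \<open>A\<close> is the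
  coordinate ring of \<open>U\<close>, a ring of functions of which only the values on \<open>U\<close> matter.
  A toric variety carries in addition its torus, a group whose elements are points of the
  variety.
\<close>

record 'a toric_variety =
  charts :: "('a set \<times> ('a \<Rightarrow> complex) set) set"
  torus :: "'a monoid"

definition points :: "'a toric_variety \<Rightarrow> 'a set" where
  "points X = (\<Union>(U, A)\<in>charts X. U)"

text \<open>The principal open subsets of the charts generate the Zariski topology.\<close>

definition zariski_open :: "'a toric_variety \<Rightarrow> 'a set \<Rightarrow> bool" where
  "zariski_open X W \<longleftrightarrow> W \<subseteq> points X \<and>
     (\<forall>p\<in>W. \<exists>(U, A)\<in>charts X. p \<in> U \<and>
        (\<exists>g\<in>A. g p \<noteq> 0 \<and> {q \<in> U. g q \<noteq> 0} \<subseteq> W))"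

text \<open>A function on an open set is regular if near each point it is a quotient of two
  elements of the coordinate ring of some chart.\<close>

definition regular_on :: "'a toric_variety \<Rightarrow> 'a set \<Rightarrow> ('a \<Rightarrow> complex) \<Rightarrow> bool" where
  "regular_on X W h \<longleftrightarrow>
     (\<forall>p\<in>W. \<exists>(U, A)\<in>charts X. p \<in> U \<and>
        (\<exists>f\<in>A. \<exists>g\<in>A. g p \<noteq> 0 \<and> (\<forall>q\<in>W \<inter> U. g q \<noteq> 0 \<longrightarrow> h q = f q / g q)))"

definition variety_morphism ::
  "'a toric_variety \<Rightarrow> 'b toric_variety \<Rightarrow> ('a \<Rightarrow> 'b) \<Rightarrow> bool" where
  "variety_morphism X Y \<phi> \<longleftrightarrow> \<phi> ` points X \<subseteq> points Y \<and>
     (\<forall>W. zariski_open Y W \<longrightarrow>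
        zariski_open X {p \<in> points X. \<phi> p \<in> W} \<and>
        (\<forall>h. regular_on Y W h \<longrightarrow> regular_on X {p \<in> points X. \<phi> p \<in> W} (h \<circ> \<phi>)))"

text \<open>A toric morphism is a morphism of varieties that restricts to a group homomorphism of
  the tori; it is then automatically equivariant.\<close>

definition toric_morphism ::
  "'a toric_variety \<Rightarrow> 'b toric_variety \<Rightarrow> ('a \<Rightarrow> 'b) \<Rightarrow> bool" where
  "toric_morphism X Y \<phi> \<longleftrightarrow> variety_morphism X Y \<phi> \<and> \<phi> \<in> hom (torus X) (torus Y)"

definition toric_isomorphic :: "'a toric_variety \<Rightarrow> 'b toric_variety \<Rightarrow> bool" where
  "toric_isomorphic X Y \<longleftrightarrow>
     (\<exists>\<phi> \<psi>. toric_morphism X Y \<phi> \<and> toric_morphism Y X \<psi> \<and>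
        (\<forall>p\<in>points X. \<psi> (\<phi> p) = p) \<and> (\<forall>q\<in>points Y. \<phi> (\<psi> q) = q))"

text \<open>The product of two affine charts has as coordinate ring the tensor product of the two
  coordinate rings, viewed as functions on the product set.\<close>

definition tensor_functions ::
  "('a \<Rightarrow> complex) set \<Rightarrow> ('b \<Rightarrow> complex) set \<Rightarrow> ('a \<times> 'b \<Rightarrow> complex) set" where
  "tensor_functions A B =
     {(\<lambda>(p, q). \<Sum>k<N. f k p * g k q) | (N :: nat) f g. (\<forall>k<N. f k \<in> A \<and> g k \<in> B)}"

definition toric_product ::
  "'a toric_variety \<Rightarrow> 'b toric_variety \<Rightarrow> ('a \<times> 'b) toric_variety" where
  "toric_product X Y =
     \<lparr>charts = {(U \<times> V, tensor_functions A B) | U A V B. (U, A) \<in> charts X \<and> (V, B) \<in> charts Y},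
      torus = torus X \<times>\<times> torus Y\<rparr>"

section \<open>The toric variety of a fan\<close>

text \<open>Cones live in the real vectors of dimension \<open>m\<close>; the characters of the torus are the
  integer vectors of dimension \<open>m\<close>.\<close>

definition pairing :: "int vec \<Rightarrow> real vec \<Rightarrow> real" where
  "pairing u x = map_vec real_of_int u \<bullet> x"

definition cone_spanned :: "nat \<Rightarrow> int vec set \<Rightarrow> real vec set" where
  "cone_spanned m S =
     {vec m (\<lambda>j. \<Sum>s\<in>S. c s * real_of_int (s $ j)) | c. \<forall>s\<in>S. 0 \<le> c s}"

definition cone_semigroup :: "nat \<Rightarrow> real vec set \<Rightarrow> int vec set" where
  "cone_semigroup m \<sigma> = {u \<in> carrier_vec m. \<forall>x\<in>\<sigma>. 0 \<le> pairing u x}"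

definition cone_perp :: "nat \<Rightarrow> real vec set \<Rightarrow> int vec set" where
  "cone_perp m \<sigma> = {u \<in> carrier_vec m. \<forall>x\<in>\<sigma>. pairing u x = 0}"

text \<open>
  The points of the affine toric variety of a cone \<open>\<sigma>\<close> are the semigroup homomorphisms from
  \<open>cone_semigroup m \<sigma>\<close> to the multiplicative monoid of complex numbers, and the toric variety
  of a fan is obtained by gluing these along faces.  Every point of the result comes from a
  unique smallest cone \<open>\<tau>\<close> of the fan; on the semigroup of \<open>\<tau>\<close> it is nonzero exactly on the
  lattice points orthogonal to \<open>\<tau>\<close>, where it is multiplicative.  A point is therefore encoded
  as a pair \<open>(\<tau>, x)\<close>, where \<open>x\<close> is this homomorphism, extended by zero to all vectors.  On the
  chart of a cone \<open>\<sigma>\<close> containing \<open>\<tau>\<close> the character of \<open>u\<close> takes the value \<open>x u\<close>.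
\<close>

type_synonym toric_point = "real vec set \<times> (int vec \<Rightarrow> complex)"

definition cone_orbit :: "nat \<Rightarrow> real vec set \<Rightarrow> (int vec \<Rightarrow> complex) set" where
  "cone_orbit m \<tau> =
     {x. (\<forall>u. x u \<noteq> 0 \<longleftrightarrow> u \<in> cone_perp m \<tau>) \<and>
         (\<forall>u\<in>cone_perp m \<tau>. \<forall>v\<in>cone_perp m \<tau>. x (u + v) = x u * x v)}"

text \<open>For cones of a fan, \<open>\<tau> \<subseteq> \<sigma>\<close> holds exactly if \<open>\<tau>\<close> is a face of \<open>\<sigma>\<close>.\<close>

definition affine_chart :: "nat \<Rightarrow> real vec set set \<Rightarrow> real vec set \<Rightarrow> toric_point set" where
  "affine_chart m \<Sigma> \<sigma> = {(\<tau>, x). \<tau> \<in> \<Sigma> \<and> \<tau> \<subseteq> \<sigma> \<and> x \<in> cone_orbit m \<tau>}"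

text \<open>The coordinate ring of a chart is the semigroup algebra of \<open>cone_semigroup m \<sigma>\<close>.\<close>

definition coordinate_ring :: "nat \<Rightarrow> real vec set \<Rightarrow> (toric_point \<Rightarrow> complex) set" where
  "coordinate_ring m \<sigma> =
     {(\<lambda>(\<tau>, x). \<Sum>u\<in>F. c u * x u) | F c. finite F \<and> F \<subseteq> cone_semigroup m \<sigma>}"

text \<open>The torus is the orbit of the zero cone, with pointwise multiplication of characters.\<close>

definition fan_torus :: "nat \<Rightarrow> toric_point monoid" where
  "fan_torus m =
     \<lparr>carrier = {{0\<^sub>v m}} \<times> cone_orbit m {0\<^sub>v m},
      monoid.mult = (\<lambda>(\<tau>, x) (\<tau>', y). ({0\<^sub>v m}, \<lambda>u. x u * y u)),
      one = ({0\<^sub>v m}, \<lambda>u. if u \<in> carrier_vec m then 1 else 0)\<rparr>"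

definition fan_variety :: "nat \<Rightarrow> real vec set set \<Rightarrow> toric_point toric_variety" where
  "fan_variety m \<Sigma> =
     \<lparr>charts = (\<lambda>\<sigma>. (affine_chart m \<Sigma> \<sigma>, coordinate_ring m \<sigma>)) ` \<Sigma>,
      torus = fan_torus m\<rparr>"

section \<open>Bott manifolds\<close>

text \<open>Rows, columns and the positions of a sequence are numbered from \<open>0\<close> to \<open>m - 1\<close>.\<close>

definition bott_matrix :: "nat \<Rightarrow> int mat \<Rightarrow> bool" where
  "bott_matrix m B \<longleftrightarrow> B \<in> carrier_mat m m \<and>
     (\<forall>j<m. B $$ (j, j) = -1) \<and> (\<forall>j<m. \<forall>k<m. j < k \<longrightarrow> B $$ (j, k) = 0)"

definition bott_maximal_generators :: "int mat \<Rightarrow> int vec set set" where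
  "bott_maximal_generators B = (let m = dim_row B in
     {S. S \<subseteq> unit_vec m ` {..<m} \<union> col B ` {..<m} \<and> card S = m \<and>
         (\<forall>i<m. \<not> {unit_vec m i, col B i} \<subseteq> S)})"

text \<open>The generators of a maximal cone form a lattice basis, so its faces are the cones
  spanned by the subsets of its generators.\<close>

definition bott_fan :: "int mat \<Rightarrow> real vec set set" where
  "bott_fan B =
     {cone_spanned (dim_row B) T | T. \<exists>S\<in>bott_maximal_generators B. T \<subseteq> S}"

definition bott_manifold :: "int mat \<Rightarrow> toric_point toric_variety" where
  "bott_manifold B = fan_variety (dim_row B) (bott_fan B)"

text \<open>Products of Bott manifolds are Bott manifolds, so it is enough to consider two factors.\<close>

definition indecomposable_bott :: "int mat \<Rightarrow> bool" where
  "indecomposable_bott B \<longleftrightarrow>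
     \<not> (\<exists>m1 m2 B1 B2. m1 < dim_row B \<and> m2 < dim_row B \<and>
          bott_matrix m1 B1 \<and> bott_matrix m2 B2 \<and>
          toric_isomorphic (bott_manifold B)
            (toric_product (bott_manifold B1) (bott_manifold B2)))"

definition seq_matrix :: "int list \<Rightarrow> int mat" where
  "seq_matrix i = mat (length i) (length i) (\<lambda>(j, k).
     if j < k then 0
     else if j = k then -1
     else if i ! j = i ! k then -2
     else if \<bar>i ! j - i ! k\<bar> = 1 then 1
     else 0)"

section \<open>Operations on sequences\<close>

definition standardization :: "int list \<Rightarrow> int list" where
  "standardization i = map (\<lambda>a. a - Min (set i) + 1) i"

definition iota :: "nat \<Rightarrow> int list \<Rightarrow> int list" where
  "iota n i = map (\<lambda>a. int n + 1 - a) i"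

inductive two_move :: "int list \<Rightarrow> int list \<Rightarrow> bool" where
  "Suc j < length i \<Longrightarrow> \<bar>i ! j - i ! Suc j\<bar> > 1 \<Longrightarrow>
     two_move i (i[j := i ! Suc j, Suc j := i ! j])"

end

theory Submission
  imports Defs "Jordan_Normal_Form.Determinant"
begin

text \<open>
  A toric isomorphism restricts to an isomorphism of tori, which by the linear independence of
  characters comes from an isomorphism of the character lattices; following the limits of
  one-parameter subgroups, its dual maps every cone of one fan into a cone of the other.  For Bott
  fans this makes the change of generators between maximal cones a nonnegative integer matrix
  with nonnegative inverse, that is, a permutation matrix.  So rays go to rays, and the pair
  \<open>{e\<^sub>k, v\<^sub>k}\<close> goes to a pair \<open>{e\<^sub>l, v\<^sub>l}\<close>.  The entries of \<open>B\<close> below the diagonal lie in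
  \<open>{-2, 0, 1}\<close>, a set meeting its negative only in \<open>0\<close>; hence exchanging some \<open>e\<^sub>k\<close> with \<open>v\<^sub>k\<close> has no
  effect on the matrices, and the two Bott matrices differ by a simultaneous permutation of rows
  and columns.

  An entry \<open>-2\<close>, \<open>1\<close> or \<open>0\<close> says that two letters of the word are equal, adjacent or far apart.  If
  the letters skip a value, 2-moves separate the smaller from the larger letters; the matrix
  becomes block diagonal and the manifold a product.  In the indecomposable case the letters thus
  form an interval, so a permutation preserving adjacency acts on them by a shift or a reflection.
  As it also preserves the order of letters that are equal or adjacent, it is a sequence of
  2-moves.
\<close>

section \<open>Morphisms of toric varieties and lattices\<close>

text \<open>The set of entries matters: for m = 2 the entries a and -a below the diagonal give the
  same Hirzebruch surface, the coordinate change being the one that exchanges e_2 and v_2. Only a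
  set without nonzero opposite numbers excludes this. What passes to the lattices is at first only
  that each cone goes into some cone of the other fan, and going forth and back might end in a
  different maximal cone. Triangularity prevents this, because every ray has leading coordinate 1 or
  -1 at its own index. Pairs are recognised by incidence: e_k and v_k are exactly the pairs of rays
  that lie in no common cone. Indecomposability matters because the letters on one side of a gap can
  be shifted alone: the words 1,3 and 1,4 have the same matrix, but their standardizations have
  different letters, even after a reflection.\<close>

lemma variety_morphism_comp:
  assumes "variety_morphism X Y \<phi>" "variety_morphism Y Z \<psi>"
  shows "variety_morphism X Z (\<psi> \<circ> \<phi>)"
proof -
  have sub: "\<phi> ` points X \<subseteq> points Y" "\<psi> ` points Y \<subseteq> points Z"
    using assms by (auto simp: variety_morphism_def)
  have eq: "{p \<in> points X. \<phi> p \<in> {q \<in> points Y. \<psi> q \<in> W}} = {p \<in> points X. (\<psi> \<circ> \<phi>) p \<in> W}" for W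
    using sub by auto
  show ?thesis
    unfolding variety_morphism_def
  proof (intro conjI allI impI)
    show "(\<psi> \<circ> \<phi>) ` points X \<subseteq> points Z" using sub by (auto simp: image_subset_iff)
  next
    fix W assume "zariski_open Z W"
    then have "zariski_open Y {q \<in> points Y. \<psi> q \<in> W}" using assms(2) by (auto simp: variety_morphism_def)
    then show "zariski_open X {p \<in> points X. (\<psi> \<circ> \<phi>) p \<in> W}"
      using assms(1) unfolding variety_morphism_def eq[symmetric] by blast
  next
    fix W h assume "zariski_open Z W" "regular_on Z W h"
    then have "zariski_open Y {q \<in> points Y. \<psi> q \<in> W}" "regular_on Y {q \<in> points Y. \<psi> q \<in> W} (h \<circ> \<psi>)"
      using assms(2) by (auto simp: variety_morphism_def)
    then have "regular_on X {p \<in> points X. \<phi> p \<in> {q \<in> points Y. \<psi> q \<in> W}} (h \<circ> \<psi> \<circ> \<phi>)"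
      using assms(1) unfolding variety_morphism_def by blast
    then show "regular_on X {p \<in> points X. (\<psi> \<circ> \<phi>) p \<in> W} (h \<circ> (\<psi> \<circ> \<phi>))"
      by (simp only: eq comp_assoc)
  qed
qed

lemma toric_morphism_comp:
  assumes "toric_morphism X Y \<phi>" "toric_morphism Y Z \<psi>"
  shows "toric_morphism X Z (\<psi> \<circ> \<phi>)"
  using assms variety_morphism_comp
  by (fastforce simp: toric_morphism_def hom_def Pi_iff)

lemma toric_isomorphic_refl: "toric_isomorphic X X"
proof -
  have "{p \<in> points X. p \<in> W} = W" if "zariski_open X W" for W
    using that by (auto simp: zariski_open_def)
  then have "toric_morphism X X (\<lambda>p. p)"
    by (auto simp: toric_morphism_def variety_morphism_def hom_def comp_def)
  then show ?thesis unfolding toric_isomorphic_def by blast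
qed

lemma toric_isomorphic_trans:
  assumes "toric_isomorphic X Y" "toric_isomorphic Y Z"
  shows "toric_isomorphic X Z"
proof -
  obtain \<phi> \<psi> where 1: "toric_morphism X Y \<phi>" "toric_morphism Y X \<psi>"
    "\<And>p. p \<in> points X \<Longrightarrow> \<psi> (\<phi> p) = p" "\<And>q. q \<in> points Y \<Longrightarrow> \<phi> (\<psi> q) = q"
    using assms(1) unfolding toric_isomorphic_def by blast
  obtain \<phi>' \<psi>' where 2: "toric_morphism Y Z \<phi>'" "toric_morphism Z Y \<psi>'"
    "\<And>p. p \<in> points Y \<Longrightarrow> \<psi>' (\<phi>' p) = p" "\<And>q. q \<in> points Z \<Longrightarrow> \<phi>' (\<psi>' q) = q"
    using assms(2) unfolding toric_isomorphic_def by blast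
  have "\<phi> ` points X \<subseteq> points Y" "\<psi>' ` points Z \<subseteq> points Y"
    using 1(1) 2(2) by (auto simp: toric_morphism_def variety_morphism_def)
  then show ?thesis
    unfolding toric_isomorphic_def
    using 1(3,4) 2(3,4) toric_morphism_comp[OF 1(1) 2(1)] toric_morphism_comp[OF 2(2) 1(2)]
    by (intro exI[of _ "\<phi>' \<circ> \<phi>"] exI[of _ "\<psi> \<circ> \<psi>'"]) (auto simp: image_subset_iff)
qed

text \<open>Opens and regular functions are both defined by coordinate functions of charts, so
  charts suffice. The criterion asks that the preimage of a chart be a whole chart; the coordinate
  permutations and the product maps to which it is applied have this property.\<close>

lemma variety_morphismI:
  assumes sub: "\<phi> ` points X \<subseteq> points Y"
    and charts: "\<And>V C. (V, C) \<in> charts Y \<Longrightarrow> \<exists>(U, A)\<in>charts X.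
      U = {p \<in> points X. \<phi> p \<in> V} \<and> (\<forall>c\<in>C. \<exists>a\<in>A. \<forall>p\<in>U. a p = c (\<phi> p))"
  shows "variety_morphism X Y \<phi>"
  unfolding variety_morphism_def
proof (intro conjI allI impI)
  show "\<phi> ` points X \<subseteq> points Y" by (rule sub)
next
  fix W assume W: "zariski_open Y W"
  show "zariski_open X {p \<in> points X. \<phi> p \<in> W}"
    unfolding zariski_open_def
  proof (intro conjI ballI)
    fix p assume p: "p \<in> {p \<in> points X. \<phi> p \<in> W}"
    then obtain V C g where 1: "(V, C) \<in> charts Y" "\<phi> p \<in> V" "g \<in> C" "g (\<phi> p) \<noteq> 0"
      "{q \<in> V. g q \<noteq> 0} \<subseteq> W" using W unfolding zariski_open_def by blast
    obtain U A where 2: "(U, A) \<in> charts X" "U = {p \<in> points X. \<phi> p \<in> V}"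
      "\<forall>c\<in>C. \<exists>a\<in>A. \<forall>p\<in>U. a p = c (\<phi> p)" using charts[OF 1(1)] by blast
    obtain a where a: "a \<in> A" "\<forall>p\<in>U. a p = g (\<phi> p)" using 2(3) 1(3) by blast
    have "p \<in> U" using p 1 2 by auto
    moreover have "{q \<in> U. a q \<noteq> 0} \<subseteq> {p \<in> points X. \<phi> p \<in> W}" using 1(5) 2(2) a by auto
    ultimately show "\<exists>(U, A)\<in>charts X. p \<in> U \<and>
        (\<exists>g\<in>A. g p \<noteq> 0 \<and> {q \<in> U. g q \<noteq> 0} \<subseteq> {p \<in> points X. \<phi> p \<in> W})"
      using 1(4) a by (intro bexI[OF _ 2(1)]) (auto intro!: bexI[OF _ a(1)])
  qed auto
next
  fix W h assume W: "zariski_open Y W" and h: "regular_on Y W h"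
  show "regular_on X {p \<in> points X. \<phi> p \<in> W} (h \<circ> \<phi>)"
    unfolding regular_on_def
  proof (intro ballI)
    fix p assume p: "p \<in> {p \<in> points X. \<phi> p \<in> W}"
    then obtain V C f g where 1: "(V, C) \<in> charts Y" "\<phi> p \<in> V" "f \<in> C" "g \<in> C" "g (\<phi> p) \<noteq> 0"
      "\<forall>q\<in>W \<inter> V. g q \<noteq> 0 \<longrightarrow> h q = f q / g q" using h unfolding regular_on_def by blast
    obtain U A where 2: "(U, A) \<in> charts X" "U = {p \<in> points X. \<phi> p \<in> V}"
      "\<forall>c\<in>C. \<exists>a\<in>A. \<forall>p\<in>U. a p = c (\<phi> p)" using charts[OF 1(1)] by blast
    obtain a where a: "a \<in> A" "\<forall>p\<in>U. a p = f (\<phi> p)" using 2(3) 1(3) by blast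
    obtain b where b: "b \<in> A" "\<forall>p\<in>U. b p = g (\<phi> p)" using 2(3) 1(4) by blast
    have "p \<in> U" using p 1 2 by auto
    then show "\<exists>(U, A)\<in>charts X. p \<in> U \<and> (\<exists>f\<in>A. \<exists>g\<in>A. g p \<noteq> 0 \<and>
        (\<forall>q\<in>{p \<in> points X. \<phi> p \<in> W} \<inter> U. g q \<noteq> 0 \<longrightarrow> (h \<circ> \<phi>) q = f q / g q))"
      using 1(5,6) a(2) b(2) 2(2)
      by (intro bexI[OF _ 2(1)] case_prodI conjI bexI[OF _ a(1)] bexI[OF _ b(1)]) auto
  qed
qed

section \<open>Cones, dual semigroups and coordinate rings\<close>

lemma scalar_prod_eq_sum:
  assumes "v \<in> carrier_vec m"
  shows "u \<bullet> v = (\<Sum>j<m. u $ j * v $ j)"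
  using assms by (simp add: scalar_prod_def atLeast0LessThan)

lemma pairing_cone_spanned:
  assumes "u \<in> carrier_vec m" "finite T" "T \<subseteq> carrier_vec m"
  shows "pairing u (vec m (\<lambda>j. \<Sum>s\<in>T. c s * real_of_int (s $ j))) = (\<Sum>s\<in>T. c s * real_of_int (u \<bullet> s))"
proof -
  have "pairing u (vec m (\<lambda>j. \<Sum>s\<in>T. c s * real_of_int (s $ j))) =
      (\<Sum>j<m. \<Sum>s\<in>T. c s * (real_of_int (u $ j) * real_of_int (s $ j)))"
    using assms by (simp add: pairing_def scalar_prod_eq_sum[of _ m] sum_distrib_left mult_ac)
  also have "\<dots> = (\<Sum>s\<in>T. \<Sum>j<m. c s * (real_of_int (u $ j) * real_of_int (s $ j)))"
    by (rule sum.swap)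
  also have "\<dots> = (\<Sum>s\<in>T. c s * real_of_int (u \<bullet> s))"
    using assms by (intro sum.cong) (auto simp: scalar_prod_eq_sum[of _ m] sum_distrib_left subset_iff)
  finally show ?thesis .
qed

lemma cone_semigroup_cone_spanned:
  assumes "finite T" "T \<subseteq> carrier_vec m"
  shows "cone_semigroup m (cone_spanned m T) = {u \<in> carrier_vec m. \<forall>s\<in>T. 0 \<le> u \<bullet> s}"
proof (intro Set.set_eqI iffI)
  fix u assume u: "u \<in> cone_semigroup m (cone_spanned m T)"
  then have uc: "u \<in> carrier_vec m" by (simp add: cone_semigroup_def)
  have "0 \<le> u \<bullet> s" if "s \<in> T" for s
  proof -
    let ?c = "\<lambda>r. if r = s then 1 else 0 :: real"
    have "vec m (\<lambda>j. \<Sum>s\<in>T. ?c s * real_of_int (s $ j)) \<in> cone_spanned m T"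
      unfolding cone_spanned_def by (intro CollectI exI[of _ ?c]) auto
    then have "0 \<le> pairing u (vec m (\<lambda>j. \<Sum>s\<in>T. ?c s * real_of_int (s $ j)))"
      using u unfolding cone_semigroup_def by blast
    also have "\<dots> = (\<Sum>r\<in>T. ?c r * real_of_int (u \<bullet> r))"
      by (rule pairing_cone_spanned[OF uc assms])
    also have "\<dots> = (\<Sum>r\<in>T. if r = s then real_of_int (u \<bullet> r) else 0)"
      by (intro sum.cong) auto
    finally show ?thesis using assms that by simp
  qed
  then show "u \<in> {u \<in> carrier_vec m. \<forall>s\<in>T. 0 \<le> u \<bullet> s}" using uc by simp
next
  fix u assume u: "u \<in> {u \<in> carrier_vec m. \<forall>s\<in>T. 0 \<le> u \<bullet> s}"
  show "u \<in> cone_semigroup m (cone_spanned m T)"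
    unfolding cone_semigroup_def cone_spanned_def
    using u assms by (auto simp: pairing_cone_spanned intro!: sum_nonneg)
qed

text \<open>Carries descriptions by generators from \<open>cone_semigroup\<close> over to
  \<open>cone_perp\<close>, which is its group of units.\<close>

lemma cone_perp_eq: "cone_perp m \<sigma> = {u \<in> cone_semigroup m \<sigma>. -u \<in> cone_semigroup m \<sigma>}" if "\<sigma> \<subseteq> carrier_vec m"
proof -
  have "pairing (-u) x = - pairing u x" if "u \<in> carrier_vec m" "x \<in> carrier_vec m" for u x
    using that by (simp add: pairing_def scalar_prod_eq_sum[of _ m] sum_negf)
  then show ?thesis using that
    by (auto simp: cone_perp_def cone_semigroup_def) (metis dual_order.antisym neg_0_le_iff_le subsetD)
qed

lemma cone_spanned_carrier: "cone_spanned m T \<subseteq> carrier_vec m"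
  by (auto simp: cone_spanned_def)

lemma cone_perp_cone_spanned:
  assumes "finite T" "T \<subseteq> carrier_vec m"
  shows "cone_perp m (cone_spanned m T) = {u \<in> carrier_vec m. \<forall>s\<in>T. u \<bullet> s = 0}"
proof -
  have "(- u) \<bullet> s = - (u \<bullet> s)" if "u \<in> carrier_vec m" "s \<in> T" for u s
    using that assms(2) by (auto simp: scalar_prod_eq_sum[of _ m] sum_negf)
  then show ?thesis
    unfolding cone_perp_eq[OF cone_spanned_carrier] cone_semigroup_cone_spanned[OF assms]
    by (auto intro: order.antisym)
qed

lemma zero_in_cone_spanned: "0\<^sub>v m \<in> cone_spanned m T"
  unfolding cone_spanned_def by (intro CollectI exI[of _ "\<lambda>_. 0"]) auto

lemma cone_spanned_empty: "cone_spanned m {} = {0\<^sub>v m}"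
  by (auto simp: cone_spanned_def)

lemma pairing_zero: "u \<in> carrier_vec m \<Longrightarrow> pairing u (0\<^sub>v m) = 0"
  by (simp add: pairing_def)

lemma cone_perp_zero: "cone_perp m {0\<^sub>v m} = carrier_vec m"
  by (auto simp: cone_perp_def pairing_zero)

lemma cone_semigroup_zero: "cone_semigroup m {0\<^sub>v m} = carrier_vec m"
  by (auto simp: cone_semigroup_def pairing_zero)

lemma pairing_add:
  assumes "u \<in> carrier_vec m" "v \<in> carrier_vec m" "x \<in> carrier_vec m"
  shows "pairing (u + v) x = pairing u x + pairing v x"
  using assms by (simp add: pairing_def scalar_prod_eq_sum[of _ m] sum.distrib algebra_simps)

lemma cone_semigroup_add:
  assumes "\<sigma> \<subseteq> carrier_vec m" "u \<in> cone_semigroup m \<sigma>" "v \<in> cone_semigroup m \<sigma>"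
  shows "u + v \<in> cone_semigroup m \<sigma>"
  using assms by (auto simp: cone_semigroup_def pairing_add[of _ m] subset_iff)

text \<open>Two nonnegative pairings add up to 0 only if both are 0: the orthogonal vectors form a
  face of the semigroup. Hence extending a character of this face by zero keeps it multiplicative on
  the whole semigroup.\<close>

lemma cone_semigroup_perp_iff:
  assumes "\<sigma> \<subseteq> carrier_vec m" "u \<in> cone_semigroup m \<sigma>" "v \<in> cone_semigroup m \<sigma>"
  shows "u + v \<in> cone_perp m \<sigma> \<longleftrightarrow> u \<in> cone_perp m \<sigma> \<and> v \<in> cone_perp m \<sigma>"
  using assms
  by (auto simp: cone_semigroup_def cone_perp_def pairing_add[of _ m] subset_iff add_nonneg_eq_0_iff)

lemma cone_semigroup_mono: "\<tau> \<subseteq> \<sigma> \<Longrightarrow> cone_semigroup m \<sigma> \<subseteq> cone_semigroup m \<tau>"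
  by (auto simp: cone_semigroup_def)

lemma cone_orbit_mult:
  assumes "\<tau> \<subseteq> carrier_vec m" "x \<in> cone_orbit m \<tau>" "u \<in> cone_semigroup m \<tau>" "v \<in> cone_semigroup m \<tau>"
  shows "x (u + v) = x u * x v"
proof (cases "u \<in> cone_perp m \<tau> \<and> v \<in> cone_perp m \<tau>")
  case True
  then show ?thesis using assms(2) by (auto simp: cone_orbit_def)
next
  case False
  then have "u + v \<notin> cone_perp m \<tau>" using cone_semigroup_perp_iff assms by blast
  then have "x (u + v) = 0" using assms(2) by (auto simp: cone_orbit_def)
  moreover have "x u * x v = 0" using False assms(2) by (auto simp: cone_orbit_def)
  ultimately show ?thesis by simp
qed

lemma coordinate_ring_monomial:
  "u \<in> cone_semigroup m \<sigma> \<Longrightarrow> (\<lambda>(\<tau>, x). c * x u) \<in> coordinate_ring m \<sigma>"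
  unfolding coordinate_ring_def by (intro CollectI exI[of _ "{u}"] exI[of _ "\<lambda>_. c"]) auto

text \<open>Sums in \<open>coordinate_ring\<close> run over sets of characters, so equal characters
  coming from different summands have to be merged: the supports are united and the coefficients
  padded by zero.\<close>

lemma coordinate_ring_sum:
  assumes "finite I" "\<And>i. i \<in> I \<Longrightarrow> f i \<in> coordinate_ring m \<sigma>"
  shows "(\<lambda>p. \<Sum>i\<in>I. f i p) \<in> coordinate_ring m \<sigma>"
proof -
  have "\<forall>i\<in>I. \<exists>F c. finite F \<and> F \<subseteq> cone_semigroup m \<sigma> \<and> f i = (\<lambda>(\<tau>, x). \<Sum>u\<in>F. c u * x u)"
    using assms(2) unfolding coordinate_ring_def by blast
  from bchoice[OF this] obtain F where "\<forall>i\<in>I. \<exists>c. finite (F i) \<and> F i \<subseteq> cone_semigroup m \<sigma> \<and>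
      f i = (\<lambda>(\<tau>, x). \<Sum>u\<in>F i. c u * x u)" by blast
  from bchoice[OF this] obtain c where Fc: "\<forall>i\<in>I. finite (F i) \<and> F i \<subseteq> cone_semigroup m \<sigma> \<and>
      f i = (\<lambda>(\<tau>, x). \<Sum>u\<in>F i. c i u * x u)" by blast
  define G where "G = (\<Union>i\<in>I. F i)"
  define d where "d = (\<lambda>u. \<Sum>i\<in>I. if u \<in> F i then c i u else 0)"
  have G: "finite G" "G \<subseteq> cone_semigroup m \<sigma>" unfolding G_def using assms(1) Fc by blast+
  have sub: "F i \<subseteq> G" if "i \<in> I" for i using that by (auto simp: G_def)
  have "(\<Sum>i\<in>I. f i (\<tau>, x)) = (\<Sum>u\<in>G. d u * x u)" for \<tau> and x :: "int vec \<Rightarrow> complex"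
  proof -
    have "f i (\<tau>, x) = (\<Sum>u\<in>G. (if u \<in> F i then c i u else 0) * x u)" if i: "i \<in> I" for i
    proof -
      have "f i (\<tau>, x) = (\<Sum>u\<in>F i. c i u * x u)" using bspec[OF Fc i] by simp
      also have "\<dots> = (\<Sum>u\<in>G. (if u \<in> F i then c i u else 0) * x u)"
        using G(1) sub[OF i] by (intro sum.mono_neutral_cong_left) auto
      finally show ?thesis .
    qed
    then have "(\<Sum>i\<in>I. f i (\<tau>, x)) = (\<Sum>i\<in>I. \<Sum>u\<in>G. (if u \<in> F i then c i u else 0) * x u)"
      by (rule sum.cong[OF refl])
    also have "\<dots> = (\<Sum>u\<in>G. d u * x u)"
      unfolding d_def by (subst sum.swap) (simp add: sum_distrib_right)
    finally show ?thesis .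
  qed
  then have "(\<Sum>i\<in>I. f i p) = (\<lambda>(\<tau>, x). \<Sum>u\<in>G. d u * x u) p" for p
    by (cases p) (simp only: case_prod_conv)
  then have "(\<lambda>p. \<Sum>i\<in>I. f i p) = (\<lambda>(\<tau>, x). \<Sum>u\<in>G. d u * x u)" by (rule ext)
  then show ?thesis
    unfolding coordinate_ring_def using G(1) G(2)
    by (intro CollectI exI[of _ G] exI[of _ d] conjI)
qed

text \<open>Only on the chart are the functions \<open>x\<close> known to be multiplicative on the
  semigroup of \<open>\<sigma>\<close>, so the product is matched by an element of the ring on the
  chart and not as a function on all pairs.\<close>

lemma coordinate_ring_mult:
  assumes "\<sigma> \<subseteq> carrier_vec m" "f \<in> coordinate_ring m \<sigma>" "g \<in> coordinate_ring m \<sigma>"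
  shows "\<exists>h\<in>coordinate_ring m \<sigma>. \<forall>p\<in>affine_chart m \<Sigma> \<sigma>. h p = f p * g p"
proof -
  obtain F c where F: "finite F" "F \<subseteq> cone_semigroup m \<sigma>" "f = (\<lambda>(\<tau>, x). \<Sum>u\<in>F. c u * x u)"
    using assms(2) unfolding coordinate_ring_def by blast
  obtain G d where G: "finite G" "G \<subseteq> cone_semigroup m \<sigma>" "g = (\<lambda>(\<tau>, x). \<Sum>u\<in>G. d u * x u)"
    using assms(3) unfolding coordinate_ring_def by blast
  let ?h = "\<lambda>p. \<Sum>i\<in>F \<times> G. (\<lambda>(\<tau>, x). (c (fst i) * d (snd i)) * x (fst i + snd i)) p"
  have h: "?h \<in> coordinate_ring m \<sigma>"
  proof (rule coordinate_ring_sum)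
    show "finite (F \<times> G)" using F G by simp
    fix i assume "i \<in> F \<times> G"
    then have "fst i + snd i \<in> cone_semigroup m \<sigma>"
      using F(2) G(2) assms(1) by (intro cone_semigroup_add) auto
    then show "(\<lambda>(\<tau>, x). c (fst i) * d (snd i) * x (fst i + snd i)) \<in> coordinate_ring m \<sigma>"
      by (rule coordinate_ring_monomial)
  qed
  have "?h p = f p * g p" if "p \<in> affine_chart m \<Sigma> \<sigma>" for p
  proof -
    obtain \<tau> x where p: "p = (\<tau>, x)" "\<tau> \<subseteq> \<sigma>" "x \<in> cone_orbit m \<tau>"
      using \<open>p \<in> affine_chart m \<Sigma> \<sigma>\<close> by (auto simp: affine_chart_def)
    have "?h p = (\<Sum>u\<in>F. \<Sum>v\<in>G. c u * d v * x (u + v))"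
      by (simp add: p sum.cartesian_product case_prod_unfold)
    also have "\<dots> = (\<Sum>u\<in>F. \<Sum>v\<in>G. (c u * x u) * (d v * x v))"
    proof (intro sum.cong refl)
      fix u v assume "u \<in> F" "v \<in> G"
      then have "u \<in> cone_semigroup m \<tau>" "v \<in> cone_semigroup m \<tau>"
        using F(2) G(2) cone_semigroup_mono[OF p(2), of m] by blast+
      then have "x (u + v) = x u * x v" using cone_orbit_mult[OF _ p(3)] p(2) assms(1) by blast
      then show "c u * d v * x (u + v) = (c u * x u) * (d v * x v)" by simp
    qed
    also have "\<dots> = f p * g p" by (simp add: F(3) G(3) p(1) sum_product)
    finally show ?thesis .
  qed
  then show ?thesis by (intro bexI[OF _ h] ballI)
qed

text \<open>Common to the coordinate permutations and the two projections of a product: all of them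
  act on points by precomposition with an additive map \<open>h\<close> of characters.\<close>

lemma cone_orbit_pullback:
  assumes x: "x \<in> cone_orbit m \<tau>"
    and h: "\<And>u. u \<in> carrier_vec n \<Longrightarrow> h u \<in> cone_perp m \<tau> \<longleftrightarrow> u \<in> cone_perp n \<tau>'"
    and add: "\<And>u v. u \<in> carrier_vec n \<Longrightarrow> v \<in> carrier_vec n \<Longrightarrow> h (u + v) = h u + h v"
  shows "(\<lambda>u. if u \<in> carrier_vec n then x (h u) else 0) \<in> cone_orbit n \<tau>'" (is "?y \<in> _")
proof -
  have carr: "u \<in> carrier_vec n" if "u \<in> cone_perp n \<tau>'" for u
    using that by (simp add: cone_perp_def)
  have "?y u \<noteq> 0 \<longleftrightarrow> u \<in> cone_perp n \<tau>'" for u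
    using h[of u] carr[of u] x by (cases "u \<in> carrier_vec n") (auto simp: cone_orbit_def)
  moreover have "?y (u + v) = ?y u * ?y v" if uv: "u \<in> cone_perp n \<tau>'" "v \<in> cone_perp n \<tau>'" for u v
    using carr[OF uv(1)] carr[OF uv(2)] uv h add x by (simp add: cone_orbit_def)
  ultimately show ?thesis unfolding cone_orbit_def by simp
qed

text \<open>The cones \<open>\<tau>\<close> and \<open>\<tau>'\<close> are unrelated because
  coordinate functions read only the second component of a point.\<close>

lemma coordinate_ring_pullback:
  assumes f: "f \<in> coordinate_ring m \<sigma>" and h: "\<And>u. u \<in> cone_semigroup m \<sigma> \<Longrightarrow> h u \<in> cone_semigroup n \<sigma>'"
  obtains a where "a \<in> coordinate_ring n \<sigma>'"
    "\<And>\<tau> \<tau>' x. a (\<tau>, x) = f (\<tau>', \<lambda>u. if u \<in> carrier_vec m then x (h u) else 0)"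
proof -
  obtain F d where F: "finite F" "F \<subseteq> cone_semigroup m \<sigma>" "f = (\<lambda>(\<tau>, x). \<Sum>u\<in>F. d u * x u)"
    using f unfolding coordinate_ring_def by blast
  have carr: "u \<in> carrier_vec m" if "u \<in> F" for u using that F(2) by (auto simp: cone_semigroup_def)
  let ?a = "\<lambda>p. \<Sum>u\<in>F. (\<lambda>(\<tau> :: real vec set, x). d u * x (h u)) p"
  show thesis
  proof (rule that[of ?a])
    show "?a \<in> coordinate_ring n \<sigma>'"
      using F(2) h by (intro coordinate_ring_sum[OF F(1)] coordinate_ring_monomial) blast
    show "?a (\<tau>, x) = f (\<tau>', \<lambda>u. if u \<in> carrier_vec m then x (h u) else 0)" for \<tau> \<tau>' x
      unfolding F(3) case_prod_conv by (intro sum.cong refl) (simp add: carr)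
  qed
qed

text \<open>Artin's argument: if \<open>s\<close> separates the characters \<open>i\<close> and
  \<open>j\<close>, then the relation translated by \<open>s\<close> minus \<open>\<chi> j s\<close>
  times the relation itself no longer involves \<open>j\<close> and gives \<open>i\<close> the
  coefficient \<open>a i * (\<chi> i s - \<chi> j s)\<close>. The form with an indexed family on a
  set \<open>T\<close> suits the application, which mixes two kinds of characters on a torus that is
  not a type.\<close>

lemma characters_independent:
  fixes \<chi> :: "'i \<Rightarrow> 't \<Rightarrow> 'k :: idom"
  assumes "finite I"
    and closed: "\<And>t s. t \<in> T \<Longrightarrow> s \<in> T \<Longrightarrow> f t s \<in> T"
    and mult: "\<And>i t s. i \<in> I \<Longrightarrow> t \<in> T \<Longrightarrow> s \<in> T \<Longrightarrow> \<chi> i (f t s) = \<chi> i t * \<chi> i s"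
    and e: "e \<in> T" "\<And>i. i \<in> I \<Longrightarrow> \<chi> i e = 1"
    and distinct: "\<And>i j. i \<in> I \<Longrightarrow> j \<in> I \<Longrightarrow> i \<noteq> j \<Longrightarrow> \<exists>t\<in>T. \<chi> i t \<noteq> \<chi> j t"
    and zero: "\<And>t. t \<in> T \<Longrightarrow> (\<Sum>i\<in>I. a i * \<chi> i t) = 0"
  shows "\<forall>i\<in>I. a i = 0"
  using \<open>finite I\<close> mult e(2) distinct zero
proof (induction I arbitrary: a rule: finite_induct)
  case (insert j J)
  note mult = insert.prems(1) and one = insert.prems(2) and distinct = insert.prems(3)
    and zero = insert.prems(4)
  have "a i = 0" if "i \<in> J" for i
  proof -
    have "i \<noteq> j" using that insert.hyps by auto
    then obtain s where s: "s \<in> T" "\<chi> i s \<noteq> \<chi> j s" using distinct[of i j] \<open>i \<in> J\<close> by auto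
    have "(\<Sum>i\<in>J. (a i * (\<chi> i s - \<chi> j s)) * \<chi> i t) = 0" if t: "t \<in> T" for t
    proof -
      have "(\<Sum>i\<in>insert j J. a i * (\<chi> i t * \<chi> i s)) = (\<Sum>i\<in>insert j J. a i * \<chi> i (f t s))"
        by (intro sum.cong refl) (simp only: mult[OF _ t s(1)])
      also have "\<dots> = 0" by (rule zero[OF closed[OF t s(1)]])
      finally have 1: "(\<Sum>i\<in>insert j J. a i * (\<chi> i t * \<chi> i s)) = 0" .
      have "(\<Sum>i\<in>insert j J. (a i * (\<chi> i s - \<chi> j s)) * \<chi> i t) =
          (\<Sum>i\<in>insert j J. a i * (\<chi> i t * \<chi> i s)) - (\<Sum>i\<in>insert j J. a i * \<chi> i t) * \<chi> j s"
        unfolding sum_distrib_right sum_subtractf[symmetric]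
        by (intro sum.cong refl) (simp only: right_diff_distrib left_diff_distrib mult_ac)
      also have "\<dots> = 0" by (simp only: 1 zero[OF t]) simp
      finally show ?thesis using insert.hyps by simp
    qed
    then have "\<forall>i\<in>J. a i * (\<chi> i s - \<chi> j s) = 0"
      using mult one distinct by (intro insert.IH) auto
    then show ?thesis using s(2) \<open>i \<in> J\<close> by auto
  qed
  moreover from this have "a j = 0" using zero[OF e(1)] one[of j] insert.hyps by simp
  ultimately show ?case by auto
qed simp

section \<open>Families of cones and their charts\<close>

text \<open>The properties of a fan on which the passage to lattice maps rests: the zero cone, whose
  chart is the torus, and finitely many integral generators of each cone, from which interior
  lattice points are built.\<close>

definition cone_family :: "nat \<Rightarrow> real vec set set \<Rightarrow> bool" where
  "cone_family m \<Sigma> \<longleftrightarrow> {0\<^sub>v m} \<in> \<Sigma> \<and>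
     (\<forall>\<sigma>\<in>\<Sigma>. \<exists>T. finite T \<and> T \<subseteq> carrier_vec m \<and> \<sigma> = cone_spanned m T)"

lemma cone_familyD:
  assumes "cone_family m \<Sigma>"
  shows "{0\<^sub>v m} \<in> \<Sigma>" "\<sigma> \<in> \<Sigma> \<Longrightarrow> \<sigma> \<subseteq> carrier_vec m" "\<sigma> \<in> \<Sigma> \<Longrightarrow> 0\<^sub>v m \<in> \<sigma>"
  using assms cone_spanned_carrier zero_in_cone_spanned unfolding cone_family_def by fast+

lemma charts_fan_variety:
  "(U, A) \<in> charts (fan_variety m \<Sigma>) \<longleftrightarrow>
     (\<exists>\<sigma>\<in>\<Sigma>. U = affine_chart m \<Sigma> \<sigma> \<and> A = coordinate_ring m \<sigma>)"
  by (auto simp: fan_variety_def)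

lemma points_fan_variety: "points (fan_variety m \<Sigma>) = {(\<tau>, x). \<tau> \<in> \<Sigma> \<and> x \<in> cone_orbit m \<tau>}"
  by (auto simp: points_def fan_variety_def affine_chart_def)

lemma zero_in_cone_semigroup: "\<sigma> \<subseteq> carrier_vec m \<Longrightarrow> 0\<^sub>v m \<in> cone_semigroup m \<sigma>"
  and zero_in_cone_perp: "\<sigma> \<subseteq> carrier_vec m \<Longrightarrow> 0\<^sub>v m \<in> cone_perp m \<sigma>"
  by (auto simp: cone_semigroup_def cone_perp_def pairing_def scalar_prod_eq_sum[of _ m] subset_iff)

text \<open>The value is nonzero and equal to its square. So the character of the zero vector is the
  constant 1 on every chart; the next two lemmas use it as a nonvanishing function and as a
  denominator.\<close>

lemma cone_orbit_at_zero:
  assumes "x \<in> cone_orbit m \<tau>" "\<tau> \<subseteq> carrier_vec m"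
  shows "x (0\<^sub>v m) = 1"
proof -
  have "x (0\<^sub>v m + 0\<^sub>v m) = x (0\<^sub>v m) * x (0\<^sub>v m)" and "x (0\<^sub>v m) \<noteq> 0"
    using assms(1) zero_in_cone_perp[OF assms(2)] unfolding cone_orbit_def by blast+
  then show ?thesis by simp
qed

lemma zariski_open_affine_chart:
  assumes "cone_family m \<Sigma>" "\<sigma> \<in> \<Sigma>"
  shows "zariski_open (fan_variety m \<Sigma>) (affine_chart m \<Sigma> \<sigma>)"
  unfolding zariski_open_def
proof (intro conjI ballI)
  show "affine_chart m \<Sigma> \<sigma> \<subseteq> points (fan_variety m \<Sigma>)"
    by (auto simp: affine_chart_def points_fan_variety)
  fix p assume p: "p \<in> affine_chart m \<Sigma> \<sigma>"
  have "(\<lambda>(\<tau>, x). 1 * x (0\<^sub>v m)) \<in> coordinate_ring m \<sigma>"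
    using cone_familyD(2)[OF assms] by (intro coordinate_ring_monomial zero_in_cone_semigroup)
  moreover have "(\<lambda>(\<tau>, x). 1 * x (0\<^sub>v m)) p \<noteq> (0 :: complex)"
    using p cone_orbit_at_zero[OF _ cone_familyD(2)[OF assms(1)]]
    by (force simp: affine_chart_def)
  ultimately show "\<exists>(U, A)\<in>charts (fan_variety m \<Sigma>).
      p \<in> U \<and> (\<exists>g\<in>A. g p \<noteq> 0 \<and> {q \<in> U. g q \<noteq> 0} \<subseteq> affine_chart m \<Sigma> \<sigma>)"
    using p assms(2)
    by (intro bexI[of _ "(affine_chart m \<Sigma> \<sigma>, coordinate_ring m \<sigma>)"])
       (auto simp: charts_fan_variety)
qed

lemma regular_on_affine_chart:
  assumes "cone_family m \<Sigma>" "\<sigma> \<in> \<Sigma>" "u \<in> cone_semigroup m \<sigma>"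
  shows "regular_on (fan_variety m \<Sigma>) (affine_chart m \<Sigma> \<sigma>) (\<lambda>(\<tau>, x). x u)"
  unfolding regular_on_def
proof (intro ballI)
  fix p assume p: "p \<in> affine_chart m \<Sigma> \<sigma>"
  let ?f = "\<lambda>(\<tau> :: real vec set, x). 1 * x u :: complex"
  let ?g = "\<lambda>(\<tau> :: real vec set, x). 1 * x (0\<^sub>v m) :: complex"
  have f: "?f \<in> coordinate_ring m \<sigma>" and g: "?g \<in> coordinate_ring m \<sigma>"
    using cone_familyD(2)[OF assms(1,2)] assms(3)
    by (intro coordinate_ring_monomial zero_in_cone_semigroup; simp)+
  have one: "?g q = 1" if "q \<in> affine_chart m \<Sigma> \<sigma>" for q
    using that cone_orbit_at_zero[OF _ cone_familyD(2)[OF assms(1)]]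
    by (force simp: affine_chart_def)
  show "\<exists>(U, A)\<in>charts (fan_variety m \<Sigma>). p \<in> U \<and> (\<exists>f\<in>A. \<exists>g\<in>A. g p \<noteq> 0 \<and>
      (\<forall>q\<in>affine_chart m \<Sigma> \<sigma> \<inter> U. g q \<noteq> 0 \<longrightarrow> (\<lambda>(\<tau>, x). x u) q = f q / g q))"
    using p assms(2) one
    by (intro bexI[of _ "(affine_chart m \<Sigma> \<sigma>, coordinate_ring m \<sigma>)"] case_prodI conjI
          bexI[OF _ f] bexI[OF _ g])
       (auto simp: charts_fan_variety)
qed

section \<open>One-parameter subgroups and their limits\<close>

text \<open>The point with parameter \<open>z\<close> on the one-parameter subgroup of the
  cocharacter \<open>s\<close>. With \<open>s\<close> zero and \<open>z = 1\<close> it is the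
  neutral element of the torus.\<close>

definition one_parameter :: "nat \<Rightarrow> int vec \<Rightarrow> complex \<Rightarrow> int vec \<Rightarrow> complex" where
  "one_parameter m s z = (\<lambda>u. if u \<in> carrier_vec m then z powi (u \<bullet> s) else 0)"

lemma one_parameter_orbit:
  assumes "z \<noteq> 0" "s \<in> carrier_vec m"
  shows "one_parameter m s z \<in> cone_orbit m {0\<^sub>v m}"
  using assms
  by (auto simp: cone_orbit_def cone_perp_zero one_parameter_def power_int_add add_scalar_prod_distrib[of _ m])

definition distinguished_point :: "nat \<Rightarrow> real vec set \<Rightarrow> toric_point" where
  "distinguished_point m \<tau> = (\<tau>, \<lambda>u. if u \<in> cone_perp m \<tau> then 1 else 0)"

lemma distinguished_point_orbit:
  assumes "\<tau> \<subseteq> carrier_vec m"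
  shows "(\<lambda>u. if u \<in> cone_perp m \<tau> then 1 else 0) \<in> cone_orbit m \<tau>"
proof -
  have "u + v \<in> cone_perp m \<tau>" if "u \<in> cone_perp m \<tau>" "v \<in> cone_perp m \<tau>" for u v
    using that assms by (auto simp: cone_perp_def pairing_add[of _ m] subset_iff)
  then show ?thesis by (auto simp: cone_orbit_def)
qed

text \<open>Lattice points in the relative interior, expressed through the semigroup instead of the
  generators: the character \<open>u\<close> restricts to the power \<open>u \<bullet> s\<close> of
  \<open>z\<close>, and its limit at 0 depends on whether this exponent is positive or 0.\<close>

definition cone_interior :: "nat \<Rightarrow> real vec set \<Rightarrow> int vec \<Rightarrow> bool" where
  "cone_interior m \<tau> s \<longleftrightarrow> s \<in> carrier_vec m \<and>
     (\<forall>u\<in>cone_semigroup m \<tau>. 0 \<le> u \<bullet> s \<and> (u \<bullet> s = 0 \<longrightarrow> u \<in> cone_perp m \<tau>))"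

text \<open>As \<open>z\<close> tends to \<open>0\<close>, the one-parameter subgroup of an interior lattice point of \<open>\<tau>\<close>
  converges to the distinguished point of the orbit of \<open>\<tau>\<close>, as seen by regular functions.\<close>

lemma coordinate_ring_tendsto:
  assumes "f \<in> coordinate_ring m \<sigma>" "\<tau> \<subseteq> \<sigma>" "cone_interior m \<tau> s" "\<sigma> \<subseteq> carrier_vec m"
  shows "((\<lambda>z. f ({0\<^sub>v m}, one_parameter m s z)) \<longlongrightarrow> f (distinguished_point m \<tau>)) (at 0)"
proof -
  obtain F c where F: "F \<subseteq> cone_semigroup m \<sigma>" "f = (\<lambda>(\<tau>, x). \<Sum>u\<in>F. c u * x u)"
    using assms(1) unfolding coordinate_ring_def by blast
  have "((\<lambda>z. one_parameter m s z u) \<longlongrightarrow> (if u \<in> cone_perp m \<tau> then 1 else 0)) (at 0)" if "u \<in> F" for u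
  proof -
    have u: "u \<in> cone_semigroup m \<tau>" using that F(1) cone_semigroup_mono[OF assms(2)] by blast
    then have uc: "u \<in> carrier_vec m" by (simp add: cone_semigroup_def)
    have nonneg: "0 \<le> u \<bullet> s" and perp: "u \<bullet> s = 0 \<longrightarrow> u \<in> cone_perp m \<tau>"
      using assms(3) u by (auto simp: cone_interior_def)
    have "isCont (\<lambda>z :: complex. z ^ nat (u \<bullet> s)) 0" by (intro continuous_intros)
    then have "((\<lambda>z :: complex. z ^ nat (u \<bullet> s)) \<longlongrightarrow> 0 ^ nat (u \<bullet> s)) (at 0)" by (simp add: isCont_def)
    moreover have "one_parameter m s z u = z ^ nat (u \<bullet> s)" for z
      using uc nonneg by (simp add: one_parameter_def power_int_def)
    moreover have "u \<bullet> s = 0" if "u \<in> cone_perp m \<tau>"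
    proof -
      have "-u \<in> cone_semigroup m \<tau>" using that cone_perp_eq assms(2,4) by blast
      then have "0 \<le> (-u) \<bullet> s" using assms(3) by (auto simp: cone_interior_def)
      moreover have "s \<in> carrier_vec m" using assms(3) by (simp add: cone_interior_def)
      then have "(-u) \<bullet> s = - (u \<bullet> s)" using uc by simp
      ultimately show ?thesis using nonneg by simp
    qed
    \<comment> \<open>As \<open>0 ^ 0 = 1\<close>, a single power describes both possible
      limits.\<close>
    then have "(if u \<in> cone_perp m \<tau> then 1 else 0 :: complex) = 0 ^ nat (u \<bullet> s)"
      using nonneg perp by auto
    ultimately show ?thesis by simp
  qed
  then show ?thesis
    unfolding F(2) distinguished_point_def by (auto intro!: tendsto_intros)
qed


lemma one_parameter_in_affine_chart:
  assumes "cone_family m \<Sigma>" "\<sigma> \<in> \<Sigma>" "z \<noteq> 0" "s \<in> carrier_vec m"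
  shows "({0\<^sub>v m}, one_parameter m s z) \<in> affine_chart m \<Sigma> \<sigma>"
  using assms cone_familyD one_parameter_orbit by (auto simp: affine_chart_def)

lemma zariski_open_eventually:
  assumes "cone_family m \<Sigma>" "zariski_open (fan_variety m \<Sigma>) W" "distinguished_point m \<tau> \<in> W"
    "cone_interior m \<tau> s"
  shows "\<forall>\<^sub>F z in at 0. ({0\<^sub>v m}, one_parameter m s z) \<in> W"
proof -
  obtain \<sigma> g where g: "\<sigma> \<in> \<Sigma>" "distinguished_point m \<tau> \<in> affine_chart m \<Sigma> \<sigma>" "g \<in> coordinate_ring m \<sigma>"
    "g (distinguished_point m \<tau>) \<noteq> 0" "{q \<in> affine_chart m \<Sigma> \<sigma>. g q \<noteq> 0} \<subseteq> W"
    using assms(2,3) unfolding zariski_open_def by (fastforce simp: charts_fan_variety)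
  have "\<tau> \<subseteq> \<sigma>" using g(2) by (auto simp: affine_chart_def distinguished_point_def)
  then have "((\<lambda>z. g ({0\<^sub>v m}, one_parameter m s z)) \<longlongrightarrow> g (distinguished_point m \<tau>)) (at 0)"
    using coordinate_ring_tendsto[OF g(3) _ assms(4)] cone_familyD(2)[OF assms(1) g(1)] by blast
  then have "\<forall>\<^sub>F z in at 0. g ({0\<^sub>v m}, one_parameter m s z) \<noteq> 0"
    using g(4) by (rule tendsto_imp_eventually_ne)
  moreover have "\<forall>\<^sub>F z in at 0. z \<noteq> (0 :: complex)" by (rule eventually_neq_at_within)
  ultimately show ?thesis
  proof eventually_elim
    case (elim z)
    then show ?case using one_parameter_in_affine_chart[OF assms(1) g(1)] assms(4) g(5)
      by (auto simp: cone_interior_def)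
  qed
qed

text \<open>\<open>h\<close> agrees with the quotient only inside \<open>W\<close> and where the
  denominator is nonzero, so the curve has to satisfy both near 0 before the limits of numerator and
  denominator can be divided.\<close>

lemma regular_on_tendsto:
  assumes "cone_family m \<Sigma>" "zariski_open (fan_variety m \<Sigma>) W" "distinguished_point m \<tau> \<in> W"
    "cone_interior m \<tau> s" "regular_on (fan_variety m \<Sigma>) W h"
  shows "((\<lambda>z. h ({0\<^sub>v m}, one_parameter m s z)) \<longlongrightarrow> h (distinguished_point m \<tau>)) (at 0)"
proof -
  let ?p = "distinguished_point m \<tau>" and ?q = "\<lambda>z. ({0\<^sub>v m}, one_parameter m s z)"
  from assms(3,5) have "\<exists>(U, A)\<in>charts (fan_variety m \<Sigma>). ?p \<in> U \<and>
        (\<exists>f\<in>A. \<exists>g\<in>A. g ?p \<noteq> 0 \<and> (\<forall>q\<in>W \<inter> U. g q \<noteq> 0 \<longrightarrow> h q = f q / g q))"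
    unfolding regular_on_def by blast
  then obtain \<sigma> f g where fg: "\<sigma> \<in> \<Sigma>" "?p \<in> affine_chart m \<Sigma> \<sigma>"
    "f \<in> coordinate_ring m \<sigma>" "g \<in> coordinate_ring m \<sigma>" "g ?p \<noteq> 0"
    "\<And>q. q \<in> W \<Longrightarrow> q \<in> affine_chart m \<Sigma> \<sigma> \<Longrightarrow> g q \<noteq> 0 \<Longrightarrow> h q = f q / g q"
    by (fastforce simp: charts_fan_variety)
  have sub: "\<tau> \<subseteq> \<sigma>" "\<sigma> \<subseteq> carrier_vec m"
    using fg(2) cone_familyD(2)[OF assms(1) fg(1)]
    by (auto simp: affine_chart_def distinguished_point_def)
  have lim: "((\<lambda>z. f (?q z)) \<longlongrightarrow> f ?p) (at 0)" "((\<lambda>z. g (?q z)) \<longlongrightarrow> g ?p) (at 0)"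
    using coordinate_ring_tendsto[OF _ sub(1) assms(4) sub(2)] fg(3,4) by blast+
  have "\<forall>\<^sub>F z in at 0. g (?q z) \<noteq> 0"
    using lim(2) fg(5) by (rule tendsto_imp_eventually_ne)
  moreover have "\<forall>\<^sub>F z in at 0. ?q z \<in> W" by (rule zariski_open_eventually[OF assms(1-4)])
  moreover have "\<forall>\<^sub>F z in at 0. z \<noteq> (0 :: complex)" by (rule eventually_neq_at_within)
  ultimately have ev: "\<forall>\<^sub>F z in at 0. f (?q z) / g (?q z) = h (?q z)"
  proof eventually_elim
    case (elim z)
    then show ?case
      using one_parameter_in_affine_chart[OF assms(1) fg(1)] assms(4) fg(6)[of "?q z"]
      by (auto simp: cone_interior_def)
  qed
  have "?p \<in> W \<and> ?p \<in> affine_chart m \<Sigma> \<sigma>" using assms(3) fg(2) by blast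
  then have "h ?p = f ?p / g ?p" using fg(5,6) by blast
  moreover have "((\<lambda>z. f (?q z) / g (?q z)) \<longlongrightarrow> f ?p / g ?p) (at 0)"
    using lim fg(5) by (intro tendsto_divide)
  ultimately show ?thesis using ev by (simp add: tendsto_cong)
qed

text \<open>If \<open>k = - n\<close> were negative, the product of \<open>z ^ n\<close> and
  \<open>z powi k\<close> would be 1 near 0 and yet tend to \<open>0 * l\<close>.\<close>

lemma powi_tendsto_imp_nonneg:
  assumes "((\<lambda>z :: complex. z powi k) \<longlongrightarrow> l) (at 0)"
  shows "0 \<le> k"
proof (rule ccontr)
  assume "\<not> 0 \<le> k"
  define n where "n = nat (- k)"
  have n: "k = - int n" "n > 0" using \<open>\<not> 0 \<le> k\<close> by (auto simp: n_def)
  have "isCont (\<lambda>z :: complex. z ^ n) 0" by (intro continuous_intros)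
  then have "((\<lambda>z :: complex. z ^ n) \<longlongrightarrow> 0) (at 0)" using n(2) by (simp add: isCont_def zero_power)
  then have "((\<lambda>z :: complex. z ^ n * z powi k) \<longlongrightarrow> 0 * l) (at 0)"
    using assms by (rule tendsto_mult)
  moreover have "\<forall>\<^sub>F z in at 0. z ^ n * z powi k = (1 :: complex)"
    using eventually_neq_at_within[of 0 "0 :: complex" UNIV]
  proof eventually_elim
    case (elim z)
    then show ?case unfolding n(1) power_int_minus power_int_of_nat by simp
  qed
  ultimately have "((\<lambda>z :: complex. 1 :: complex) \<longlongrightarrow> 0 * l) (at 0)"
    by (rule Lim_transform_eventually)
  then have "(1 :: complex) = 0 * l" by (intro tendsto_unique[OF _ tendsto_const]) auto
  then show False by simp
qed

text \<open>The sum of all generators is interior, and stays so when a multiple of one generator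
  \<open>t\<close> is added. Limits give information about interior points only; a large
  \<open>N\<close> makes such a point test the pairing with \<open>t\<close> itself.\<close>

lemma cone_interior_exists:
  assumes "finite T" "T \<subseteq> carrier_vec m" "t \<in> T" "0 \<le> N"
  shows "\<exists>s. cone_interior m (cone_spanned m T) s \<and>
    (\<forall>u\<in>carrier_vec m. u \<bullet> s = N * (u \<bullet> t) + (\<Sum>r\<in>T. u \<bullet> r))"
proof -
  let ?s = "vec m (\<lambda>j. N * (t $ j) + (\<Sum>r\<in>T. r $ j))"
  have eq: "u \<bullet> ?s = N * (u \<bullet> t) + (\<Sum>r\<in>T. u \<bullet> r)" if "u \<in> carrier_vec m" for u
  proof -
    have "(\<Sum>r\<in>T. u \<bullet> r) = (\<Sum>r\<in>T. \<Sum>j<m. u $ j * r $ j)"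
      using assms(2) by (intro sum.cong) (auto simp: scalar_prod_eq_sum[of _ m] subset_iff)
    also have "\<dots> = (\<Sum>j<m. \<Sum>r\<in>T. u $ j * r $ j)" by (rule sum.swap)
    finally have "(\<Sum>r\<in>T. u \<bullet> r) = (\<Sum>j<m. \<Sum>r\<in>T. u $ j * r $ j)" .
    moreover have "u \<bullet> t = (\<Sum>j<m. u $ j * t $ j)"
      using assms(2,3) by (intro scalar_prod_eq_sum) auto
    moreover have "u \<bullet> ?s = (\<Sum>j<m. u $ j * (N * t $ j + (\<Sum>r\<in>T. r $ j)))"
      by (simp add: scalar_prod_eq_sum[of _ m])
    moreover have "\<dots> = N * (\<Sum>j<m. u $ j * t $ j) + (\<Sum>j<m. \<Sum>r\<in>T. u $ j * r $ j)"
      unfolding sum_distrib_left sum.distrib[symmetric]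
      by (intro sum.cong refl) (simp add: distrib_left sum_distrib_left)
    ultimately show ?thesis by simp
  qed
  have nonneg: "0 \<le> u \<bullet> ?s \<and> (u \<bullet> ?s = 0 \<longrightarrow> (\<forall>r\<in>T. u \<bullet> r = 0))"
    if "u \<in> carrier_vec m" "\<forall>r\<in>T. 0 \<le> u \<bullet> r" for u
  proof -
    have N: "0 \<le> N * (u \<bullet> t)" using that(2) assms(3,4) by (intro mult_nonneg_nonneg) auto
    have S: "0 \<le> (\<Sum>r\<in>T. u \<bullet> r)" using that(2) by (intro sum_nonneg) auto
    have "(\<Sum>r\<in>T. u \<bullet> r) = 0 \<longleftrightarrow> (\<forall>r\<in>T. u \<bullet> r = 0)"
      using that(2) by (intro sum_nonneg_eq_0_iff[OF assms(1)]) auto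
    then show ?thesis using N S unfolding eq[OF that(1)] by linarith
  qed
  have "?s \<in> carrier_vec m" by simp
  then have "cone_interior m (cone_spanned m T) ?s"
    unfolding cone_interior_def cone_semigroup_cone_spanned[OF assms(1,2)]
      cone_perp_cone_spanned[OF assms(1,2)] using nonneg by blast
  then show ?thesis using eq by blast
qed

lemma cone_semigroupI_interior:
  assumes "cone_family m \<Sigma>" "\<tau> \<in> \<Sigma>" "u \<in> carrier_vec m" "\<And>s. cone_interior m \<tau> s \<Longrightarrow> 0 \<le> u \<bullet> s"
  shows "u \<in> cone_semigroup m \<tau>"
proof -
  obtain T where T: "finite T" "T \<subseteq> carrier_vec m" "\<tau> = cone_spanned m T"
    using assms(1,2) unfolding cone_family_def by blast
  have "0 \<le> u \<bullet> t" if t: "t \<in> T" for t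
  proof (rule ccontr)
    assume neg: "\<not> 0 \<le> u \<bullet> t"
    define K where "K = (\<Sum>r\<in>T. u \<bullet> r)"
    \<comment> \<open>\<open>u \<bullet> t\<close> is a negative integer, hence at most -1, so
      \<open>N\<close> copies of it outweigh \<open>K\<close>.\<close>
    define N where "N = \<bar>K\<bar> + 1"
    obtain s where s: "cone_interior m \<tau> s" "u \<bullet> s = N * (u \<bullet> t) + K"
      using cone_interior_exists[OF T(1,2) t, of N] T(3) assms(3) unfolding K_def N_def by auto
    have "N * (u \<bullet> t) \<le> N * (-1)" using neg unfolding N_def by (intro mult_left_mono) auto
    then have "u \<bullet> s \<le> K - N" using s(2) by simp
    then show False using assms(4)[OF s(1)] unfolding N_def by linarith
  qed
  then show ?thesis using T assms(3) by (simp add: cone_semigroup_cone_spanned)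
qed

section \<open>Lattice maps dual to toric morphisms\<close>

lemma cone_orbit_zero_mult:
  "x \<in> cone_orbit m {0\<^sub>v m} \<Longrightarrow> u \<in> carrier_vec m \<Longrightarrow> v \<in> carrier_vec m \<Longrightarrow> x (u + v) = x u * x v"
  by (auto simp: cone_orbit_def cone_perp_zero)

lemma cone_orbit_zero_closed:
  "x \<in> cone_orbit m {0\<^sub>v m} \<Longrightarrow> y \<in> cone_orbit m {0\<^sub>v m} \<Longrightarrow> (\<lambda>u. x u * y u) \<in> cone_orbit m {0\<^sub>v m}"
  by (auto simp: cone_orbit_def)

text \<open>The torus point whose coordinate \<open>j\<close> is 2 and whose other coordinates are 1
  turns a difference in entry \<open>j\<close> into different powers of 2. Identities between
  characters can therefore be checked on torus points.\<close>

lemma cone_orbit_separates: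
  assumes "u \<in> carrier_vec m" "w \<in> carrier_vec m" "u \<noteq> w"
  shows "\<exists>t\<in>cone_orbit m {0\<^sub>v m}. t u \<noteq> t w"
proof -
  obtain j where j: "j < m" "u $ j \<noteq> w $ j" using assms by (metis carrier_vecD eq_vecI)
  have inj: "a = b" if "(2 :: complex) powi a = 2 powi b" for a b
  proof -
    have "norm ((2 :: complex) powi a) = norm ((2 :: complex) powi b)" using that by simp
    then have "(2 :: real) powi a = 2 powi b" by (simp add: norm_power_int)
    then show ?thesis
      using power_int_strict_increasing[of a b "2 :: real"] power_int_strict_increasing[of b a "2 :: real"]
      by (cases a b rule: linorder_cases) auto
  qed
  have "one_parameter m (unit_vec m j) 2 \<in> cone_orbit m {0\<^sub>v m}" by (rule one_parameter_orbit) auto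
  moreover have "one_parameter m (unit_vec m j) 2 u \<noteq> one_parameter m (unit_vec m j) 2 w"
    using assms j inj by (auto simp: one_parameter_def)
  ultimately show ?thesis by blast
qed

lemma fan_torus_hom:
  assumes "\<phi> \<in> hom (fan_torus m) (fan_torus m')" "t \<in> cone_orbit m {0\<^sub>v m}"
  shows "fst (\<phi> ({0\<^sub>v m}, t)) = {0\<^sub>v m'}" "snd (\<phi> ({0\<^sub>v m}, t)) \<in> cone_orbit m' {0\<^sub>v m'}"
    "t' \<in> cone_orbit m {0\<^sub>v m} \<Longrightarrow>
      snd (\<phi> ({0\<^sub>v m}, \<lambda>u. t u * t' u)) w = snd (\<phi> ({0\<^sub>v m}, t)) w * snd (\<phi> ({0\<^sub>v m}, t')) w"
proof -
  have "\<phi> ({0\<^sub>v m}, t) \<in> {{0\<^sub>v m'}} \<times> cone_orbit m' {0\<^sub>v m'}"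
    using assms by (auto simp: hom_def fan_torus_def Pi_iff)
  then show "fst (\<phi> ({0\<^sub>v m}, t)) = {0\<^sub>v m'}" "snd (\<phi> ({0\<^sub>v m}, t)) \<in> cone_orbit m' {0\<^sub>v m'}" by auto
  assume t': "t' \<in> cone_orbit m {0\<^sub>v m}"
  have "\<forall>x\<in>carrier (fan_torus m). \<forall>y\<in>carrier (fan_torus m).
      \<phi> (x \<otimes>\<^bsub>fan_torus m\<^esub> y) = \<phi> x \<otimes>\<^bsub>fan_torus m'\<^esub> \<phi> y"
    using assms(1) by (auto simp: hom_def)
  then have "\<phi> ({0\<^sub>v m}, \<lambda>u. t u * t' u) =
      (\<lambda>(\<tau>, x) (\<tau>', y). ({0\<^sub>v m'}, \<lambda>u. x u * y u)) (\<phi> ({0\<^sub>v m}, t)) (\<phi> ({0\<^sub>v m}, t'))"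
    using assms(2) t' by (simp add: fan_torus_def)
  then show "snd (\<phi> ({0\<^sub>v m}, \<lambda>u. t u * t' u)) w = snd (\<phi> ({0\<^sub>v m}, t)) w * snd (\<phi> ({0\<^sub>v m}, t')) w"
    by (simp add: case_prod_unfold)
qed

text \<open>A multiplicative function on the torus that is a quotient of two Laurent polynomials near
  one point is a character, by the linear independence of characters.\<close>

lemma rational_multiplicative_imp_character:
  fixes \<Sigma> :: "real vec set set"
  assumes mult: "\<And>s t. s \<in> cone_orbit m {0\<^sub>v m} \<Longrightarrow> t \<in> cone_orbit m {0\<^sub>v m} \<Longrightarrow> \<chi> (\<lambda>u. s u * t u) = \<chi> s * \<chi> t"
    and one: "\<chi> (one_parameter m (0\<^sub>v m) 1) = (1 :: complex)"
    and \<sigma>: "\<sigma> \<subseteq> carrier_vec m" "0\<^sub>v m \<in> \<sigma>" "{0\<^sub>v m} \<in> \<Sigma>"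
    and fg: "f \<in> coordinate_ring m \<sigma>" "g \<in> coordinate_ring m \<sigma>" "g ({0\<^sub>v m}, one_parameter m (0\<^sub>v m) 1) \<noteq> 0"
    and quot: "\<And>t. t \<in> cone_orbit m {0\<^sub>v m} \<Longrightarrow> g ({0\<^sub>v m}, t) \<noteq> 0 \<Longrightarrow> \<chi> t = f ({0\<^sub>v m}, t) / g ({0\<^sub>v m}, t)"
  shows "\<exists>w\<in>carrier_vec m. \<forall>t\<in>cone_orbit m {0\<^sub>v m}. \<chi> t = t w"
proof (rule ccontr)
  assume contr: "\<not> ?thesis"
  let ?T = "cone_orbit m {0\<^sub>v m}" and ?e = "one_parameter m (0\<^sub>v m) 1"
  have e: "?e \<in> ?T" by (rule one_parameter_orbit) auto
  have chart: "({0\<^sub>v m}, t) \<in> affine_chart m \<Sigma> \<sigma>" if "t \<in> ?T" for t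
    using that \<sigma> by (auto simp: affine_chart_def)
  \<comment> \<open>\<open>G\<close> is the square of \<open>g\<close> and \<open>H\<close> is
    \<open>f\<close> times \<open>g\<close>. The quotient formula for \<open>\<chi>\<close> holds
    only where \<open>g\<close> is nonzero, but \<open>\<chi>\<close> times \<open>G\<close> equals
    \<open>H\<close> on the whole torus, since both sides vanish with \<open>g\<close>.\<close>
  obtain G where G: "G \<in> coordinate_ring m \<sigma>" "\<forall>p\<in>affine_chart m \<Sigma> \<sigma>. G p = g p * g p"
    using coordinate_ring_mult[OF \<sigma>(1) fg(2,2)] by blast
  obtain H where H: "H \<in> coordinate_ring m \<sigma>" "\<forall>p\<in>affine_chart m \<Sigma> \<sigma>. H p = f p * g p"
    using coordinate_ring_mult[OF \<sigma>(1) fg(1,2)] by blast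
  obtain A a where A: "finite A" "A \<subseteq> cone_semigroup m \<sigma>" "G = (\<lambda>(\<tau>, x). \<Sum>u\<in>A. a u * x u)"
    using G(1) unfolding coordinate_ring_def by blast
  obtain B b where B: "finite B" "B \<subseteq> cone_semigroup m \<sigma>" "H = (\<lambda>(\<tau>, x). \<Sum>u\<in>B. b u * x u)"
    using H(1) unfolding coordinate_ring_def by blast
  have carr: "A \<subseteq> carrier_vec m" "B \<subseteq> carrier_vec m" using A B by (auto simp: cone_semigroup_def)
  have sums: "(\<Sum>u\<in>A. a u * (\<chi> t * t u)) = (\<Sum>u\<in>B. b u * t u)" if t: "t \<in> ?T" for t
  proof -
    have "\<chi> t * G ({0\<^sub>v m}, t) = H ({0\<^sub>v m}, t)"
      using quot[OF t] G(2) H(2) chart[OF t] by (cases "g ({0\<^sub>v m}, t) = 0") auto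
    then show ?thesis using A(3) B(3) by (simp add: sum_distrib_left mult_ac)
  qed
  \<comment> \<open>The identity between \<open>G\<close> and \<open>H\<close> is a linear relation
    between the characters \<open>\<chi>\<close> times \<open>u\<close>, for \<open>u\<close> in
    \<open>A\<close>, and \<open>u\<close>, for \<open>u\<close> in \<open>B\<close>. The disjoint
    sum keeps the two kinds apart even if \<open>A\<close> and \<open>B\<close> meet.\<close>
  define \<psi> where "\<psi> = (\<lambda>i t. case i of Inl u \<Rightarrow> \<chi> t * t u | Inr u \<Rightarrow> t (u :: int vec))"
  define c where "c = (\<lambda>i. case i of Inl u \<Rightarrow> a u | Inr u \<Rightarrow> - b u)"
  have eu: "?e u = 1" if "u \<in> carrier_vec m" for u using that by (simp add: one_parameter_def)
  have \<chi>0: "\<chi> t \<noteq> 0" if t: "t \<in> ?T" for t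
  proof -
    have "(\<lambda>u. if u \<in> carrier_vec m then inverse (t u) else 0) \<in> ?T" (is "?t' \<in> _")
      using t by (auto simp: cone_orbit_def cone_perp_zero)
    moreover have "(\<lambda>u. t u * ?t' u) = ?e"
      using t by (auto simp: cone_orbit_def cone_perp_zero one_parameter_def)
    ultimately have "\<chi> t * \<chi> ?t' = 1" using mult[OF t, of ?t'] one by simp
    then show ?thesis by auto
  qed
  \<comment> \<open>Otherwise \<open>\<chi>\<close> would be the character of \<open>v - u\<close>,
    against \<open>contr\<close>.\<close>
  have ne: "\<exists>t\<in>?T. \<chi> t * t u \<noteq> t v" if "u \<in> carrier_vec m" "v \<in> carrier_vec m" for u v
  proof (rule ccontr)
    assume "\<not> ?thesis"
    then have eq: "\<chi> t * t u = t v" if "t \<in> ?T" for t using that by blast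
    have "\<chi> t = t (v - u)" if t: "t \<in> ?T" for t
    proof -
      have "t (v - u + u) = t (v - u) * t u"
        using t that \<open>u \<in> carrier_vec m\<close> \<open>v \<in> carrier_vec m\<close> by (intro cone_orbit_zero_mult) auto
      moreover have "v - u + u = v" using \<open>u \<in> carrier_vec m\<close> \<open>v \<in> carrier_vec m\<close> by auto
      ultimately have "\<chi> t * t u = t (v - u) * t u" using eq[OF t] by simp
      moreover have "t u \<noteq> 0" using t \<open>u \<in> carrier_vec m\<close> by (auto simp: cone_orbit_def cone_perp_zero)
      ultimately show ?thesis by simp
    qed
    then show False using contr that by (metis minus_carrier_vec)
  qed
  have "\<forall>i\<in>A <+> B. c i = 0"
  proof (rule characters_independent[where T = ?T and f = "\<lambda>s t u. s u * t u" and e = ?e and \<chi> = \<psi>])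
    show "finite (A <+> B)" using A B by simp
    show "?e \<in> ?T" by (rule e)
    show "(\<lambda>u. t u * s u) \<in> ?T" if "t \<in> ?T" "s \<in> ?T" for t s using that by (rule cone_orbit_zero_closed)
    show "\<psi> i (\<lambda>u. t u * s u) = \<psi> i t * \<psi> i s" if "i \<in> A <+> B" "t \<in> ?T" "s \<in> ?T" for i t s
      using that mult by (auto simp: \<psi>_def)
    show "\<psi> i ?e = 1" if "i \<in> A <+> B" for i
      using that carr eu one by (auto simp: \<psi>_def)
    show "(\<Sum>i\<in>A <+> B. c i * \<psi> i t) = 0" if "t \<in> ?T" for t
    proof -
      have "(\<Sum>i\<in>A <+> B. c i * \<psi> i t) = (\<Sum>u\<in>A. a u * (\<chi> t * t u)) - (\<Sum>u\<in>B. b u * t u)"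
        using A(1) B(1) by (simp add: sum.Plus c_def \<psi>_def sum_negf)
      then show ?thesis using sums[OF that] by simp
    qed
    show "\<exists>t\<in>?T. \<psi> i t \<noteq> \<psi> j t" if ij: "i \<in> A <+> B" "j \<in> A <+> B" "i \<noteq> j" for i j
    proof (cases i; cases j)
      fix u v assume "i = Inl u" "j = Inl v"
      then show ?thesis using ij cone_orbit_separates[of u m v] carr \<chi>0 by (auto simp: \<psi>_def)
    next
      fix u v assume "i = Inr u" "j = Inr v"
      then show ?thesis using ij cone_orbit_separates[of u m v] carr by (auto simp: \<psi>_def)
    next
      fix u v assume "i = Inl u" "j = Inr v"
      then show ?thesis using ij ne[of u v] carr by (auto simp: \<psi>_def)
    next
      fix u v assume "i = Inr u" "j = Inl v"
      then have "v \<in> carrier_vec m" "u \<in> carrier_vec m" using ij carr by auto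
      then obtain t where "t \<in> ?T" "\<chi> t * t v \<noteq> t u" using ne by blast
      then show ?thesis using \<open>i = Inr u\<close> \<open>j = Inl v\<close> by (auto simp: \<psi>_def intro!: bexI[of _ t])
    qed
  qed
  \<comment> \<open>The coefficients of \<open>G\<close> vanish, although \<open>G\<close> is the
    square of a nonzero number at the neutral element.\<close>
  then have "a u = 0" if "u \<in> A" for u using that by (force simp: c_def)
  then have "G ({0\<^sub>v m}, ?e) = 0" using A(3) by simp
  then show False using G(2) chart[OF e] fg(3) by auto
qed

text \<open>A group homomorphism of tori may be wild, for instance complex conjugation of all
  coordinates; the regularity of pulled back characters is what makes them characters again. For the
  cones, a character in the semigroup of \<open>\<tau>'\<close> pulls back to a function regular at
  the distinguished point of \<open>\<tau>\<close>. It then has a limit along the one-parameter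
  subgroups of all interior points, which forces nonnegative exponents.\<close>

lemma toric_morphism_dual:
  assumes \<Sigma>: "cone_family m \<Sigma>" and \<Sigma>': "cone_family m' \<Sigma>'"
    and \<phi>: "toric_morphism (fan_variety m \<Sigma>) (fan_variety m' \<Sigma>') \<phi>"
  obtains M where "\<And>u. u \<in> carrier_vec m' \<Longrightarrow> M u \<in> carrier_vec m"
    and "\<And>u t. u \<in> carrier_vec m' \<Longrightarrow> t \<in> cone_orbit m {0\<^sub>v m} \<Longrightarrow> snd (\<phi> ({0\<^sub>v m}, t)) u = t (M u)"
    and "\<And>\<tau>. \<tau> \<in> \<Sigma> \<Longrightarrow> \<exists>\<tau>'\<in>\<Sigma>'. M ` cone_semigroup m' \<tau>' \<subseteq> cone_semigroup m \<tau>"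
proof -
  let ?X = "fan_variety m \<Sigma>" and ?Y = "fan_variety m' \<Sigma>'"
  have hom: "\<phi> \<in> hom (fan_torus m) (fan_torus m')" and mor: "variety_morphism ?X ?Y \<phi>"
    using \<phi> by (auto simp: toric_morphism_def fan_variety_def)
  have torus: "\<phi> ({0\<^sub>v m}, t) = ({0\<^sub>v m'}, snd (\<phi> ({0\<^sub>v m}, t)))" if "t \<in> cone_orbit m {0\<^sub>v m}" for t
    using fan_torus_hom(1)[OF hom that] by (metis prod.collapse)
  have pull: "zariski_open ?X {p \<in> points ?X. \<phi> p \<in> affine_chart m' \<Sigma>' \<sigma>}"
    "u \<in> cone_semigroup m' \<sigma> \<Longrightarrow>
      regular_on ?X {p \<in> points ?X. \<phi> p \<in> affine_chart m' \<Sigma>' \<sigma>} ((\<lambda>(\<tau>, x). x u) \<circ> \<phi>)"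
    if "\<sigma> \<in> \<Sigma>'" for \<sigma> u
    using mor zariski_open_affine_chart[OF \<Sigma>' that] regular_on_affine_chart[OF \<Sigma>' that, of u]
    unfolding variety_morphism_def by blast+
  have ex: "\<exists>w\<in>carrier_vec m. \<forall>t\<in>cone_orbit m {0\<^sub>v m}. snd (\<phi> ({0\<^sub>v m}, t)) u = t w"
    if u: "u \<in> carrier_vec m'" for u
  proof -
    let ?W = "{p \<in> points ?X. \<phi> p \<in> affine_chart m' \<Sigma>' {0\<^sub>v m'}}"
    let ?e = "one_parameter m (0\<^sub>v m) 1"
    have e: "?e \<in> cone_orbit m {0\<^sub>v m}" by (rule one_parameter_orbit) auto
    have W: "({0\<^sub>v m}, t) \<in> ?W" if "t \<in> cone_orbit m {0\<^sub>v m}" for t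
    proof -
      have "({0\<^sub>v m'}, snd (\<phi> ({0\<^sub>v m}, t))) \<in> affine_chart m' \<Sigma>' {0\<^sub>v m'}"
        using fan_torus_hom(2)[OF hom that] cone_familyD(1)[OF \<Sigma>'] by (simp add: affine_chart_def)
      then show ?thesis
        using that torus[OF that] cone_familyD(1)[OF \<Sigma>] by (simp add: points_fan_variety)
    qed
    have "regular_on ?X ?W ((\<lambda>(\<tau>, x). x u) \<circ> \<phi>)"
      using pull(2)[OF cone_familyD(1)[OF \<Sigma>']] u by (simp add: cone_semigroup_zero)
    then have "\<exists>(U, A)\<in>charts ?X. ({0\<^sub>v m}, ?e) \<in> U \<and> (\<exists>f\<in>A. \<exists>g\<in>A. g ({0\<^sub>v m}, ?e) \<noteq> 0 \<and>
        (\<forall>q\<in>?W \<inter> U. g q \<noteq> 0 \<longrightarrow> ((\<lambda>(\<tau>, x). x u) \<circ> \<phi>) q = f q / g q))"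
      using W[OF e] unfolding regular_on_def by blast
    then obtain \<sigma> f g where fg: "\<sigma> \<in> \<Sigma>" "f \<in> coordinate_ring m \<sigma>" "g \<in> coordinate_ring m \<sigma>"
      "g ({0\<^sub>v m}, ?e) \<noteq> 0"
      "\<And>q. q \<in> ?W \<Longrightarrow> q \<in> affine_chart m \<Sigma> \<sigma> \<Longrightarrow> g q \<noteq> 0 \<Longrightarrow> ((\<lambda>(\<tau>, x). x u) \<circ> \<phi>) q = f q / g q"
      by (fastforce simp: charts_fan_variety)
    show ?thesis
    proof (rule rational_multiplicative_imp_character)
      show "snd (\<phi> ({0\<^sub>v m}, \<lambda>u. s u * t u)) u = snd (\<phi> ({0\<^sub>v m}, s)) u * snd (\<phi> ({0\<^sub>v m}, t)) u"
        if "s \<in> cone_orbit m {0\<^sub>v m}" "t \<in> cone_orbit m {0\<^sub>v m}" for s t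
        by (rule fan_torus_hom(3)[OF hom that])
      have "(\<lambda>u. ?e u * ?e u) = ?e" by (auto simp: one_parameter_def)
      then have "snd (\<phi> ({0\<^sub>v m}, ?e)) u = snd (\<phi> ({0\<^sub>v m}, ?e)) u * snd (\<phi> ({0\<^sub>v m}, ?e)) u"
        using fan_torus_hom(3)[OF hom e e, of u] by simp
      moreover have "snd (\<phi> ({0\<^sub>v m}, ?e)) u \<noteq> 0"
        using fan_torus_hom(2)[OF hom e] u by (auto simp: cone_orbit_def cone_perp_zero)
      ultimately show "snd (\<phi> ({0\<^sub>v m}, ?e)) u = 1" by simp
      show "\<sigma> \<subseteq> carrier_vec m" "0\<^sub>v m \<in> \<sigma>" "{0\<^sub>v m} \<in> \<Sigma>" using cone_familyD[OF \<Sigma>] fg(1) by auto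
      show "f \<in> coordinate_ring m \<sigma>" "g \<in> coordinate_ring m \<sigma>" "g ({0\<^sub>v m}, ?e) \<noteq> 0" by fact+
      show "snd (\<phi> ({0\<^sub>v m}, t)) u = f ({0\<^sub>v m}, t) / g ({0\<^sub>v m}, t)"
        if t: "t \<in> cone_orbit m {0\<^sub>v m}" and nz: "g ({0\<^sub>v m}, t) \<noteq> 0" for t
      proof -
        have "({0\<^sub>v m}, t) \<in> affine_chart m \<Sigma> \<sigma>"
          using t cone_familyD[OF \<Sigma>] fg(1) by (auto simp: affine_chart_def)
        from fg(5)[OF W[OF t] this nz] show ?thesis by (simp add: case_prod_unfold)
      qed
    qed
  qed
  define M where "M = (\<lambda>u. SOME w. w \<in> carrier_vec m \<and>
      (\<forall>t\<in>cone_orbit m {0\<^sub>v m}. snd (\<phi> ({0\<^sub>v m}, t)) u = t w))"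
  have M: "M u \<in> carrier_vec m \<and> (\<forall>t\<in>cone_orbit m {0\<^sub>v m}. snd (\<phi> ({0\<^sub>v m}, t)) u = t (M u))"
    if "u \<in> carrier_vec m'" for u
    unfolding M_def by (rule someI_ex) (use ex[OF that] in blast)
  have "\<exists>\<tau>'\<in>\<Sigma>'. M ` cone_semigroup m' \<tau>' \<subseteq> cone_semigroup m \<tau>" if \<tau>: "\<tau> \<in> \<Sigma>" for \<tau>
  proof -
    let ?p = "distinguished_point m \<tau>"
    have p: "?p \<in> points ?X"
      using \<tau> distinguished_point_orbit[OF cone_familyD(2)[OF \<Sigma> \<tau>]]
      by (simp add: points_fan_variety distinguished_point_def)
    then have "\<phi> ?p \<in> points ?Y" using mor by (auto simp: variety_morphism_def)
    \<comment> \<open>\<open>\<tau>'\<close> is the cone of the orbit that receives the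
      distinguished point of \<open>\<tau>\<close>; the preimage of its chart is an open
      neighbourhood of that point.\<close>
    then obtain \<tau>' x where \<tau>': "\<tau>' \<in> \<Sigma>'" "\<phi> ?p = (\<tau>', x)" "x \<in> cone_orbit m' \<tau>'"
      by (auto simp: points_fan_variety)
    let ?W = "{p \<in> points ?X. \<phi> p \<in> affine_chart m' \<Sigma>' \<tau>'}"
    have pW: "?p \<in> ?W" using p \<tau>' by (simp add: affine_chart_def)
    have "M u \<in> cone_semigroup m \<tau>" if u: "u \<in> cone_semigroup m' \<tau>'" for u
    proof (rule cone_semigroupI_interior[OF \<Sigma> \<tau>])
      have uc: "u \<in> carrier_vec m'" using u by (simp add: cone_semigroup_def)
      then show "M u \<in> carrier_vec m" using M by blast
      fix s assume s: "cone_interior m \<tau> s"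
      let ?h = "(\<lambda>(\<tau>, x). x u) \<circ> \<phi>"
      have "((\<lambda>z. ?h ({0\<^sub>v m}, one_parameter m s z)) \<longlongrightarrow> ?h ?p) (at 0)"
        using regular_on_tendsto[OF \<Sigma> pull(1)[OF \<tau>'(1)] pW s pull(2)[OF \<tau>'(1) u]] .
      moreover have "\<forall>\<^sub>F z in at 0. ?h ({0\<^sub>v m}, one_parameter m s z) = z powi (M u \<bullet> s)"
        using eventually_neq_at_within[of 0 "0 :: complex" UNIV]
      proof eventually_elim
        case (elim z)
        then have "one_parameter m s z \<in> cone_orbit m {0\<^sub>v m}"
          using s by (intro one_parameter_orbit) (auto simp: cone_interior_def)
        then have "snd (\<phi> ({0\<^sub>v m}, one_parameter m s z)) u = one_parameter m s z (M u)"
          using M[OF uc] by blast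
        then show ?case using M[OF uc] by (simp add: case_prod_unfold one_parameter_def)
      qed
      ultimately have "((\<lambda>z. z powi (M u \<bullet> s)) \<longlongrightarrow> ?h ?p) (at 0)" using tendsto_cong by force
      then show "0 \<le> M u \<bullet> s" by (rule powi_tendsto_imp_nonneg)
    qed
    then show ?thesis using \<tau>'(1) by blast
  qed
  then show thesis using that[of M] M by blast
qed

text \<open>\<open>M\<close> was obtained by choice, character by character. That it is additive and
  inverse to \<open>M'\<close> follows because torus points separate characters.\<close>

lemma toric_isomorphic_dual:
  assumes \<Sigma>: "cone_family m \<Sigma>" and \<Sigma>': "cone_family m' \<Sigma>'"
    and iso: "toric_isomorphic (fan_variety m \<Sigma>) (fan_variety m' \<Sigma>')"
  obtains M M' where
    "\<And>u. u \<in> carrier_vec m' \<Longrightarrow> M u \<in> carrier_vec m" "\<And>u. u \<in> carrier_vec m \<Longrightarrow> M' u \<in> carrier_vec m'"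
    "\<And>u v. u \<in> carrier_vec m' \<Longrightarrow> v \<in> carrier_vec m' \<Longrightarrow> M (u + v) = M u + M v"
    "\<And>u v. u \<in> carrier_vec m \<Longrightarrow> v \<in> carrier_vec m \<Longrightarrow> M' (u + v) = M' u + M' v"
    "\<And>u. u \<in> carrier_vec m' \<Longrightarrow> M' (M u) = u" "\<And>u. u \<in> carrier_vec m \<Longrightarrow> M (M' u) = u"
    "\<And>\<tau>. \<tau> \<in> \<Sigma> \<Longrightarrow> \<exists>\<tau>'\<in>\<Sigma>'. M ` cone_semigroup m' \<tau>' \<subseteq> cone_semigroup m \<tau>"
    "\<And>\<tau>'. \<tau>' \<in> \<Sigma>' \<Longrightarrow> \<exists>\<tau>\<in>\<Sigma>. M' ` cone_semigroup m \<tau> \<subseteq> cone_semigroup m' \<tau>'"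
proof -
  let ?X = "fan_variety m \<Sigma>" and ?Y = "fan_variety m' \<Sigma>'"
  obtain \<phi> \<psi> where \<phi>: "toric_morphism ?X ?Y \<phi>" and \<psi>: "toric_morphism ?Y ?X \<psi>"
    and inv: "\<And>p. p \<in> points ?X \<Longrightarrow> \<psi> (\<phi> p) = p" "\<And>q. q \<in> points ?Y \<Longrightarrow> \<phi> (\<psi> q) = q"
    using iso unfolding toric_isomorphic_def by blast
  obtain M where M: "\<And>u. u \<in> carrier_vec m' \<Longrightarrow> M u \<in> carrier_vec m"
    "\<And>u t. u \<in> carrier_vec m' \<Longrightarrow> t \<in> cone_orbit m {0\<^sub>v m} \<Longrightarrow> snd (\<phi> ({0\<^sub>v m}, t)) u = t (M u)"
    "\<And>\<tau>. \<tau> \<in> \<Sigma> \<Longrightarrow> \<exists>\<tau>'\<in>\<Sigma>'. M ` cone_semigroup m' \<tau>' \<subseteq> cone_semigroup m \<tau>"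
    using toric_morphism_dual[OF \<Sigma> \<Sigma>' \<phi>] by blast
  obtain M' where M': "\<And>u. u \<in> carrier_vec m \<Longrightarrow> M' u \<in> carrier_vec m'"
    "\<And>u t. u \<in> carrier_vec m \<Longrightarrow> t \<in> cone_orbit m' {0\<^sub>v m'} \<Longrightarrow> snd (\<psi> ({0\<^sub>v m'}, t)) u = t (M' u)"
    "\<And>\<tau>. \<tau> \<in> \<Sigma>' \<Longrightarrow> \<exists>\<tau>'\<in>\<Sigma>. M' ` cone_semigroup m \<tau>' \<subseteq> cone_semigroup m' \<tau>"
    using toric_morphism_dual[OF \<Sigma>' \<Sigma> \<psi>] by blast
  have hom: "\<phi> \<in> hom (fan_torus m) (fan_torus m')" "\<psi> \<in> hom (fan_torus m') (fan_torus m)"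
    using \<phi> \<psi> by (auto simp: toric_morphism_def fan_variety_def)
  show thesis
  proof (rule that)
    show "M (u + v) = M u + M v" if uv: "u \<in> carrier_vec m'" "v \<in> carrier_vec m'" for u v
    proof (rule ccontr)
      assume "M (u + v) \<noteq> M u + M v"
      moreover have "M (u + v) \<in> carrier_vec m" "M u + M v \<in> carrier_vec m" using M(1) uv by auto
      ultimately obtain t where t: "t \<in> cone_orbit m {0\<^sub>v m}" "t (M (u + v)) \<noteq> t (M u + M v)"
        using cone_orbit_separates by blast
      then show False
        using cone_orbit_zero_mult[OF t(1) M(1)[OF uv(1)] M(1)[OF uv(2)]] M(2)[OF _ t(1)] uv
          cone_orbit_zero_mult[OF fan_torus_hom(2)[OF hom(1) t(1)] uv] by simp
    qed
    show "M' (u + v) = M' u + M' v" if uv: "u \<in> carrier_vec m" "v \<in> carrier_vec m" for u v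
    proof (rule ccontr)
      assume "M' (u + v) \<noteq> M' u + M' v"
      moreover have "M' (u + v) \<in> carrier_vec m'" "M' u + M' v \<in> carrier_vec m'" using M'(1) uv by auto
      ultimately obtain t where t: "t \<in> cone_orbit m' {0\<^sub>v m'}" "t (M' (u + v)) \<noteq> t (M' u + M' v)"
        using cone_orbit_separates by blast
      then show False
        using cone_orbit_zero_mult[OF t(1) M'(1)[OF uv(1)] M'(1)[OF uv(2)]] M'(2)[OF _ t(1)] uv
          cone_orbit_zero_mult[OF fan_torus_hom(2)[OF hom(2) t(1)] uv] by simp
    qed
    show "M' (M u) = u" if u: "u \<in> carrier_vec m'" for u
    proof (rule ccontr)
      assume "M' (M u) \<noteq> u"
      then obtain t where t: "t \<in> cone_orbit m' {0\<^sub>v m'}" "t (M' (M u)) \<noteq> t u"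
        using cone_orbit_separates M(1) M'(1) u by blast
      have "({0\<^sub>v m'}, t) \<in> points ?Y" using t cone_familyD(1)[OF \<Sigma>'] by (simp add: points_fan_variety)
      moreover have "\<psi> ({0\<^sub>v m'}, t) = ({0\<^sub>v m}, snd (\<psi> ({0\<^sub>v m'}, t)))"
        using fan_torus_hom(1)[OF hom(2) t(1)] by (metis prod.collapse)
      ultimately have "snd (\<phi> ({0\<^sub>v m}, snd (\<psi> ({0\<^sub>v m'}, t)))) u = t u" using inv(2) by (metis snd_conv)
      then show False
        using M(2)[OF u fan_torus_hom(2)[OF hom(2) t(1)]] M'(2)[OF M(1)[OF u] t(1)] t(2) by simp
    qed
    show "M (M' u) = u" if u: "u \<in> carrier_vec m" for u
    proof (rule ccontr)
      assume "M (M' u) \<noteq> u"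
      then obtain t where t: "t \<in> cone_orbit m {0\<^sub>v m}" "t (M (M' u)) \<noteq> t u"
        using cone_orbit_separates M(1) M'(1) u by blast
      have "({0\<^sub>v m}, t) \<in> points ?X" using t cone_familyD(1)[OF \<Sigma>] by (simp add: points_fan_variety)
      moreover have "\<phi> ({0\<^sub>v m}, t) = ({0\<^sub>v m'}, snd (\<phi> ({0\<^sub>v m}, t)))"
        using fan_torus_hom(1)[OF hom(1) t(1)] by (metis prod.collapse)
      ultimately have "snd (\<psi> ({0\<^sub>v m'}, snd (\<phi> ({0\<^sub>v m}, t)))) u = t u" using inv(1) by (metis snd_conv)
      then show False
        using M'(2)[OF u fan_torus_hom(2)[OF hom(1) t(1)]] M(2)[OF M'(1)[OF u] t(1)] t(2) by simp
    qed
  qed (use M M' in blast)+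
qed

section \<open>Rays of Bott fans\<close>

text \<open>Over a commutative ring the adjugate supplies the right inverse: \<open>det C'\<close>
  is inverse to \<open>det C\<close>, so \<open>det C'\<close> times \<open>adj_mat C\<close> is a
  right inverse of \<open>C\<close>, and it coincides with the left inverse
  \<open>C'\<close>.\<close>

lemma left_inverse_imp_right_inverse:
  fixes C C' :: "'a :: comm_ring_1 mat"
  assumes C: "C \<in> carrier_mat m m" "C' \<in> carrier_mat m m" and inv: "C' * C = 1\<^sub>m m"
  shows "C * C' = 1\<^sub>m m"
proof -
  have det: "det C' * det C = 1" using det_mult[OF C(2,1)] inv by simp
  have adj: "adj_mat C \<in> carrier_mat m m" "C * adj_mat C = det C \<cdot>\<^sub>m 1\<^sub>m m" using adj_mat[OF C(1)] by auto
  let ?X = "det C' \<cdot>\<^sub>m adj_mat C"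
  have X: "?X \<in> carrier_mat m m" using adj by simp
  have "C * ?X = det C' \<cdot>\<^sub>m (C * adj_mat C)" by (rule mult_smult_distrib[OF C(1) adj(1)])
  also have "\<dots> = 1\<^sub>m m" unfolding adj(2) using det by (intro eq_matI) auto
  finally have CX: "C * ?X = 1\<^sub>m m" .
  have "?X = (C' * C) * ?X" unfolding inv by (rule left_mult_one_mat[OF X, symmetric])
  also have "\<dots> = C' * (C * ?X)" by (rule assoc_mult_mat[OF C(2,1) X])
  also have "\<dots> = C'" unfolding CX using C(2) by simp
  finally show ?thesis using CX by simp
qed

section \<open>Generators and maximal cones of a Bott fan\<close>

text \<open>The Boolean picks one ray of the pair e_k, v_k. A function \<open>\<epsilon>\<close>
  making such a choice for every \<open>k\<close> names a maximal cone, and the columns of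
  \<open>ray_matrix B \<epsilon>\<close> are its generators.\<close>

definition ray :: "int mat \<Rightarrow> bool \<Rightarrow> nat \<Rightarrow> int vec" where
  "ray B b k = (if b then col B k else unit_vec (dim_row B) k)"

definition ray_matrix :: "int mat \<Rightarrow> (nat \<Rightarrow> bool) \<Rightarrow> int mat" where
  "ray_matrix B \<epsilon> = mat (dim_row B) (dim_row B) (\<lambda>(j, k). ray B (\<epsilon> k) k $ j)"

lemma bott_matrix_dims: "bott_matrix m B \<Longrightarrow> dim_row B = m" "bott_matrix m B \<Longrightarrow> dim_col B = m"
  unfolding bott_matrix_def carrier_mat_def by blast+

lemma ray_carrier:
  assumes "bott_matrix m B"
  shows "ray B b k \<in> carrier_vec m"
proof -
  have "dim_vec (ray B b k) = m" using bott_matrix_dims(1)[OF assms] by (simp add: ray_def)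
  then show ?thesis by (rule carrier_vecI)
qed

lemma ray_index:
  assumes B: "bott_matrix m B" and jk: "j < m" "k < m"
  shows "ray B b k $ j = (if j < k then 0 else if j = k then (if b then -1 else 1)
    else if b then B $$ (j, k) else 0)"
proof -
  have "B $$ (j, j) = -1" "j < k \<Longrightarrow> B $$ (j, k) = 0"
    using B jk unfolding bott_matrix_def by blast+
  moreover have "ray B b k $ j = (if b then B $$ (j, k) else if j = k then 1 else 0)"
    using jk bott_matrix_dims[OF B] by (simp add: ray_def)
  ultimately show ?thesis by (cases j k rule: linorder_cases) simp_all
qed

lemma ray_above_diag:
  assumes B: "bott_matrix m B" and "j < k" "k < m"
  shows "ray B b k $ j = 0"
  using ray_index[OF B _ \<open>k < m\<close>, of j] assms(2,3) by simp

lemma ray_diag: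
  assumes B: "bott_matrix m B" and "k < m"
  shows "ray B b k $ k = (if b then -1 else 1)"
  using ray_index[OF B \<open>k < m\<close> \<open>k < m\<close>] by simp

text \<open>The first nonzero coordinate of a ray stands at its index, and its sign tells e_k from
  v_k.\<close>

lemma ray_inject:
  assumes B: "bott_matrix m B" and kl: "k < m" "l < m" and eq: "ray B b k = ray B c l"
  shows "k = l" "b = c"
proof -
  have diag: "ray B b k $ k \<noteq> 0" "ray B c l $ l \<noteq> 0" using ray_diag[OF B] kl by auto
  show "k = l"
  proof (cases k l rule: linorder_cases)
    case less
    then show ?thesis using ray_above_diag[OF B less kl(2), of c] diag(1) unfolding eq by blast
  next
    case greater
    then show ?thesis using ray_above_diag[OF B greater kl(1), of b] diag(2) unfolding eq by blast
  qed
  then have "(if b then -1 else 1 :: int) = (if c then -1 else 1)"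
    using ray_diag[OF B kl(1), of b] ray_diag[OF B kl(2), of c] eq by metis
  then show "b = c" by (cases b; cases c) simp_all
qed

lemma ray_in_maximal_generators:
  assumes B: "bott_matrix m B"
  shows "(\<lambda>k. ray B (\<epsilon> k) k) ` {..<m} \<in> bott_maximal_generators B"
proof -
  let ?S = "(\<lambda>k. ray B (\<epsilon> k) k) ` {..<m}"
  have "inj_on (\<lambda>k. ray B (\<epsilon> k) k) {..<m}" by (intro inj_onI) (use ray_inject[OF B] in auto)
  then have "card ?S = m" by (simp add: card_image)
  moreover have "?S \<subseteq> unit_vec m ` {..<m} \<union> col B ` {..<m}"
    using bott_matrix_dims[OF B] by (auto simp: ray_def)
  moreover have "\<not> {unit_vec m i, col B i} \<subseteq> ?S" if i: "i < m" for i
  proof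
    assume sub: "{unit_vec m i, col B i} \<subseteq> ?S"
    have "ray B False i \<in> ?S" "ray B True i \<in> ?S"
      using sub bott_matrix_dims[OF B] by (auto simp: ray_def)
    then obtain k l where kl: "k < m" "ray B False i = ray B (\<epsilon> k) k" "l < m" "ray B True i = ray B (\<epsilon> l) l"
      by auto
    then show False
      using ray_inject[OF B i kl(1,2)] ray_inject[OF B i kl(3,4)] by simp
  qed
  ultimately show ?thesis
    using bott_matrix_dims[OF B] by (simp add: bott_maximal_generators_def Let_def)
qed

text \<open>Replaces sets of generators by index data. A maximal set of generators never contains
  both rays of a pair, so recording which v_k it contains determines the choice
  \<open>\<epsilon>\<close>.\<close>

lemma bott_fan_eq:
  assumes B: "bott_matrix m B"
  shows "bott_fan B = {cone_spanned m ((\<lambda>k. ray B (\<epsilon> k) k) ` K) | \<epsilon> K. K \<subseteq> {..<m}}" (is "_ = ?R")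
proof (intro equalityI subsetI)
  fix \<sigma> assume "\<sigma> \<in> bott_fan B"
  then obtain T S where T: "\<sigma> = cone_spanned m T" "T \<subseteq> S" and S: "S \<in> bott_maximal_generators B"
    using bott_matrix_dims[OF B] by (auto simp: bott_fan_def)
  define \<epsilon> where "\<epsilon> = (\<lambda>k. col B k \<in> S)"
  have "\<exists>k<m. t = ray B (\<epsilon> k) k" if t: "t \<in> T" for t
  proof -
    have tS: "t \<in> S" using t T by blast
    then have "t \<in> unit_vec m ` {..<m} \<union> col B ` {..<m}"
      using S bott_matrix_dims[OF B] by (auto simp: bott_maximal_generators_def Let_def)
    then consider k where "k < m" "t = unit_vec m k" | k where "k < m" "t = col B k" by blast
    then show ?thesis
    proof cases
      case 1
      have "\<not> {unit_vec m k, col B k} \<subseteq> S"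
        using S 1(1) bott_matrix_dims[OF B] by (auto simp: bott_maximal_generators_def Let_def)
      then have "\<not> \<epsilon> k" using tS 1(2) by (simp add: \<epsilon>_def)
      then show ?thesis using 1 bott_matrix_dims[OF B] by (auto simp: ray_def)
    next
      case 2
      then have "\<epsilon> k" using tS by (simp add: \<epsilon>_def)
      then show ?thesis using 2 by (auto simp: ray_def)
    qed
  qed
  then have "T = (\<lambda>k. ray B (\<epsilon> k) k) ` {k\<in>{..<m}. ray B (\<epsilon> k) k \<in> T}" by blast
  then have "\<sigma> = cone_spanned m ((\<lambda>k. ray B (\<epsilon> k) k) ` {k\<in>{..<m}. ray B (\<epsilon> k) k \<in> T})"
    using T(1) by simp
  moreover have "{k\<in>{..<m}. ray B (\<epsilon> k) k \<in> T} \<subseteq> {..<m}" by auto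
  ultimately show "\<sigma> \<in> ?R" by blast
next
  fix \<sigma> assume "\<sigma> \<in> ?R"
  then obtain \<epsilon> K where K: "\<sigma> = cone_spanned m ((\<lambda>k. ray B (\<epsilon> k) k) ` K)" "K \<subseteq> {..<m}" by blast
  have "(\<lambda>k. ray B (\<epsilon> k) k) ` K \<subseteq> (\<lambda>k. ray B (\<epsilon> k) k) ` {..<m}" using K(2) by (rule image_mono)
  then show "\<sigma> \<in> bott_fan B"
    unfolding bott_fan_def bott_matrix_dims(1)[OF B]
    using K(1) ray_in_maximal_generators[OF B, of \<epsilon>] by blast
qed

lemma cone_family_bott_fan:
  assumes B: "bott_matrix m B"
  shows "cone_family m (bott_fan B)"
  unfolding cone_family_def
proof (intro conjI ballI)
  show "{0\<^sub>v m} \<in> bott_fan B"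
    unfolding bott_fan_eq[OF B]
    by (intro CollectI exI[of _ "\<lambda>_. True"] exI[of _ "{}"]) (simp add: cone_spanned_empty)
  fix \<sigma> assume "\<sigma> \<in> bott_fan B"
  then obtain \<epsilon> K where K: "\<sigma> = cone_spanned m ((\<lambda>k. ray B (\<epsilon> k) k) ` K)" "K \<subseteq> {..<m}"
    unfolding bott_fan_eq[OF B] by blast
  then show "\<exists>T. finite T \<and> T \<subseteq> carrier_vec m \<and> \<sigma> = cone_spanned m T"
    using finite_subset[OF K(2)] ray_carrier[OF B]
    by (intro exI[of _ "(\<lambda>k. ray B (\<epsilon> k) k) ` K"]) auto
qed

definition ray_cone :: "int mat \<Rightarrow> (nat \<Rightarrow> bool) \<Rightarrow> real vec set" where
  "ray_cone B \<epsilon> = cone_spanned (dim_row B) ((\<lambda>k. ray B (\<epsilon> k) k) ` {..<dim_row B})"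

lemma cone_semigroup_ray_cone:
  assumes B: "bott_matrix m B"
  shows "cone_semigroup m (ray_cone B \<epsilon>) = {u \<in> carrier_vec m. \<forall>k<m. 0 \<le> u \<bullet> ray B (\<epsilon> k) k}"
  unfolding ray_cone_def bott_matrix_dims(1)[OF B]
  using ray_carrier[OF B] by (subst cone_semigroup_cone_spanned) auto

lemma ray_cone_in_fan:
  assumes B: "bott_matrix m B"
  shows "ray_cone B \<epsilon> \<in> bott_fan B"
  unfolding bott_fan_eq[OF B] ray_cone_def bott_matrix_dims(1)[OF B] by blast

text \<open>Each cone lies in a maximal one and semigroups reverse inclusions, so a cone that
  receives an image may be replaced by a maximal cone.\<close>

lemma bott_fan_below_ray_cone:
  assumes B: "bott_matrix m B" and "\<tau> \<in> bott_fan B"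
  shows "\<exists>\<epsilon>. cone_semigroup m (ray_cone B \<epsilon>) \<subseteq> cone_semigroup m \<tau>"
proof -
  obtain \<epsilon> K where K: "\<tau> = cone_spanned m ((\<lambda>k. ray B (\<epsilon> k) k) ` K)" "K \<subseteq> {..<m}"
    using assms(2) unfolding bott_fan_eq[OF B] by blast
  have "cone_semigroup m \<tau> = {u \<in> carrier_vec m. \<forall>k\<in>K. 0 \<le> u \<bullet> ray B (\<epsilon> k) k}"
    unfolding K(1) using ray_carrier[OF B] finite_subset[OF K(2)]
    by (subst cone_semigroup_cone_spanned) auto
  then show ?thesis unfolding cone_semigroup_ray_cone[OF B] using K(2) by (intro exI[of _ \<epsilon>]) auto
qed

lemma ray_matrix_carrier:
  assumes "bott_matrix m B"
  shows "ray_matrix B \<epsilon> \<in> carrier_mat m m"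
  by (simp add: ray_matrix_def bott_matrix_dims[OF assms])

lemma ray_matrix_index:
  assumes B: "bott_matrix m B" and "j < m" "k < m"
  shows "ray_matrix B \<epsilon> $$ (j, k) = ray B (\<epsilon> k) k $ j"
  using assms(2,3) by (simp add: ray_matrix_def bott_matrix_dims[OF B])

lemma col_ray_matrix:
  assumes B: "bott_matrix m B" and k: "k < m"
  shows "col (ray_matrix B \<epsilon>) k = ray B (\<epsilon> k) k"
proof (rule eq_vecI)
  have dim: "dim_vec (ray B (\<epsilon> k) k) = m" by (rule carrier_vecD[OF ray_carrier[OF B]])
  then show "dim_vec (col (ray_matrix B \<epsilon>) k) = dim_vec (ray B (\<epsilon> k) k)"
    using carrier_matD[OF ray_matrix_carrier[OF B]] by simp
  fix j assume "j < dim_vec (ray B (\<epsilon> k) k)"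
  then show "col (ray_matrix B \<epsilon>) k $ j = ray B (\<epsilon> k) k $ j"
    using ray_matrix_index[OF B _ k] carrier_matD[OF ray_matrix_carrier[OF B]] k dim by simp
qed

text \<open>This is the smoothness of the fan. The matrix is triangular with diagonal entries 1 or
  -1, so its determinant is its own inverse, and determinant times adjugate is an integral
  inverse.\<close>

lemma ray_matrix_inverse:
  assumes B: "bott_matrix m B"
  shows "\<exists>D\<in>carrier_mat m m. D * ray_matrix B \<epsilon> = 1\<^sub>m m \<and> ray_matrix B \<epsilon> * D = 1\<^sub>m m"
proof -
  let ?A = "ray_matrix B \<epsilon>"
  have A: "?A \<in> carrier_mat m m" by (rule ray_matrix_carrier[OF B])
  have "det ?A = prod_list (diag_mat ?A)"
    by (rule det_lower_triangular[OF _ A]) (simp add: ray_matrix_index[OF B] ray_index[OF B])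
  also have "\<dots> = (\<Prod>k<m. ?A $$ (k, k))" using A by (simp add: prod_list_diag_prod atLeast0LessThan)
  also have "\<bar>\<dots>\<bar> = (\<Prod>k<m. \<bar>?A $$ (k, k)\<bar>)" by (rule abs_prod)
  also have "\<dots> = 1" by (intro prod.neutral) (simp add: ray_matrix_index[OF B] ray_index[OF B])
  finally have "det ?A * det ?A = 1" by (metis abs_mult_self_eq mult_1)
  have adj: "adj_mat ?A \<in> carrier_mat m m" "adj_mat ?A * ?A = det ?A \<cdot>\<^sub>m 1\<^sub>m m"
    using adj_mat[OF A] by auto
  let ?D = "det ?A \<cdot>\<^sub>m adj_mat ?A"
  have D: "?D \<in> carrier_mat m m" using adj by simp
  have "?D * ?A = det ?A \<cdot>\<^sub>m (adj_mat ?A * ?A)" by (rule mult_smult_assoc_mat[OF adj(1) A])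
  also have "\<dots> = 1\<^sub>m m" unfolding adj(2) using \<open>det ?A * det ?A = 1\<close> by (intro eq_matI) auto
  finally have "?D * ?A = 1\<^sub>m m" .
  moreover have "?A * ?D = 1\<^sub>m m" by (rule left_inverse_imp_right_inverse[OF A D \<open>?D * ?A = 1\<^sub>m m\<close>])
  ultimately show ?thesis using D by blast
qed

section \<open>Nonnegative changes of generators\<close>

text \<open>The entries off the diagonal of both products are sums of nonnegative terms with value
  0, so every term vanishes. One nonzero entry of \<open>C\<close> in row \<open>l\<close> and
  column \<open>k\<close> thus clears column \<open>l\<close> of \<open>C'\<close> except in row
  \<open>k\<close>, and the nonzero entry left there clears column \<open>k\<close> of
  \<open>C\<close> except in row \<open>l\<close>.\<close>

lemma nonneg_inverse_imp_unit_columns: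
  fixes C C' :: "int mat"
  assumes C: "C \<in> carrier_mat m m" "C' \<in> carrier_mat m m"
    and nonneg: "\<And>j k. j < m \<Longrightarrow> k < m \<Longrightarrow> 0 \<le> C $$ (j, k)" "\<And>j k. j < m \<Longrightarrow> k < m \<Longrightarrow> 0 \<le> C' $$ (j, k)"
    and inv: "C' * C = 1\<^sub>m m" and k: "k < m"
  shows "\<exists>l<m. col C k = unit_vec m l"
proof -
  have inv': "C * C' = 1\<^sub>m m" by (rule left_inverse_imp_right_inverse[OF C inv])
  have index: "(X * Y) $$ (a, b) = (\<Sum>j<m. X $$ (a, j) * Y $$ (j, b))"
    if "X \<in> carrier_mat m m" "Y \<in> carrier_mat m m" "a < m" "b < m" for X Y :: "int mat" and a b
    using that by (simp add: scalar_prod_def atLeast0LessThan)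
  have s: "(\<Sum>j<m. C' $$ (a, j) * C $$ (j, b)) = (if a = b then 1 else 0)"
    "(\<Sum>j<m. C $$ (a, j) * C' $$ (j, b)) = (if a = b then 1 else 0)" if "a < m" "b < m" for a b
    using index[OF C(2,1) that] index[OF C(1,2) that] inv inv' that by auto
  have z: "C' $$ (a, j) * C $$ (j, b) = 0" "C $$ (a, j) * C' $$ (j, b) = 0"
    if "a < m" "b < m" "a \<noteq> b" "j < m" for a b j
  proof -
    have "\<forall>j\<in>{..<m}. C' $$ (a, j) * C $$ (j, b) = 0"
      using s(1)[OF that(1,2)] that nonneg by (subst sum_nonneg_eq_0_iff[symmetric]) auto
    then show "C' $$ (a, j) * C $$ (j, b) = 0" using that by auto
    have "\<forall>j\<in>{..<m}. C $$ (a, j) * C' $$ (j, b) = 0"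
      using s(2)[OF that(1,2)] that nonneg by (subst sum_nonneg_eq_0_iff[symmetric]) auto
    then show "C $$ (a, j) * C' $$ (j, b) = 0" using that by auto
  qed
  obtain l where l: "l < m" "C $$ (l, k) \<noteq> 0"
  proof -
    have "(\<Sum>j<m. C' $$ (k, j) * C $$ (j, k)) \<noteq> 0" using s(1)[OF k k] by simp
    then obtain j where "j \<in> {..<m}" "C' $$ (k, j) * C $$ (j, k) \<noteq> 0" by (rule sum.not_neutral_contains_not_neutral)
    then show thesis using that by auto
  qed
  have row: "C' $$ (j, l) = 0" if "j < m" "j \<noteq> k" for j using z(1)[OF that(1) k that(2) l(1)] l(2) by simp
  have "(\<Sum>j<m. C $$ (l, j) * C' $$ (j, l)) = (\<Sum>j\<in>{k}. C $$ (l, j) * C' $$ (j, l))"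
    using k row by (intro sum.mono_neutral_right) auto
  then have one: "C $$ (l, k) * C' $$ (k, l) = 1" using s(2)[OF l(1) l(1)] by simp
  then have lk: "C $$ (l, k) = 1" using nonneg(1)[OF l(1) k] by (auto simp: zmult_eq_1_iff)
  have "C $$ (j, k) = 0" if "j < m" "j \<noteq> l" for j
    using z(2)[OF that(1) l(1) that(2) k] one by auto
  then have "col C k = unit_vec m l" using lk C k l by (intro eq_vecI) auto
  then show ?thesis using l(1) by blast
qed

text \<open>A cone cannot be mapped into a different maximal cone by a nonnegative change of generators:
  comparing leading coordinates fixes the signs.\<close>

lemma ray_matrix_nonneg_unique:
  assumes B: "bott_matrix m B" and E: "E \<in> carrier_mat m m"
    and nonneg: "\<And>j k. j < m \<Longrightarrow> k < m \<Longrightarrow> 0 \<le> E $$ (j, k)"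
    and eq: "ray_matrix B \<epsilon> = ray_matrix B \<delta> * E"
  shows "E = 1\<^sub>m m"
proof -
  have idx: "ray B (\<epsilon> k) k $ p = (\<Sum>q<m. ray B (\<delta> q) q $ p * E $$ (q, k))" if "p < m" "k < m" for p k
  proof -
    have "ray_matrix B \<epsilon> $$ (p, k) = (\<Sum>q<m. ray_matrix B \<delta> $$ (p, q) * E $$ (q, k))"
      unfolding eq using that E ray_matrix_carrier[OF B, of \<delta>]
      by (simp add: scalar_prod_def atLeast0LessThan)
    then show ?thesis using that by (simp add: ray_matrix_index[OF B])
  qed
  have upper: "E $$ (p, k) = 0" if "p < k" "k < m" for p k
    using that
  proof (induction p rule: less_induct)
    case (less p)
    have "(\<Sum>q<m. ray B (\<delta> q) q $ p * E $$ (q, k)) = (\<Sum>q\<in>{p}. ray B (\<delta> q) q $ p * E $$ (q, k))"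
      using less by (intro sum.mono_neutral_right) (auto simp: ray_index[OF B])
    then show ?case using idx[of p k] less.prems by (simp add: ray_index[OF B] split: if_splits)
  qed
  \<comment> \<open>On the diagonal the sign chosen by \<open>\<epsilon>\<close> is the sign chosen
    by \<open>\<delta>\<close> times a nonnegative entry of \<open>E\<close>.\<close>
  have \<epsilon>: "\<epsilon> k = \<delta> k" if k: "k < m" for k
  proof -
    have "(\<Sum>q<m. ray B (\<delta> q) q $ k * E $$ (q, k)) = (\<Sum>q\<in>{k}. ray B (\<delta> q) q $ k * E $$ (q, k))"
      using k upper by (intro sum.mono_neutral_right) (auto simp: ray_index[OF B])
    then show ?thesis using idx[OF k k] k nonneg[OF k k] by (simp add: ray_index[OF B] split: if_splits)
  qed
  have "ray_matrix B \<epsilon> = ray_matrix B \<delta>"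
    using \<epsilon> by (intro eq_matI) (auto simp: ray_matrix_def bott_matrix_dims[OF B])
  then have eq': "ray_matrix B \<delta> = ray_matrix B \<delta> * E" using eq by simp
  obtain D where D: "D \<in> carrier_mat m m" "D * ray_matrix B \<delta> = 1\<^sub>m m"
    using ray_matrix_inverse[OF B] by blast
  have "E = (D * ray_matrix B \<delta>) * E" using D E by simp
  also have "\<dots> = D * (ray_matrix B \<delta> * E)" by (rule assoc_mult_mat[OF D(1) ray_matrix_carrier[OF B] E])
  also have "\<dots> = 1\<^sub>m m" using D(2) eq' by simp
  finally show ?thesis .
qed


text \<open>Additivity alone gives linearity over the integers: natural multiples come by induction,
  negative ones from the value 0 at zero, and the vector is then built up one coordinate at a
  time.\<close>

lemma additive_eq_sum:
  fixes f :: "int vec \<Rightarrow> int"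
  assumes add: "\<And>u v. u \<in> carrier_vec m \<Longrightarrow> v \<in> carrier_vec m \<Longrightarrow> f (u + v) = f u + f v"
    and u: "u \<in> carrier_vec m"
  shows "f u = (\<Sum>i<m. u $ i * f (unit_vec m i))"
proof -
  have zero: "f (0\<^sub>v m) = 0" using add[of "0\<^sub>v m" "0\<^sub>v m"] by simp
  have nat_mult: "f (int c \<cdot>\<^sub>v v) = int c * f v" if v: "v \<in> carrier_vec m" for c v
  proof (induction c)
    case 0
    have "int 0 \<cdot>\<^sub>v v = 0\<^sub>v m" using v by (intro eq_vecI) auto
    then show ?case using zero by simp
  next
    case (Suc c)
    have "int (Suc c) \<cdot>\<^sub>v v = int c \<cdot>\<^sub>v v + v" using v by (intro eq_vecI) (auto simp: algebra_simps)
    also have "f \<dots> = f (int c \<cdot>\<^sub>v v) + f v" using v by (intro add) simp_all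
    also have "\<dots> = int (Suc c) * f v" unfolding Suc.IH by (simp add: distrib_right)
    finally show ?case .
  qed
  have mult: "f (c \<cdot>\<^sub>v v) = c * f v" if v: "v \<in> carrier_vec m" for c v
  proof (cases c)
    case (nonneg n)
    then show ?thesis by (simp only: nat_mult[OF v])
  next
    case (neg n)
    let ?k = "int (Suc n)"
    have "?k \<cdot>\<^sub>v v + (- ?k) \<cdot>\<^sub>v v = 0\<^sub>v m" using v by (intro eq_vecI) (auto simp: algebra_simps)
    then have "f (?k \<cdot>\<^sub>v v + (- ?k) \<cdot>\<^sub>v v) = 0" using zero by (simp only:)
    moreover have "f (?k \<cdot>\<^sub>v v + (- ?k) \<cdot>\<^sub>v v) = f (?k \<cdot>\<^sub>v v) + f ((- ?k) \<cdot>\<^sub>v v)"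
      using v by (intro add) simp_all
    ultimately have "f ((- ?k) \<cdot>\<^sub>v v) = (- ?k) * f v"
      unfolding nat_mult[OF v] mult_minus_left by linarith
    moreover have "c = - ?k" using neg by simp
    ultimately show ?thesis by (simp only:)
  qed
  have "f (vec m (\<lambda>i. if i < n then u $ i else 0)) = (\<Sum>i<n. u $ i * f (unit_vec m i))" if "n \<le> m" for n
    using that
  proof (induction n)
    case 0
    have "vec m (\<lambda>i. if i < 0 then u $ i else 0) = 0\<^sub>v m" by (intro eq_vecI) auto
    then show ?case using zero by simp
  next
    case (Suc n)
    have "vec m (\<lambda>i. if i < Suc n then u $ i else 0) =
        vec m (\<lambda>i. if i < n then u $ i else 0) + (u $ n) \<cdot>\<^sub>v unit_vec m n"
      using Suc.prems by (intro eq_vecI) (auto simp: less_Suc_eq)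
    also have "f \<dots> = f (vec m (\<lambda>i. if i < n then u $ i else 0)) + f ((u $ n) \<cdot>\<^sub>v unit_vec m n)"
      by (rule add) simp_all
    also have "f (vec m (\<lambda>i. if i < n then u $ i else 0)) = (\<Sum>i<n. u $ i * f (unit_vec m i))"
      using Suc.prems by (intro Suc.IH) simp
    also have "f ((u $ n) \<cdot>\<^sub>v unit_vec m n) = u $ n * f (unit_vec m n)" by (rule mult) simp
    finally show ?case by (simp only: sum.lessThan_Suc)
  qed
  from this[OF order_refl]
  have "f (vec m (\<lambda>i. if i < m then u $ i else 0)) = (\<Sum>i<m. u $ i * f (unit_vec m i))" .
  moreover have "vec m (\<lambda>i. if i < m then u $ i else 0) = u" using u by (intro eq_vecI) auto
  ultimately show ?thesis by (simp only:)
qed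

text \<open>\<open>M\<close> acts on characters, whereas rays live in the dual lattice.
  \<open>P\<close> is the adjoint acting there; its row \<open>i\<close> is the image under
  \<open>M\<close> of the unit vector \<open>i\<close>.\<close>

lemma additive_transpose:
  fixes M :: "int vec \<Rightarrow> int vec"
  assumes M: "\<And>u. u \<in> carrier_vec m \<Longrightarrow> M u \<in> carrier_vec m"
    and add: "\<And>u v. u \<in> carrier_vec m \<Longrightarrow> v \<in> carrier_vec m \<Longrightarrow> M (u + v) = M u + M v"
  obtains P where "P \<in> carrier_mat m m"
    "\<And>u x. u \<in> carrier_vec m \<Longrightarrow> x \<in> carrier_vec m \<Longrightarrow> u \<bullet> (P *\<^sub>v x) = M u \<bullet> x"
proof
  let ?P = "mat m m (\<lambda>(i, j). M (unit_vec m i) $ j)"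
  show "?P \<in> carrier_mat m m" by simp
  fix u x :: "int vec" assume u: "u \<in> carrier_vec m" and x: "x \<in> carrier_vec m"
  have Mu: "M u $ j = (\<Sum>i<m. u $ i * M (unit_vec m i) $ j)" if "j < m" for j
  proof (rule additive_eq_sum[where f = "\<lambda>u. M u $ j", OF _ u])
    fix v w :: "int vec" assume v: "v \<in> carrier_vec m" and w: "w \<in> carrier_vec m"
    show "M (v + w) $ j = M v $ j + M w $ j"
      unfolding add[OF v w] using M[OF w] that by (intro index_add_vec) simp
  qed
  have Px: "(?P *\<^sub>v x) $ i = (\<Sum>j<m. M (unit_vec m i) $ j * x $ j)" if "i < m" for i
    using that x by (simp add: scalar_prod_eq_sum[of _ m] row_def)
  have "u \<bullet> (?P *\<^sub>v x) = (\<Sum>i<m. u $ i * (?P *\<^sub>v x) $ i)" by (intro scalar_prod_eq_sum carrier_vecI) simp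
  also have "\<dots> = (\<Sum>i<m. \<Sum>j<m. u $ i * (M (unit_vec m i) $ j * x $ j))"
  proof (intro sum.cong refl)
    fix i assume "i \<in> {..<m}"
    then have "i < m" by simp
    show "u $ i * (?P *\<^sub>v x) $ i = (\<Sum>j<m. u $ i * (M (unit_vec m i) $ j * x $ j))"
      unfolding Px[OF \<open>i < m\<close>] by (rule sum_distrib_left)
  qed
  also have "\<dots> = (\<Sum>j<m. \<Sum>i<m. u $ i * (M (unit_vec m i) $ j * x $ j))" by (rule sum.swap)
  also have "\<dots> = (\<Sum>j<m. M u $ j * x $ j)"
  proof (intro sum.cong refl)
    fix j assume "j \<in> {..<m}"
    then have "j < m" by simp
    show "(\<Sum>i<m. u $ i * (M (unit_vec m i) $ j * x $ j)) = M u $ j * x $ j"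
      unfolding Mu[OF \<open>j < m\<close>] sum_distrib_right mult.assoc by (rule refl)
  qed
  also have "\<dots> = M u \<bullet> x" by (rule scalar_prod_eq_sum[OF x, symmetric])
  finally show "u \<bullet> (?P *\<^sub>v x) = M u \<bullet> x" .
qed

text \<open>The rows of the inverse \<open>D\<close> are dual to the generators chosen by
  \<open>\<delta>\<close>, hence lie in the semigroup of that cone. \<open>M\<close> sends them into
  the semigroup of the cone chosen by \<open>\<epsilon>\<close>, and the entries of \<open>C\<close>
  are their pairings with the generators of this cone.\<close>

lemma cone_map_nonneg_matrix:
  assumes B: "bott_matrix m B" and B': "bott_matrix m B'"
    and P: "P \<in> carrier_mat m m"
    and adj: "\<forall>u\<in>carrier_vec m. \<forall>x\<in>carrier_vec m. u \<bullet> (P *\<^sub>v x) = M u \<bullet> x"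
    and sub: "M ` cone_semigroup m (ray_cone B' \<delta>) \<subseteq> cone_semigroup m (ray_cone B \<epsilon>)"
  shows "\<exists>C. C \<in> carrier_mat m m \<and> (\<forall>j<m. \<forall>k<m. 0 \<le> C $$ (j, k)) \<and>
    P * ray_matrix B \<epsilon> = ray_matrix B' \<delta> * C"
proof -
  have A: "ray_matrix B \<epsilon> \<in> carrier_mat m m" and A': "ray_matrix B' \<delta> \<in> carrier_mat m m"
    using ray_matrix_carrier B B' by auto
  obtain D where D: "D \<in> carrier_mat m m" "D * ray_matrix B' \<delta> = 1\<^sub>m m" "ray_matrix B' \<delta> * D = 1\<^sub>m m"
    using ray_matrix_inverse[OF B'] by blast
  let ?C = "D * (P * ray_matrix B \<epsilon>)"
  have PA: "P * ray_matrix B \<epsilon> \<in> carrier_mat m m" using P A by simp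
  have nonneg: "0 \<le> ?C $$ (j, k)" if jk: "j < m" "k < m" for j k
  proof -
    have row: "row D j \<in> carrier_vec m" using carrier_matD[OF D(1)] by (intro carrier_vecI) simp
    have "row D j \<bullet> ray B' (\<delta> l) l = (if j = l then 1 else 0)" if "l < m" for l
    proof -
      have "(D * ray_matrix B' \<delta>) $$ (j, l) = row D j \<bullet> col (ray_matrix B' \<delta>) l"
        using jk(1) that carrier_matD[OF D(1)] carrier_matD[OF A'] by (intro index_mult_mat(1)) auto
      then show ?thesis unfolding D(2) col_ray_matrix[OF B' that] using jk that by simp
    qed
    then have "row D j \<in> cone_semigroup m (ray_cone B' \<delta>)"
      unfolding cone_semigroup_ray_cone[OF B'] using row by simp
    then have "M (row D j) \<in> cone_semigroup m (ray_cone B \<epsilon>)" using sub by blast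
    then have "0 \<le> M (row D j) \<bullet> ray B (\<epsilon> k) k"
      unfolding cone_semigroup_ray_cone[OF B] using jk by simp
    also have "\<dots> = row D j \<bullet> (P *\<^sub>v ray B (\<epsilon> k) k)" by (rule adj[rule_format, OF row ray_carrier[OF B], symmetric])
    also have "P *\<^sub>v ray B (\<epsilon> k) k = col (P * ray_matrix B \<epsilon>) k"
      unfolding col_mult2[OF P A jk(2)] col_ray_matrix[OF B jk(2)] by (rule refl)
    also have "row D j \<bullet> col (P * ray_matrix B \<epsilon>) k = ?C $$ (j, k)"
      using jk carrier_matD[OF D(1)] carrier_matD[OF PA] by (intro index_mult_mat(1)[symmetric]) auto
    finally show ?thesis .
  qed
  have eq: "ray_matrix B' \<delta> * ?C = P * ray_matrix B \<epsilon>"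
  proof -
    have "ray_matrix B' \<delta> * ?C = (ray_matrix B' \<delta> * D) * (P * ray_matrix B \<epsilon>)"
      by (rule assoc_mult_mat[OF A' D(1) PA, symmetric])
    then show ?thesis unfolding D(3) left_mult_one_mat[OF PA] .
  qed
  have "?C \<in> carrier_mat m m" using D(1) PA by simp
  then show ?thesis using nonneg eq by (intro exI[of _ ?C] conjI allI impI) (simp_all only:)
qed

text \<open>The cone of \<open>\<epsilon>\<close> goes into a cone of \<open>\<delta>\<close>, which
  \<open>Q\<close> sends into a cone of \<open>\<eta>\<close>, a priori not that of
  \<open>\<epsilon>\<close>. The composite change of generators \<open>C' * C\<close> is
  nonnegative, so \<open>ray_matrix_nonneg_unique\<close> makes it the identity, and
  \<open>C\<close> has a nonnegative inverse.\<close>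

lemma cone_map_rays:
  assumes B: "bott_matrix m B" and B': "bott_matrix m B'"
    and P: "P \<in> carrier_mat m m" and Q: "Q \<in> carrier_mat m m" and QP: "Q * P = 1\<^sub>m m"
    and adjP: "\<forall>u\<in>carrier_vec m. \<forall>x\<in>carrier_vec m. u \<bullet> (P *\<^sub>v x) = M u \<bullet> x"
    and adjQ: "\<forall>u\<in>carrier_vec m. \<forall>x\<in>carrier_vec m. u \<bullet> (Q *\<^sub>v x) = M' u \<bullet> x"
    and subP: "\<And>\<tau>. \<tau> \<in> bott_fan B \<Longrightarrow> \<exists>\<tau>'\<in>bott_fan B'. M ` cone_semigroup m \<tau>' \<subseteq> cone_semigroup m \<tau>"
    and subQ: "\<And>\<tau>'. \<tau>' \<in> bott_fan B' \<Longrightarrow> \<exists>\<tau>\<in>bott_fan B. M' ` cone_semigroup m \<tau> \<subseteq> cone_semigroup m \<tau>'"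
  shows "\<exists>\<delta>. \<forall>k<m. \<exists>l<m. P *\<^sub>v ray B (\<epsilon> k) k = ray B' (\<delta> l) l"
proof -
  obtain \<tau>' where \<tau>': "\<tau>' \<in> bott_fan B'"
    "M ` cone_semigroup m \<tau>' \<subseteq> cone_semigroup m (ray_cone B \<epsilon>)"
    using subP[OF ray_cone_in_fan[OF B]] by (rule bexE)
  obtain \<delta> where "cone_semigroup m (ray_cone B' \<delta>) \<subseteq> cone_semigroup m \<tau>'"
    using bott_fan_below_ray_cone[OF B' \<tau>'(1)] by (rule exE)
  then have \<delta>: "M ` cone_semigroup m (ray_cone B' \<delta>) \<subseteq> cone_semigroup m (ray_cone B \<epsilon>)"
    using \<tau>'(2) by (rule subset_trans[OF image_mono])
  obtain \<tau> where \<tau>: "\<tau> \<in> bott_fan B"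
    "M' ` cone_semigroup m \<tau> \<subseteq> cone_semigroup m (ray_cone B' \<delta>)"
    using subQ[OF ray_cone_in_fan[OF B']] by (rule bexE)
  obtain \<eta> where "cone_semigroup m (ray_cone B \<eta>) \<subseteq> cone_semigroup m \<tau>"
    using bott_fan_below_ray_cone[OF B \<tau>(1)] by (rule exE)
  then have \<eta>: "M' ` cone_semigroup m (ray_cone B \<eta>) \<subseteq> cone_semigroup m (ray_cone B' \<delta>)"
    using \<tau>(2) by (rule subset_trans[OF image_mono])
  obtain C where C: "C \<in> carrier_mat m m" "\<forall>j<m. \<forall>k<m. 0 \<le> C $$ (j, k)"
    "P * ray_matrix B \<epsilon> = ray_matrix B' \<delta> * C"
    using cone_map_nonneg_matrix[OF B B' P adjP \<delta>] by (elim exE conjE)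
  obtain C' where C': "C' \<in> carrier_mat m m" "\<forall>j<m. \<forall>k<m. 0 \<le> C' $$ (j, k)"
    "Q * ray_matrix B' \<delta> = ray_matrix B \<eta> * C'"
    using cone_map_nonneg_matrix[OF B' B Q adjQ \<eta>] by (elim exE conjE)
  have carr: "ray_matrix B \<epsilon> \<in> carrier_mat m m" "ray_matrix B' \<delta> \<in> carrier_mat m m"
    "ray_matrix B \<eta> \<in> carrier_mat m m" using ray_matrix_carrier B B' by auto
  have "ray_matrix B \<epsilon> = (Q * P) * ray_matrix B \<epsilon>" using QP carr by simp
  also have "\<dots> = Q * (ray_matrix B' \<delta> * C)" using assoc_mult_mat[OF Q P carr(1)] C(3) by simp
  also have "\<dots> = (ray_matrix B \<eta> * C') * C" using assoc_mult_mat[OF Q carr(2) C(1)] C'(3) by simp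
  also have "\<dots> = ray_matrix B \<eta> * (C' * C)" by (rule assoc_mult_mat[OF carr(3) C'(1) C(1)])
  finally have eq: "ray_matrix B \<epsilon> = ray_matrix B \<eta> * (C' * C)" .
  have "C' * C = 1\<^sub>m m"
  proof (rule ray_matrix_nonneg_unique[OF B _ _ eq])
    show "C' * C \<in> carrier_mat m m" using C C' by simp
    show "0 \<le> (C' * C) $$ (j, k)" if "j < m" "k < m" for j k
    proof -
      have "(C' * C) $$ (j, k) = (\<Sum>l<m. C' $$ (j, l) * C $$ (l, k))"
        using that C(1) C'(1) by (simp add: scalar_prod_def atLeast0LessThan)
      also have "\<dots> \<ge> 0" using that C(2) C'(2) by (intro sum_nonneg mult_nonneg_nonneg) auto
      finally show ?thesis .
    qed
  qed
  then have unit: "\<exists>l<m. col C k = unit_vec m l" if "k < m" for k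
    using C(2) C'(2) that by (intro nonneg_inverse_imp_unit_columns[OF C(1) C'(1)]) simp_all
  have "\<exists>l<m. P *\<^sub>v ray B (\<epsilon> k) k = ray B' (\<delta> l) l" if k: "k < m" for k
  proof -
    obtain l where l: "l < m" "col C k = unit_vec m l" using unit[OF k] by (elim exE conjE)
    have "P *\<^sub>v ray B (\<epsilon> k) k = col (P * ray_matrix B \<epsilon>) k"
      using col_mult2[OF P carr(1) k] col_ray_matrix[OF B k] by simp
    also have "\<dots> = ray_matrix B' \<delta> *\<^sub>v unit_vec m l"
      unfolding C(3) using col_mult2[OF carr(2) C(1) k] l(2) by simp
    also have "\<dots> = col (ray_matrix B' \<delta>) l" using carr(2) l(1) by (intro eq_vecI) (auto simp: scalar_prod_right_unit)
    also have "\<dots> = ray B' (\<delta> l) l" by (rule col_ray_matrix[OF B' l(1)])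
    finally show ?thesis using l(1) by blast
  qed
  then show ?thesis by blast
qed

section \<open>From maps of rays to permuted Bott matrices\<close>

lemma mat_eq_one_if_pairing:
  fixes A :: "int mat"
  assumes A: "A \<in> carrier_mat m m"
    and eq: "\<forall>u\<in>carrier_vec m. \<forall>x\<in>carrier_vec m. u \<bullet> (A *\<^sub>v x) = u \<bullet> x"
  shows "A = 1\<^sub>m m"
proof (rule eq_matI)
  fix i j assume "i < dim_row (1\<^sub>m m :: int mat)" "j < dim_col (1\<^sub>m m :: int mat)"
  then have ij: "i < m" "j < m" by auto
  have "unit_vec m i \<bullet> (A *\<^sub>v unit_vec m j) = (A *\<^sub>v unit_vec m j) $ i"
    using ij A by (intro scalar_prod_left_unit) auto
  also have "\<dots> = A $$ (i, j)" using ij carrier_matD[OF A] by simp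
  finally have "A $$ (i, j) = unit_vec m i \<bullet> unit_vec m j" using eq by simp
  then show "A $$ (i, j) = 1\<^sub>m m $$ (i, j)" using ij by simp
qed (use A in auto)

text \<open>The matrix \<open>C\<close> expresses the opposite generators in the basis obtained from the unit vectors
  by exchanging \<open>e\<^sub>q\<close> and \<open>v\<^sub>q\<close> for \<open>q\<close> with \<open>g q\<close>.  Such an exchange negates row \<open>q\<close>, so by
  induction on the rows the entry restriction forces that row to vanish off the diagonal.\<close>

lemma exchange_trivial:
  assumes B: "bott_matrix m B"
    and entries: "\<And>j k. k < j \<Longrightarrow> j < m \<Longrightarrow> B $$ (j, k) \<in> {-2, 0, 1}"
    and diag: "\<And>k. k < m \<Longrightarrow> C k k = -1"
    and off: "\<And>j k. j < m \<Longrightarrow> k < m \<Longrightarrow> j \<noteq> k \<Longrightarrow> C j k \<in> {-2, 0, 1 :: int}"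
    and eq: "\<And>k p. k < m \<Longrightarrow> p < m \<Longrightarrow> ray B (\<not> g k) k $ p = (\<Sum>q<m. C q k * ray B (g q) q $ p)"
  shows "\<forall>p<m. \<forall>k<m. C p k = B $$ (p, k)"
proof -
  have Bdiag: "B $$ (k, k) = -1" if "k < m" for k using B that by (simp add: bott_matrix_def)
  have Bup: "B $$ (j, k) = 0" if "j < k" "k < m" for j k using B that by (simp add: bott_matrix_def)
  have "\<forall>k<m. C p k = B $$ (p, k) \<and> (g p \<longrightarrow> k \<noteq> p \<longrightarrow> B $$ (p, k) = 0)" if "p < m" for p
    using that
  proof (induction p rule: less_induct)
    case (less p)
    define d where "d = (if g p then -1 else 1 :: int)"
    have main: "d * C p k = B $$ (p, k)" if k: "k < m" "k \<noteq> p" for k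
    proof -
      \<comment> \<open>Coordinate \<open>p\<close> sees only \<open>q = p\<close> and
        \<open>q = k\<close>: rays with \<open>q > p\<close> vanish there, e_q with
        \<open>q < p\<close> is another unit vector, and v_q with \<open>q < p\<close> has the
        coefficient \<open>C q k\<close>, which is 0 by induction.\<close>
      have "(\<Sum>q<m. C q k * ray B (g q) q $ p) = (\<Sum>q\<in>{p, k}. C q k * ray B (g q) q $ p)"
      proof (rule sum.mono_neutral_right)
        show "\<forall>q\<in>{..<m} - {p, k}. C q k * ray B (g q) q $ p = 0"
        proof
          fix q assume q: "q \<in> {..<m} - {p, k}"
          show "C q k * ray B (g q) q $ p = 0"
          proof (cases "p < q")
            case True
            then show ?thesis using ray_above_diag[OF B True] q by simp
          next
            case False
            then have "q < p" using q by auto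
            show ?thesis
            proof (cases "g q")
              case True
              then have "C q k = 0" using less.IH[OF \<open>q < p\<close>] q k by auto
              then show ?thesis by simp
            next
              case False
              then show ?thesis using ray_index[OF B less.prems, of q "g q"] q \<open>q < p\<close> by simp
            qed
          qed
        qed
      qed (use less.prems k in auto)
      also have "\<dots> = C p k * d - ray B (g k) k $ p"
        using k diag[OF k(1)] ray_diag[OF B less.prems, of "g p"] by (simp add: d_def)
      finally have sum: "ray B (\<not> g k) k $ p + ray B (g k) k $ p = C p k * d"
        using eq[OF k(1) less.prems] by simp
      \<comment> \<open>Away from coordinate \<open>k\<close> the sum of e_k and v_k is just column
        \<open>k\<close> of \<open>B\<close>, whichever of the two was chosen.\<close>
      have "ray B (\<not> g k) k $ p + ray B (g k) k $ p = B $$ (p, k)"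
      proof (cases "p < k")
        case True
        then show ?thesis using ray_above_diag[OF B True k(1)] Bup[OF True k(1)] by simp
      next
        case False
        then show ?thesis using ray_index[OF B less.prems k(1)] k(2) by (cases "g k") simp_all
      qed
      then show ?thesis using sum by (simp add: mult.commute)
    qed
    show ?case
    proof (intro allI impI)
      fix k assume k: "k < m"
      show "C p k = B $$ (p, k) \<and> (g p \<longrightarrow> k \<noteq> p \<longrightarrow> B $$ (p, k) = 0)"
      proof (cases "k = p")
        case True
        then show ?thesis using diag[OF k] Bdiag[OF k] by simp
      next
        case False
        have B3: "B $$ (p, k) \<in> {-2, 0, 1}"
        proof (cases "p < k")
          case True
          then show ?thesis using Bup[OF True k] by simp
        next
          case False
          then show ?thesis using entries[of k p] \<open>k \<noteq> p\<close> less.prems by simp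
        qed
        have C3: "C p k \<in> {-2, 0, 1}" using off[OF less.prems k] False by simp
        show ?thesis using main[OF k False] B3 C3 by (cases "g p") (auto simp: d_def)
      qed
    qed
  qed
  then show ?thesis by blast
qed

text \<open>If e_k and v_k went to rays with different indices, some maximal cone would contain both
  images, and \<open>Q\<close> would send its generators into one maximal cone containing e_k and
  v_k. The Boolean \<open>f k\<close> records whether the pair is exchanged.\<close>

lemma ray_maps_imp_permutation:
  assumes B: "bott_matrix m B" and B': "bott_matrix m B'"
    and P: "P \<in> carrier_mat m m" and Q: "Q \<in> carrier_mat m m" and QP: "Q * P = 1\<^sub>m m"
    and raysP: "\<And>\<epsilon>. \<exists>\<delta>. \<forall>k<m. \<exists>l<m. P *\<^sub>v ray B (\<epsilon> k) k = ray B' (\<delta> l) l"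
    and raysQ: "\<And>\<epsilon>. \<exists>\<delta>. \<forall>k<m. \<exists>l<m. Q *\<^sub>v ray B' (\<epsilon> k) k = ray B (\<delta> l) l"
  shows "\<exists>\<sigma> f. bij_betw \<sigma> {..<m} {..<m} \<and>
    (\<forall>k<m. \<forall>b. P *\<^sub>v ray B b k = ray B' (f k \<noteq> b) (\<sigma> k))"
proof -
  have QP_ray: "Q *\<^sub>v (P *\<^sub>v ray B b k) = ray B b k" for b k
    using assoc_mult_mat_vec[OF Q P ray_carrier[OF B]] ray_carrier[OF B] unfolding QP by simp
  have inj: "k = l \<and> b = c" if "P *\<^sub>v ray B b k = P *\<^sub>v ray B c l" "k < m" "l < m" for b c k l
    using QP_ray[of b k] QP_ray[of c l] ray_inject[OF B that(2,3)] that(1) by metis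
  have "\<forall>k\<in>{..<m}. \<exists>x. fst x < m \<and> P *\<^sub>v ray B b k = ray B' (snd x) (fst x)" for b
  proof -
    obtain \<delta> where "\<forall>k<m. \<exists>l<m. P *\<^sub>v ray B b k = ray B' (\<delta> l) l" using raysP[of "\<lambda>_. b"] by blast
    then show ?thesis by (metis fst_conv snd_conv lessThan_iff)
  qed
  from bchoice[OF this, of False] bchoice[OF this, of True]
  obtain F T where F: "\<And>k. k < m \<Longrightarrow> fst (F k) < m \<and> P *\<^sub>v ray B False k = ray B' (snd (F k)) (fst (F k))"
    and T: "\<And>k. k < m \<Longrightarrow> fst (T k) < m \<and> P *\<^sub>v ray B True k = ray B' (snd (T k)) (fst (T k))"
    by (metis lessThan_iff)
  have fst: "fst (T k) = fst (F k)" if k: "k < m" for k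
  proof (rule ccontr)
    assume ne: "fst (T k) \<noteq> fst (F k)"
    \<comment> \<open>A choice containing the images of both e_k and v_k; it exists only because
      their indices differ.\<close>
    define \<epsilon> where "\<epsilon> = (\<lambda>l. if l = fst (F k) then snd (F k) else snd (T k))"
    obtain \<delta> where \<delta>: "\<forall>l<m. \<exists>j<m. Q *\<^sub>v ray B' (\<epsilon> l) l = ray B (\<delta> j) j" using raysQ by blast
    have "P *\<^sub>v ray B False k = ray B' (\<epsilon> (fst (F k))) (fst (F k))" using F[OF k] by (simp add: \<epsilon>_def)
    then obtain j where j: "j < m" "ray B False k = ray B (\<delta> j) j" using \<delta> F[OF k] QP_ray by metis
    have "P *\<^sub>v ray B True k = ray B' (\<epsilon> (fst (T k))) (fst (T k))" using T[OF k] ne by (simp add: \<epsilon>_def)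
    then obtain j' where j': "j' < m" "ray B True k = ray B (\<delta> j') j'" using \<delta> T[OF k] QP_ray by metis
    show False using ray_inject[OF B k j] ray_inject[OF B k j'] by simp
  qed
  have snd: "snd (T k) \<noteq> snd (F k)" if k: "k < m" for k
    using F[OF k] T[OF k] fst[OF k] inj[of False k True k] k by metis
  define \<sigma> where "\<sigma> = (\<lambda>k. fst (F k))"
  define f where "f = (\<lambda>k. snd (F k))"
  have img: "P *\<^sub>v ray B b k = ray B' (f k \<noteq> b) (\<sigma> k)" if "k < m" for k b
    using F[OF that] T[OF that] fst[OF that] snd[OF that]
    by (cases b; cases "snd (F k)") (simp_all add: \<sigma>_def f_def)
  have "inj_on \<sigma> {..<m}"
  proof (rule inj_onI)
    fix k l assume kl: "k \<in> {..<m}" "l \<in> {..<m}" "\<sigma> k = \<sigma> l"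
    \<comment> \<open>With the Boolean \<open>f k\<close> the image is the unit vector at
      \<open>\<sigma> k\<close>, so it depends on \<open>\<sigma> k\<close> alone.\<close>
    have "P *\<^sub>v ray B (f k) k = P *\<^sub>v ray B (f l) l" using img[of k "f k"] img[of l "f l"] kl by simp
    then show "k = l" using inj kl by blast
  qed
  moreover have "\<sigma> ` {..<m} \<subseteq> {..<m}" using F by (auto simp: \<sigma>_def)
  ultimately have "bij_betw \<sigma> {..<m} {..<m}"
    unfolding bij_betw_def using endo_inj_surj[of "{..<m}" \<sigma>] by simp
  then show ?thesis using img by blast
qed

theorem bott_isomorphic_imp_permutation:
  assumes B: "bott_matrix m B" and B': "bott_matrix m B'"
    and entries: "\<And>j k. k < j \<Longrightarrow> j < m \<Longrightarrow> B $$ (j, k) \<in> {-2, 0, 1}"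
    and entries': "\<And>j k. k < j \<Longrightarrow> j < m \<Longrightarrow> B' $$ (j, k) \<in> {-2, 0, 1}"
    and iso: "toric_isomorphic (bott_manifold B) (bott_manifold B')"
  obtains \<sigma> where "bij_betw \<sigma> {..<m} {..<m}"
    "\<And>j k. j < m \<Longrightarrow> k < m \<Longrightarrow> B' $$ (\<sigma> j, \<sigma> k) = B $$ (j, k)"
proof -
  have iso': "toric_isomorphic (fan_variety m (bott_fan B)) (fan_variety m (bott_fan B'))"
    using iso unfolding bott_manifold_def bott_matrix_dims(1)[OF B] bott_matrix_dims(1)[OF B'] .
  obtain M M' where M: "\<And>u. u \<in> carrier_vec m \<Longrightarrow> M u \<in> carrier_vec m"
    and M': "\<And>u. u \<in> carrier_vec m \<Longrightarrow> M' u \<in> carrier_vec m"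
    and add: "\<And>u v. u \<in> carrier_vec m \<Longrightarrow> v \<in> carrier_vec m \<Longrightarrow> M (u + v) = M u + M v"
    and add': "\<And>u v. u \<in> carrier_vec m \<Longrightarrow> v \<in> carrier_vec m \<Longrightarrow> M' (u + v) = M' u + M' v"
    and inv: "\<And>u. u \<in> carrier_vec m \<Longrightarrow> M' (M u) = u" "\<And>u. u \<in> carrier_vec m \<Longrightarrow> M (M' u) = u"
    and sub: "\<And>\<tau>. \<tau> \<in> bott_fan B \<Longrightarrow> \<exists>\<tau>'\<in>bott_fan B'. M ` cone_semigroup m \<tau>' \<subseteq> cone_semigroup m \<tau>"
    and sub': "\<And>\<tau>'. \<tau>' \<in> bott_fan B' \<Longrightarrow> \<exists>\<tau>\<in>bott_fan B. M' ` cone_semigroup m \<tau> \<subseteq> cone_semigroup m \<tau>'"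
    by (rule toric_isomorphic_dual[OF cone_family_bott_fan[OF B] cone_family_bott_fan[OF B'] iso']) blast
  obtain P where P: "P \<in> carrier_mat m m"
    and adjP: "\<And>u x. u \<in> carrier_vec m \<Longrightarrow> x \<in> carrier_vec m \<Longrightarrow> u \<bullet> (P *\<^sub>v x) = M u \<bullet> x"
    by (rule additive_transpose[of m M, OF M add]) auto
  obtain Q where Q: "Q \<in> carrier_mat m m"
    and adjQ: "\<And>u x. u \<in> carrier_vec m \<Longrightarrow> x \<in> carrier_vec m \<Longrightarrow> u \<bullet> (Q *\<^sub>v x) = M' u \<bullet> x"
    by (rule additive_transpose[of m M', OF M' add']) auto
  have comp: "u \<bullet> ((Q * P) *\<^sub>v x) = u \<bullet> x" if "u \<in> carrier_vec m" "x \<in> carrier_vec m" for u x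
  proof -
    have Px: "P *\<^sub>v x \<in> carrier_vec m" by (rule mult_mat_vec_carrier[OF P that(2)])
    have "u \<bullet> ((Q * P) *\<^sub>v x) = u \<bullet> (Q *\<^sub>v (P *\<^sub>v x))" unfolding assoc_mult_mat_vec[OF Q P that(2)] ..
    also have "\<dots> = M' u \<bullet> (P *\<^sub>v x)" by (rule adjQ[OF that(1) Px])
    also have "\<dots> = M (M' u) \<bullet> x" by (rule adjP[OF M'[OF that(1)] that(2)])
    finally show ?thesis unfolding inv(2)[OF that(1)] .
  qed
  have comp': "u \<bullet> ((P * Q) *\<^sub>v x) = u \<bullet> x" if "u \<in> carrier_vec m" "x \<in> carrier_vec m" for u x
  proof -
    have Qx: "Q *\<^sub>v x \<in> carrier_vec m" by (rule mult_mat_vec_carrier[OF Q that(2)])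
    have "u \<bullet> ((P * Q) *\<^sub>v x) = u \<bullet> (P *\<^sub>v (Q *\<^sub>v x))" unfolding assoc_mult_mat_vec[OF P Q that(2)] ..
    also have "\<dots> = M u \<bullet> (Q *\<^sub>v x)" by (rule adjP[OF that(1) Qx])
    also have "\<dots> = M' (M u) \<bullet> x" by (rule adjQ[OF M[OF that(1)] that(2)])
    finally show ?thesis unfolding inv(1)[OF that(1)] .
  qed
  have QP: "Q * P = 1\<^sub>m m" by (rule mat_eq_one_if_pairing) (use P Q comp in auto)
  have PQ: "P * Q = 1\<^sub>m m" by (rule mat_eq_one_if_pairing) (use P Q comp' in auto)
  have raysP: "\<exists>\<delta>. \<forall>k<m. \<exists>l<m. P *\<^sub>v ray B (\<epsilon> k) k = ray B' (\<delta> l) l" for \<epsilon>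
    by (rule cone_map_rays[OF B B' P Q QP, where M = M and M' = M']) (use adjP adjQ sub sub' in blast)+
  have raysQ: "\<exists>\<delta>. \<forall>k<m. \<exists>l<m. Q *\<^sub>v ray B' (\<epsilon> k) k = ray B (\<delta> l) l" for \<epsilon>
    by (rule cone_map_rays[OF B' B Q P PQ, where M = M' and M' = M]) (use adjP adjQ sub sub' in blast)+
  obtain \<sigma> f where \<sigma>: "bij_betw \<sigma> {..<m} {..<m}"
    and img: "\<And>k b. k < m \<Longrightarrow> P *\<^sub>v ray B b k = ray B' (f k \<noteq> b) (\<sigma> k)"
    using ray_maps_imp_permutation[OF B B' P Q QP raysP raysQ] by blast
  define \<rho> where "\<rho> = inv_into {..<m} \<sigma>"
  have \<rho>: "bij_betw \<rho> {..<m} {..<m}" unfolding \<rho>_def by (rule bij_betw_inv_into[OF \<sigma>])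
  have \<sigma>\<rho>: "\<sigma> (\<rho> k) = k" "\<rho> (\<sigma> k) = k" "\<rho> k < m" "\<sigma> k < m" if "k < m" for k
    using that \<sigma> \<rho> bij_betw_inv_into_right[OF \<sigma>] bij_betw_inv_into_left[OF \<sigma>]
    by (auto simp: \<rho>_def bij_betw_def)
  \<comment> \<open>\<open>exchange_trivial\<close> is applied to \<open>B'\<close>. The columns of
    \<open>P\<close> are the images of the unit vectors, that is, rays of \<open>B'\<close> chosen
    by \<open>f\<close>; in this basis the images of the v_k have the entries of \<open>B\<close> as
    coordinates, with indices carried over by \<open>\<rho>\<close>.\<close>
  have "\<forall>p<m. \<forall>k<m. B $$ (\<rho> p, \<rho> k) = B' $$ (p, k)"
  proof (rule exchange_trivial[OF B' entries', where g = "\<lambda>q. f (\<rho> q)"])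
    show "B $$ (\<rho> k, \<rho> k) = -1" if "k < m" for k
      using B \<sigma>\<rho>(3)[OF that] by (simp add: bott_matrix_def)
    show "B $$ (\<rho> j, \<rho> k) \<in> {-2, 0, 1}" if "j < m" "k < m" "j \<noteq> k" for j k
    proof -
      have "\<rho> j \<noteq> \<rho> k" using \<sigma>\<rho>(1) that by metis
      then consider "\<rho> j < \<rho> k" | "\<rho> k < \<rho> j" by linarith
      then show ?thesis
      proof cases
        case 1
        then show ?thesis using B \<sigma>\<rho>(3)[OF that(2)] \<sigma>\<rho>(3)[OF that(1)] by (simp add: bott_matrix_def)
      next
        case 2
        then show ?thesis using entries \<sigma>\<rho>(3)[OF that(1)] by blast
      qed
    qed
    show "ray B' (\<not> f (\<rho> k)) k $ p = (\<Sum>q<m. B $$ (\<rho> q, \<rho> k) * ray B' (f (\<rho> q)) q $ p)"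
      if k: "k < m" and p: "p < m" for k p
    proof -
      have P1: "P $$ (p, j) = ray B' (f j) (\<sigma> j) $ p" if j: "j < m" for j
      proof -
        have "ray B' (f j) (\<sigma> j) = P *\<^sub>v unit_vec m j"
          using img[OF j, of False] bott_matrix_dims(1)[OF B] by (simp add: ray_def)
        then show ?thesis using p j carrier_matD[OF P] by simp
      qed
      have "ray B' (\<not> f (\<rho> k)) k $ p = (P *\<^sub>v col B (\<rho> k)) $ p"
        using img[OF \<sigma>\<rho>(3)[OF k], of True] \<sigma>\<rho>(1)[OF k] by (simp add: ray_def)
      also have "\<dots> = (\<Sum>j<m. P $$ (p, j) * B $$ (j, \<rho> k))"
        using p \<sigma>\<rho>(3)[OF k] carrier_matD[OF P] bott_matrix_dims[OF B]
        by (simp add: scalar_prod_def atLeast0LessThan)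
      also have "\<dots> = (\<Sum>j<m. B $$ (j, \<rho> k) * ray B' (f j) (\<sigma> j) $ p)"
        by (intro sum.cong refl) (simp add: P1)
      also have "\<dots> = (\<Sum>q<m. B $$ (\<rho> q, \<rho> k) * ray B' (f (\<rho> q)) (\<sigma> (\<rho> q)) $ p)"
        by (rule sum.reindex_bij_betw[OF \<rho>, symmetric])
      also have "\<dots> = (\<Sum>q<m. B $$ (\<rho> q, \<rho> k) * ray B' (f (\<rho> q)) q $ p)"
        by (intro sum.cong refl) (simp add: \<sigma>\<rho>(1))
      finally show ?thesis .
    qed
  qed
  then have "B' $$ (\<sigma> j, \<sigma> k) = B $$ (j, k)" if "j < m" "k < m" for j k
    using \<sigma>\<rho>(2,4)[OF that(1)] \<sigma>\<rho>(2,4)[OF that(2)] by metis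
  with \<sigma> show thesis by (rule that)
qed

section \<open>Words and 2-moves\<close>

lemma bott_matrix_seq_matrix: "bott_matrix (length i) (seq_matrix i)"
  by (auto simp: bott_matrix_def seq_matrix_def)

lemma seq_matrix_below_diag:
  "k < j \<Longrightarrow> j < length i \<Longrightarrow> seq_matrix i $$ (j, k) =
    (if i ! j = i ! k then -2 else if \<bar>i ! j - i ! k\<bar> = 1 then 1 else 0)"
  by (simp add: seq_matrix_def)

text \<open>The matrix sees only the distances between letters; \<open>standardization\<close> and
  \<open>iota\<close> apply isometries of the integers.\<close>

lemma seq_matrix_map:
  assumes "\<And>a b. \<bar>f a - f b\<bar> = \<bar>a - b\<bar>"
  shows "seq_matrix (map f i) = seq_matrix i"
proof -
  have "f a = f b \<longleftrightarrow> a = b" for a b using assms[of a b] by auto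
  then show ?thesis by (intro eq_matI) (auto simp: seq_matrix_def assms)
qed

lemma seq_matrix_standardization: "seq_matrix (standardization i) = seq_matrix i"
  unfolding standardization_def by (rule seq_matrix_map) simp

lemma seq_matrix_iota: "seq_matrix (iota n i) = seq_matrix i"
  unfolding iota_def by (rule seq_matrix_map) simp

text \<open>Letters at distance at most 1 give a nonzero entry below the diagonal, and above it all
  entries are 0. So \<open>\<sigma>\<close> cannot carry such an entry across the diagonal, and
  these letters keep their order.\<close>

lemma seq_matrix_permutation:
  assumes bij: "bij_betw \<sigma> {..<m} {..<m}" and len: "length i = m" "length i' = m"
    and eq: "\<And>j k. j < m \<Longrightarrow> k < m \<Longrightarrow> seq_matrix i' $$ (\<sigma> j, \<sigma> k) = seq_matrix i $$ (j, k)"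
    and jk: "j < m" "k < m"
  shows "i' ! \<sigma> j = i' ! \<sigma> k \<longleftrightarrow> i ! j = i ! k"
    and "\<bar>i' ! \<sigma> j - i' ! \<sigma> k\<bar> = 1 \<longleftrightarrow> \<bar>i ! j - i ! k\<bar> = 1"
    and "j < k \<Longrightarrow> \<bar>i ! j - i ! k\<bar> \<le> 1 \<Longrightarrow> \<sigma> j < \<sigma> k"
proof -
  have lt: "\<sigma> j < m" if "j < m" for j using bij that by (auto simp: bij_betw_def)
  have inj: "\<sigma> j = \<sigma> k \<longleftrightarrow> j = k" if "j < m" "k < m" for j k
    using bij that by (auto simp: bij_betw_def inj_on_def)
  have upper: "seq_matrix i' $$ (a, b) = 0" if "a < b" "b < m" for a b
    using that len by (simp add: seq_matrix_def)
  have main: "(i' ! \<sigma> j = i' ! \<sigma> k \<longleftrightarrow> i ! j = i ! k) \<and>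
      (\<bar>i' ! \<sigma> j - i' ! \<sigma> k\<bar> = 1 \<longleftrightarrow> \<bar>i ! j - i ! k\<bar> = 1) \<and>
      (\<bar>i ! j - i ! k\<bar> \<le> 1 \<longrightarrow> \<sigma> j < \<sigma> k)" if "j < k" "k < m" for j k
  proof -
    have jm: "j < m" using that by simp
    have e1: "seq_matrix i' $$ (\<sigma> k, \<sigma> j) = seq_matrix i $$ (k, j)" using eq that jm by simp
    have e2: "seq_matrix i' $$ (\<sigma> j, \<sigma> k) = 0" using eq[OF jm that(2)] that len by (simp add: seq_matrix_def)
    have ik: "seq_matrix i $$ (k, j) = (if i ! k = i ! j then -2 else if \<bar>i ! k - i ! j\<bar> = 1 then 1 else 0)"
      using seq_matrix_below_diag that len by simp
    have "\<sigma> j \<noteq> \<sigma> k" using inj[OF jm that(2)] that by simp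
    then consider "\<sigma> j < \<sigma> k" | "\<sigma> k < \<sigma> j" by linarith
    then show ?thesis
    proof cases
      case 1
      have "seq_matrix i' $$ (\<sigma> k, \<sigma> j) =
          (if i' ! \<sigma> k = i' ! \<sigma> j then -2 else if \<bar>i' ! \<sigma> k - i' ! \<sigma> j\<bar> = 1 then 1 else 0)"
        using seq_matrix_below_diag[OF 1, of i'] lt[OF that(2)] len by simp
      then show ?thesis using e1 ik 1 by (auto split: if_splits)
    next
      \<comment> \<open>Here both equations match an entry below the diagonal with one above it, so
        both entries are 0 and both pairs of letters are at distance at least 2.\<close>
      case 2
      have "seq_matrix i' $$ (\<sigma> j, \<sigma> k) =
          (if i' ! \<sigma> j = i' ! \<sigma> k then -2 else if \<bar>i' ! \<sigma> j - i' ! \<sigma> k\<bar> = 1 then 1 else 0)"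
        using seq_matrix_below_diag[OF 2, of i'] lt[OF jm] len by simp
      moreover have "seq_matrix i $$ (k, j) = 0" using e1 upper[OF 2 lt[OF jm]] by simp
      ultimately show ?thesis using e2 ik by (auto split: if_splits)
    qed
  qed
  have "(i' ! \<sigma> j = i' ! \<sigma> k \<longleftrightarrow> i ! j = i ! k) \<and>
      (\<bar>i' ! \<sigma> j - i' ! \<sigma> k\<bar> = 1 \<longleftrightarrow> \<bar>i ! j - i ! k\<bar> = 1)"
  proof (cases j k rule: linorder_cases)
    case less
    then show ?thesis using main[OF less jk(2)] by blast
  next
    case greater
    then show ?thesis using main[OF greater jk(1)] by (metis abs_minus_commute)
  qed simp
  then show "i' ! \<sigma> j = i' ! \<sigma> k \<longleftrightarrow> i ! j = i ! k"
    "\<bar>i' ! \<sigma> j - i' ! \<sigma> k\<bar> = 1 \<longleftrightarrow> \<bar>i ! j - i ! k\<bar> = 1" by blast+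
  show "\<sigma> j < \<sigma> k" if "j < k" "\<bar>i ! j - i ! k\<bar> \<le> 1" using main[OF that(1) jk(2)] that(2) by blast
qed

text \<open>Injectivity forbids turning back, as that would repeat the value two steps earlier; so
  every step has the sign \<open>d\<close> of the first.\<close>

lemma unit_steps_imp_affine:
  fixes f :: "int \<Rightarrow> int"
  assumes inj: "inj_on f {a..b}" and step: "\<And>x. a \<le> x \<Longrightarrow> x < b \<Longrightarrow> \<bar>f (x + 1) - f x\<bar> = 1"
  obtains d where "d = 1 \<or> d = -1" "\<And>x. x \<in> {a..b} \<Longrightarrow> f x = f a + d * (x - a)"
proof (cases "a < b")
  case False
  then have "x = a" if "x \<in> {a..b}" for x using that by simp
  then have "f x = f a + 1 * (x - a)" if "x \<in> {a..b}" for x using that by force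
  then show thesis using that by blast
next
  case True
  define d where "d = f (a + 1) - f a"
  have d: "d = 1 \<or> d = -1" using step[of a] True unfolding d_def by auto
  have "x + 1 \<le> b \<longrightarrow> f x = f a + d * (x - a) \<and> f (x + 1) = f x + d" if "a \<le> x" for x
    using that
  proof (induction x rule: int_ge_induct)
    case base
    then show ?case by (simp add: d_def)
  next
    case (step x)
    show ?case
    proof
      assume le: "x + 1 + 1 \<le> b"
      have 1: "f x = f a + d * (x - a)" "f (x + 1) = f x + d" using step le by auto
      have "\<bar>f (x + 1 + 1) - f (x + 1)\<bar> = 1" using assms(2)[of "x + 1"] step.hyps le by simp
      moreover have "f (x + 1 + 1) \<noteq> f x" using inj_onD[OF inj, of "x + 1 + 1" x] step.hyps le by auto
      ultimately have "f (x + 1 + 1) = f (x + 1) + d" using 1(2) d by auto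
      then show "f (x + 1) = f a + d * (x + 1 - a) \<and> f (x + 1 + 1) = f (x + 1) + d"
        using 1 by (simp add: algebra_simps)
    qed
  qed
  note main = this
  have "f x = f a + d * (x - a)" if "x \<in> {a..b}" for x
  proof (cases "x = b")
    case True
    have "f (b - 1) = f a + d * (b - 1 - a) \<and> f (b - 1 + 1) = f (b - 1) + d"
      using main[of "b - 1"] \<open>a < b\<close> by simp
    then show ?thesis using True by (simp add: algebra_simps)
  next
    case False
    then show ?thesis using main[of x] that by simp
  qed
  then show thesis using that d by blast
qed

text \<open>A permutation of positions keeps the set of letters, and a shift moves the least letter
  along, so subtracting the minimum cancels \<open>c\<close>.\<close>

lemma standardization_shift:
  assumes bij: "bij_betw \<sigma> {..<m} {..<m}" and len: "length i = m" "length i' = m" "m > 0"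
    and shift: "\<And>j. j < m \<Longrightarrow> i' ! \<sigma> j = i ! j + c" and j: "j < m"
  shows "standardization i' ! \<sigma> j = standardization i ! j"
proof -
  have lt: "\<sigma> j < m" using bij j by (auto simp: bij_betw_def)
  have "set i' = (\<lambda>j. i' ! j) ` {..<m}" using len by (auto simp: set_conv_nth)
  also have "\<dots> = (\<lambda>j. i' ! j) ` (\<sigma> ` {..<m})" using bij by (simp add: bij_betw_def)
  also have "\<dots> = (\<lambda>x. x + c) ` (\<lambda>j. i ! j) ` {..<m}" using shift by (force simp: image_image)
  also have "(\<lambda>j. i ! j) ` {..<m} = set i" using len by (auto simp: set_conv_nth)
  finally have "set i' = (\<lambda>x. x + c) ` set i" .
  moreover have "Min ((\<lambda>x. x + c) ` set i) = Min (set i) + c"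
    using len by (intro mono_Min_commute[symmetric]) (auto intro: monoI)
  ultimately show ?thesis using lt j len shift by (simp add: standardization_def)
qed

section \<open>Sorting a word by 2-moves\<close>

text \<open>The rearrangement inequality for one adjacent transposition: the larger value gains when
  it moves to the larger index.\<close>

lemma swap_sum_less:
  fixes \<sigma> :: "nat \<Rightarrow> nat"
  assumes "Suc j < m" "\<sigma> (Suc j) < \<sigma> j"
  shows "(\<Sum>k<m. k * \<sigma> k) < (\<Sum>k<m. k * \<sigma> (if k = j then Suc j else if k = Suc j then j else k))"
proof -
  let ?t = "\<lambda>k. if k = j then Suc j else if k = Suc j then j else k"
  let ?R = "{..<m} - {j} - {Suc j}"
  have split: "(\<Sum>k<m. g k) = g j + (g (Suc j) + sum g ?R)" for g :: "nat \<Rightarrow> nat"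
    using assms(1) by (subst sum.remove[of _ j], simp, simp, subst sum.remove[of _ "Suc j"]) auto
  have "(\<Sum>k\<in>?R. k * \<sigma> (?t k)) = (\<Sum>k\<in>?R. k * \<sigma> k)" by (intro sum.cong) auto
  moreover have "j * \<sigma> j + Suc j * \<sigma> (Suc j) < j * \<sigma> (Suc j) + Suc j * \<sigma> j" using assms(2) by simp
  ultimately show ?thesis by (simp add: split)
qed

text \<open>Strict growth from 0 up to \<open>j\<close> gives \<open>j \<le> \<sigma> j\<close>, and
  strict growth from \<open>j\<close> up to \<open>m - 1\<close> leaves no room for more.\<close>

lemma no_descent_imp_id:
  fixes \<sigma> :: "nat \<Rightarrow> nat"
  assumes asc: "\<And>j. Suc j < m \<Longrightarrow> \<sigma> j < \<sigma> (Suc j)" and lt: "\<And>j. j < m \<Longrightarrow> \<sigma> j < m" and j: "j < m"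
  shows "\<sigma> j = j"
proof -
  have grow: "\<sigma> a + d \<le> \<sigma> (a + d)" if "a + d < m" for a d
    using that
  proof (induction d)
    case (Suc d)
    then show ?case using asc[of "a + d"] by simp
  qed simp
  have "j \<le> \<sigma> j" using grow[of 0 j] j by simp
  moreover have "\<sigma> j + (m - 1 - j) \<le> \<sigma> (m - 1)" using grow[of j "m - 1 - j"] j by simp
  ultimately show ?thesis using lt[of "m - 1"] j by simp
qed

text \<open>Each 2-move at a descent of \<open>\<sigma>\<close> increases \<open>\<Sum>k. k * \<sigma> k\<close>, which is bounded.\<close>

lemma two_moves_of_order_preserving:
  assumes "bij_betw \<sigma> {..<m} {..<m}" and "length w = m" "length w' = m"
    and "\<And>j. j < m \<Longrightarrow> w' ! \<sigma> j = w ! j"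
    and "\<And>j k. j < k \<Longrightarrow> k < m \<Longrightarrow> \<bar>w ! j - w ! k\<bar> \<le> 1 \<Longrightarrow> \<sigma> j < \<sigma> k"
  shows "two_move\<^sup>*\<^sup>* w w'"
  using assms
proof (induction "m * (m * m) - (\<Sum>k<m. k * \<sigma> k)" arbitrary: w \<sigma> rule: less_induct)
  case (less \<sigma> w)
  note bij = less.prems(1) and len = less.prems(2,3) and vals = less.prems(4) and ord = less.prems(5)
  have lt: "\<sigma> k < m" if "k < m" for k using bij that by (auto simp: bij_betw_def)
  show ?case
  proof (cases "\<exists>j. Suc j < m \<and> \<sigma> (Suc j) < \<sigma> j")
    case False
    have "\<sigma> j < \<sigma> (Suc j)" if j: "Suc j < m" for j
    proof -
      have "\<sigma> j \<noteq> \<sigma> (Suc j)" using inj_onD[OF bij_betw_imp_inj_on[OF bij], of j "Suc j"] j by auto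
      then show ?thesis using False j by (metis nat_neq_iff)
    qed
    then have "\<sigma> j = j" if "j < m" for j using no_descent_imp_id lt that by blast
    then have "w = w'" using vals len by (intro nth_equalityI) auto
    then show ?thesis by simp
  next
    case True
    then obtain j where j: "Suc j < m" "\<sigma> (Suc j) < \<sigma> j" by blast
    \<comment> \<open>A descent of \<open>\<sigma>\<close> can only occur at letters that are far
      apart, so exchanging them is a 2-move.\<close>
    have far: "\<bar>w ! j - w ! Suc j\<bar> > 1" using ord[of j "Suc j"] j by (meson lessI not_le less_asym)
    define t where "t = (\<lambda>k. if k = j then Suc j else if k = Suc j then j else k)"
    define v where "v = w[j := w ! Suc j, Suc j := w ! j]"
    have vt: "v ! k = w ! t k" if "k < m" for k
      using that j len by (simp add: v_def t_def nth_list_update)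
    have tm: "t k < m" if "k < m" for k using that j by (simp add: t_def)
    have tt: "t (t k) = k" for k by (simp add: t_def)
    have "bij_betw t {..<m} {..<m}"
      by (rule bij_betw_byWitness[where f' = t]) (use tm tt in auto)
    then have bij': "bij_betw (\<sigma> \<circ> t) {..<m} {..<m}" using bij by (rule bij_betw_trans)
    have move: "two_move w v" unfolding v_def using j(1) len far by (intro two_move.intros) simp_all
    have "two_move\<^sup>*\<^sup>* v w'"
    proof (rule less.hyps[OF _ bij'])
      have "(\<Sum>k<m. k * (\<sigma> \<circ> t) k) \<le> (\<Sum>k<m. m * m)"
      proof (rule sum_mono)
        fix k assume "k \<in> {..<m}"
        then have "(\<sigma> \<circ> t) k \<le> m" "k \<le> m" using lt[OF tm, of k] by auto
        then show "k * (\<sigma> \<circ> t) k \<le> m * m" by (intro mult_mono) simp_all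
      qed
      then have "(\<Sum>k<m. k * (\<sigma> \<circ> t) k) \<le> m * (m * m)" by simp
      moreover have "(\<Sum>k<m. k * \<sigma> k) < (\<Sum>k<m. k * (\<sigma> \<circ> t) k)"
        using swap_sum_less[of j m \<sigma>, OF j] by (simp add: t_def)
      ultimately show "m * (m * m) - (\<Sum>k<m. k * (\<sigma> \<circ> t) k) < m * (m * m) - (\<Sum>k<m. k * \<sigma> k)"
        by linarith
      show "length v = m" "length w' = m" using len by (simp_all add: v_def)
      show "w' ! (\<sigma> \<circ> t) k = v ! k" if "k < m" for k using vals[OF tm[OF that]] vt[OF that] by simp
      show "(\<sigma> \<circ> t) k < (\<sigma> \<circ> t) l" if kl: "k < l" "l < m" "\<bar>v ! k - v ! l\<bar> \<le> 1" for k l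
      proof -
        have "\<bar>w ! t k - w ! t l\<bar> \<le> 1" using kl vt by simp
        \<comment> \<open>The pair \<open>j\<close>, \<open>Suc j\<close> is the only one whose
          order \<open>t\<close> reverses, and its letters are too far apart to satisfy the
          hypothesis.\<close>
        moreover have "t k < t l"
        proof (rule ccontr)
          assume "\<not> t k < t l"
          then have "k = j \<and> l = Suc j" using kl(1) by (auto simp: t_def split: if_splits)
          then show False using \<open>\<bar>w ! t k - w ! t l\<bar> \<le> 1\<close> far by (simp add: t_def abs_minus_commute)
        qed
        ultimately show ?thesis using ord[of "t k" "t l"] tm[OF kl(2)] by simp
      qed
    qed
    then show ?thesis using move by (rule converse_rtranclp_into_rtranclp[rotated])
  qed
qed

section \<open>Words with a missing letter, and isomorphic words\<close>

lemma two_move_Cons: "two_move u v \<Longrightarrow> two_move (a # u) (a # v)"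
proof (induction rule: two_move.induct)
  case (1 j i)
  have "two_move (a # i) ((a # i)[Suc j := (a # i) ! Suc (Suc j), Suc (Suc j) := (a # i) ! Suc j])"
    using 1 by (intro two_move.intros) simp_all
  then show ?case by simp
qed

lemma two_moves_Cons: "two_move\<^sup>*\<^sup>* u v \<Longrightarrow> two_move\<^sup>*\<^sup>* (a # u) (a # v)"
proof (induction rule: rtranclp_induct)
  case (step v w)
  from step.IH two_move_Cons[OF step.hyps(2)] show ?case by (rule rtranclp.rtrancl_into_rtrancl)
qed simp

lemma two_moves_past:
  "\<forall>a\<in>set u. \<bar>a - b\<bar> > 1 \<Longrightarrow> two_move\<^sup>*\<^sup>* (b # u @ v) (u @ b # v)"
proof (induction u)
  case (Cons a u)
  have "two_move (b # a # u @ v) ((b # a # u @ v)[0 := (b # a # u @ v) ! Suc 0, Suc 0 := (b # a # u @ v) ! 0])"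
    using Cons.prems by (intro two_move.intros) (auto simp: abs_minus_commute)
  then have "two_move (b # a # u @ v) (a # b # u @ v)" by simp
  moreover have "two_move\<^sup>*\<^sup>* (a # b # u @ v) (a # u @ b # v)"
    using Cons by (intro two_moves_Cons) simp
  ultimately show ?case by (simp add: converse_rtranclp_into_rtranclp)
qed simp

text \<open>As \<open>c\<close> does not occur, a smaller and a larger letter differ by at least 2.
  In front of an already separated word a small letter may stay, and a large one moves past the
  whole block of small letters.\<close>

lemma two_moves_split_at_gap:
  assumes "c \<notin> set i"
  shows "two_move\<^sup>*\<^sup>* i (filter (\<lambda>a. a < c) i @ filter (\<lambda>a. c < a) i)"
  using assms
proof (induction i)
  case (Cons a i)
  have IH: "two_move\<^sup>*\<^sup>* (a # i) (a # filter (\<lambda>a. a < c) i @ filter (\<lambda>a. c < a) i)"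
    using Cons by (intro two_moves_Cons) simp
  show ?case
  proof (cases "a < c")
    case True
    then show ?thesis using IH by simp
  next
    case False
    then have "c < a" using Cons.prems by auto
    then have "two_move\<^sup>*\<^sup>* (a # filter (\<lambda>a. a < c) i @ filter (\<lambda>a. c < a) i)
        (filter (\<lambda>a. a < c) i @ a # filter (\<lambda>a. c < a) i)"
      by (intro two_moves_past) auto
    with IH have "two_move\<^sup>*\<^sup>* (a # i) (filter (\<lambda>a. a < c) i @ a # filter (\<lambda>a. c < a) i)"
      by (rule rtranclp_trans)
    then show ?thesis using False \<open>c < a\<close> by simp
  qed
qed simp

lemma seq_matrix_isomorphic_imp_two_moves:
  assumes len: "length i = m" "length i' = m" "m > 0"
    and iv: "set i = {a..b}"
    and iso: "toric_isomorphic (bott_manifold (seq_matrix i)) (bott_manifold (seq_matrix i'))"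
  shows "two_move\<^sup>*\<^sup>* (standardization i) (standardization i') \<or>
    two_move\<^sup>*\<^sup>* (standardization i) (standardization (iota n i'))"
proof -
  obtain \<sigma> where \<sigma>: "bij_betw \<sigma> {..<m} {..<m}"
    and eq: "\<And>j k. j < m \<Longrightarrow> k < m \<Longrightarrow> seq_matrix i' $$ (\<sigma> j, \<sigma> k) = seq_matrix i $$ (j, k)"
  proof (rule bott_isomorphic_imp_permutation[of m "seq_matrix i" "seq_matrix i'"])
    show "bott_matrix m (seq_matrix i)" "bott_matrix m (seq_matrix i')"
      using bott_matrix_seq_matrix[of i] bott_matrix_seq_matrix[of i'] len by auto
    show "seq_matrix i $$ (j, k) \<in> {-2, 0, 1}" if "k < j" "j < m" for j k
      using seq_matrix_below_diag[of k j i] that len by simp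
    show "seq_matrix i' $$ (j, k) \<in> {-2, 0, 1}" if "k < j" "j < m" for j k
      using seq_matrix_below_diag[of k j i'] that len by simp
  qed (use iso that in auto)
  note perm = seq_matrix_permutation[OF \<sigma> len(1,2) eq]
  have lt: "\<sigma> j < m" if "j < m" for j using \<sigma> that by (auto simp: bij_betw_def)
  have "\<forall>x\<in>{a..b}. \<exists>j. j < m \<and> i ! j = x" using iv len(1) by (metis in_set_conv_nth)
  then obtain g where g: "\<And>x. x \<in> {a..b} \<Longrightarrow> g x < m \<and> i ! g x = x" by metis
  \<comment> \<open>\<open>g\<close> picks a position for each letter. The letter \<open>f x\<close>
    does not depend on this choice, since equal letters go to equal letters.\<close>
  define f where "f = (\<lambda>x. i' ! \<sigma> (g x))"
  have mem: "i ! j \<in> {a..b}" if "j < m" for j using iv len(1) that nth_mem by blast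
  have f: "f (i ! j) = i' ! \<sigma> j" if "j < m" for j
    unfolding f_def using perm(1) g[OF mem[OF that]] that by blast
  have inj: "inj_on f {a..b}"
  proof (rule inj_onI)
    fix x y assume xy: "x \<in> {a..b}" "y \<in> {a..b}" "f x = f y"
    then have "i ! g x = i ! g y" using perm(1) g unfolding f_def by blast
    then show "x = y" using g xy by metis
  qed
  have step: "\<bar>f (x + 1) - f x\<bar> = 1" if "a \<le> x" "x < b" for x
  proof -
    have x: "x \<in> {a..b}" "x + 1 \<in> {a..b}" using that by auto
    have "\<bar>i ! g (x + 1) - i ! g x\<bar> = 1" using g[OF x(1)] g[OF x(2)] by simp
    then show ?thesis unfolding f_def using perm(2) g[OF x(1)] g[OF x(2)] by blast
  qed
  obtain d where d: "d = 1 \<or> d = -1" and aff: "\<And>x. x \<in> {a..b} \<Longrightarrow> f x = f a + d * (x - a)"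
    using unit_steps_imp_affine[OF inj step] by blast
  have val: "i' ! \<sigma> j = f a + d * (i ! j - a)" if "j < m" for j
    using f[OF that] aff[OF mem[OF that]] by simp
  have moves: "two_move\<^sup>*\<^sup>* (standardization i) (standardization u)"
    if "length u = m" and shift: "\<And>j. j < m \<Longrightarrow> u ! \<sigma> j = i ! j + c" for u c
  proof (rule two_moves_of_order_preserving[OF \<sigma>])
    show "length (standardization i) = m" "length (standardization u) = m"
      using len that by (simp_all add: standardization_def)
    show "standardization u ! \<sigma> j = standardization i ! j" if "j < m" for j
      by (rule standardization_shift[OF \<sigma> len(1) \<open>length u = m\<close> len(3) shift that])
    show "\<sigma> j < \<sigma> k"
      if "j < k" "k < m" "\<bar>standardization i ! j - standardization i ! k\<bar> \<le> 1" for j k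
      using perm(3)[of j k] that len by (simp add: standardization_def)
  qed
  from d show ?thesis
  proof
    assume "d = 1"
    then have "i' ! \<sigma> j = i ! j + (f a - a)" if "j < m" for j using val[OF that] by simp
    then show ?thesis using moves[OF len(2)] by blast
  next
    \<comment> \<open>Composing with \<open>iota\<close> reverses the slope, so in this case, too,
      only a shift remains for \<open>standardization\<close> to remove.\<close>
    assume "d = -1"
    then have "iota n i' ! \<sigma> j = i ! j + (int n + 1 - f a - a)" if "j < m" for j
      using val[OF that] lt[OF that] len by (simp add: iota_def)
    then show ?thesis using moves[of "iota n i'"] len by (simp add: iota_def)
  qed
qed

section \<open>Permutations of the coordinates\<close>

definition permute_vec :: "nat \<Rightarrow> (nat \<Rightarrow> nat) \<Rightarrow> 'a vec \<Rightarrow> 'a vec" where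
  "permute_vec m \<rho> x = vec m (\<lambda>j. x $ \<rho> j)"

text \<open>Both directions are carried along, because cones are moved by one and characters are
  pulled back by the other.\<close>

definition inverse_permutations :: "nat \<Rightarrow> (nat \<Rightarrow> nat) \<Rightarrow> (nat \<Rightarrow> nat) \<Rightarrow> bool" where
  "inverse_permutations m \<pi> \<rho> \<longleftrightarrow>
     (\<forall>j<m. \<pi> j < m \<and> \<rho> j < m \<and> \<pi> (\<rho> j) = j \<and> \<rho> (\<pi> j) = j)"

lemma inverse_permutationsD:
  assumes "inverse_permutations m \<pi> \<rho>" "j < m"
  shows "\<pi> j < m" "\<rho> j < m" "\<pi> (\<rho> j) = j" "\<rho> (\<pi> j) = j"
  using assms unfolding inverse_permutations_def by blast+

lemma inverse_permutations_sym: "inverse_permutations m \<pi> \<rho> \<Longrightarrow> inverse_permutations m \<rho> \<pi>"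
  unfolding inverse_permutations_def by blast

lemma inverse_permutations_bij:
  assumes "inverse_permutations m \<pi> \<rho>"
  shows "bij_betw \<pi> {..<m} {..<m}"
  by (rule bij_betw_byWitness[where f' = \<rho>]) (use inverse_permutationsD[OF assms] in auto)

lemma permute_vec_carrier: "permute_vec m \<rho> x \<in> carrier_vec m"
  unfolding permute_vec_def by (rule vec_carrier)

lemma permute_vec_inverse:
  assumes "inverse_permutations m \<pi> \<rho>" "x \<in> carrier_vec m"
  shows "permute_vec m \<pi> (permute_vec m \<rho> x) = x"
  using assms(2) inverse_permutationsD[OF assms(1)] by (intro eq_vecI) (auto simp: permute_vec_def)

lemma permute_vec_add:
  assumes "inverse_permutations m \<pi> \<rho>" "u \<in> carrier_vec m" "v \<in> carrier_vec m"
  shows "permute_vec m \<pi> (u + v) = permute_vec m \<pi> u + permute_vec m \<pi> v"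
  using assms(2,3) inverse_permutationsD[OF assms(1)] by (intro eq_vecI) (auto simp: permute_vec_def)

text \<open>The adjoint of a coordinate permutation is its inverse; in the sum this is the
  substitution of \<open>\<pi> k\<close> for \<open>j\<close>.\<close>

lemma pairing_permute:
  assumes P: "inverse_permutations m \<pi> \<rho>" and "u \<in> carrier_vec m" "x \<in> carrier_vec m"
  shows "pairing u (permute_vec m \<rho> x) = pairing (permute_vec m \<pi> u) x"
proof -
  have "pairing u (permute_vec m \<rho> x) = (\<Sum>j<m. real_of_int (u $ j) * x $ \<rho> j)"
    unfolding pairing_def scalar_prod_eq_sum[OF permute_vec_carrier]
    using assms(2) by (intro sum.cong) (auto simp: permute_vec_def)
  also have "\<dots> = (\<Sum>k<m. real_of_int (u $ \<pi> k) * x $ \<rho> (\<pi> k))"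
    by (rule sum.reindex_bij_betw[OF inverse_permutations_bij[OF P], symmetric])
  also have "\<dots> = pairing (permute_vec m \<pi> u) x"
    unfolding pairing_def scalar_prod_eq_sum[OF assms(3)]
    using inverse_permutationsD[OF P] by (intro sum.cong) (auto simp: permute_vec_def)
  finally show ?thesis .
qed

lemma permute_vec_image_inverse:
  assumes "inverse_permutations m \<pi> \<rho>" "\<tau> \<subseteq> carrier_vec m"
  shows "permute_vec m \<pi> ` permute_vec m \<rho> ` \<tau> = \<tau>"
  using permute_vec_inverse[OF assms(1)] assms(2) by (force simp: image_image subset_iff)

lemma cone_perp_permute:
  assumes "inverse_permutations m \<pi> \<rho>" "\<tau> \<subseteq> carrier_vec m" "u \<in> carrier_vec m"
  shows "u \<in> cone_perp m (permute_vec m \<rho> ` \<tau>) \<longleftrightarrow> permute_vec m \<pi> u \<in> cone_perp m \<tau>"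
  using pairing_permute[OF assms(1,3)] assms(2,3) permute_vec_carrier[of m \<pi> u]
  by (auto simp: cone_perp_def subset_iff)

lemma cone_semigroup_permute:
  assumes "inverse_permutations m \<pi> \<rho>" "\<tau> \<subseteq> carrier_vec m" "u \<in> carrier_vec m"
  shows "u \<in> cone_semigroup m (permute_vec m \<rho> ` \<tau>) \<longleftrightarrow> permute_vec m \<pi> u \<in> cone_semigroup m \<tau>"
  using pairing_permute[OF assms(1,3)] assms(2,3) permute_vec_carrier[of m \<pi> u]
  by (auto simp: cone_semigroup_def subset_iff)

definition permute_point :: "nat \<Rightarrow> (nat \<Rightarrow> nat) \<Rightarrow> (nat \<Rightarrow> nat) \<Rightarrow> toric_point \<Rightarrow> toric_point" where
  "permute_point m \<pi> \<rho> = (\<lambda>(\<tau>, x).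
     (permute_vec m \<rho> ` \<tau>, \<lambda>u. if u \<in> carrier_vec m then x (permute_vec m \<pi> u) else 0))"

lemma permute_point_orbit:
  assumes P: "inverse_permutations m \<pi> \<rho>" and \<tau>: "\<tau> \<subseteq> carrier_vec m" and x: "x \<in> cone_orbit m \<tau>"
  shows "(\<lambda>u. if u \<in> carrier_vec m then x (permute_vec m \<pi> u) else 0)
    \<in> cone_orbit m (permute_vec m \<rho> ` \<tau>)"
  by (rule cone_orbit_pullback[OF x])
    (auto simp only: cone_perp_permute[OF P \<tau>] permute_vec_add[OF P])

lemma toric_morphism_permute:
  assumes P: "inverse_permutations m \<pi> \<rho>" and \<Sigma>: "\<And>\<tau>. \<tau> \<in> \<Sigma> \<Longrightarrow> \<tau> \<subseteq> carrier_vec m"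
  shows "toric_morphism (fan_variety m \<Sigma>) (fan_variety m ((`) (permute_vec m \<rho>) ` \<Sigma>)) (permute_point m \<pi> \<rho>)"
proof -
  let ?\<Sigma>' = "(`) (permute_vec m \<rho>) ` \<Sigma>"
  let ?X = "fan_variety m \<Sigma>" and ?Y = "fan_variety m ?\<Sigma>'" and ?\<phi> = "permute_point m \<pi> \<rho>"
  have pts: "?\<phi> ` points ?X \<subseteq> points ?Y"
  proof
    fix q assume "q \<in> ?\<phi> ` points ?X"
    then obtain \<tau> x where q: "q = ?\<phi> (\<tau>, x)" "\<tau> \<in> \<Sigma>" "x \<in> cone_orbit m \<tau>"
      by (auto simp: points_fan_variety)
    show "q \<in> points ?Y" unfolding q(1) permute_point_def points_fan_variety
      using q(2) permute_point_orbit[OF P \<Sigma>[OF q(2)] q(3)] by simp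
  qed
  have "variety_morphism ?X ?Y ?\<phi>"
  proof (rule variety_morphismI[OF pts])
    fix V C assume "(V, C) \<in> charts ?Y"
    then obtain \<sigma> where \<sigma>: "\<sigma> \<in> \<Sigma>" and V: "V = affine_chart m ?\<Sigma>' (permute_vec m \<rho> ` \<sigma>)"
      and C: "C = coordinate_ring m (permute_vec m \<rho> ` \<sigma>)" by (auto simp: charts_fan_variety)
    have sub: "permute_vec m \<rho> ` \<tau> \<subseteq> permute_vec m \<rho> ` \<sigma> \<longleftrightarrow> \<tau> \<subseteq> \<sigma>" if "\<tau> \<in> \<Sigma>" for \<tau>
    proof
      assume "permute_vec m \<rho> ` \<tau> \<subseteq> permute_vec m \<rho> ` \<sigma>"
      then have "permute_vec m \<pi> ` permute_vec m \<rho> ` \<tau> \<subseteq> permute_vec m \<pi> ` permute_vec m \<rho> ` \<sigma>"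
        by (rule image_mono)
      then show "\<tau> \<subseteq> \<sigma>" unfolding permute_vec_image_inverse[OF P \<Sigma>[OF that]]
          permute_vec_image_inverse[OF P \<Sigma>[OF \<sigma>]] .
    qed (rule image_mono)
    have "affine_chart m \<Sigma> \<sigma> = {p \<in> points ?X. ?\<phi> p \<in> V}"
    proof (intro equalityI subsetI)
      fix p assume "p \<in> affine_chart m \<Sigma> \<sigma>"
      then obtain \<tau> x where p: "p = (\<tau>, x)" "\<tau> \<in> \<Sigma>" "\<tau> \<subseteq> \<sigma>" "x \<in> cone_orbit m \<tau>"
        by (auto simp: affine_chart_def)
      have "?\<phi> p \<in> V" unfolding V p(1) permute_point_def affine_chart_def
        using p(2) sub[OF p(2)] p(3) permute_point_orbit[OF P \<Sigma>[OF p(2)] p(4)] by simp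
      then show "p \<in> {p \<in> points ?X. ?\<phi> p \<in> V}" using p by (simp add: points_fan_variety)
    next
      fix p assume "p \<in> {p \<in> points ?X. ?\<phi> p \<in> V}"
      then obtain \<tau> x where p: "p = (\<tau>, x)" "\<tau> \<in> \<Sigma>" "x \<in> cone_orbit m \<tau>" and "?\<phi> (\<tau>, x) \<in> V"
        by (auto simp: points_fan_variety)
      then have "permute_vec m \<rho> ` \<tau> \<subseteq> permute_vec m \<rho> ` \<sigma>"
        unfolding V permute_point_def affine_chart_def by simp
      then show "p \<in> affine_chart m \<Sigma> \<sigma>" using p sub[OF p(2)] by (simp add: affine_chart_def)
    qed
    moreover have "\<exists>a\<in>coordinate_ring m \<sigma>. \<forall>p\<in>affine_chart m \<Sigma> \<sigma>. a p = c (?\<phi> p)" if c: "c \<in> C" for c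
    proof -
      have "permute_vec m \<pi> u \<in> cone_semigroup m \<sigma>" if "u \<in> cone_semigroup m (permute_vec m \<rho> ` \<sigma>)" for u
        using that cone_semigroup_permute[OF P \<Sigma>[OF \<sigma>], of u] by (auto simp: cone_semigroup_def)
      from coordinate_ring_pullback[where h = "permute_vec m \<pi>", OF c[unfolded C] this] obtain a where a: "a \<in> coordinate_ring m \<sigma>"
        "\<And>\<tau> \<tau>' x. a (\<tau>, x) = c (\<tau>', \<lambda>u. if u \<in> carrier_vec m then x (permute_vec m \<pi> u) else 0)"
        by blast
      show ?thesis
        by (intro bexI[OF _ a(1)] ballI) (auto simp: permute_point_def a(2))
    qed
    ultimately show "\<exists>(U, A)\<in>charts ?X. U = {p \<in> points ?X. ?\<phi> p \<in> V} \<and> (\<forall>c\<in>C. \<exists>a\<in>A. \<forall>p\<in>U. a p = c (?\<phi> p))"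
      using \<sigma> by (intro bexI[of _ "(affine_chart m \<Sigma> \<sigma>, coordinate_ring m \<sigma>)"] case_prodI conjI ballI)
        (auto simp: charts_fan_variety)
  qed
  moreover have "?\<phi> \<in> hom (fan_torus m) (fan_torus m)"
  proof -
    have "permute_vec m \<rho> (0\<^sub>v m :: real vec) = 0\<^sub>v m"
      using inverse_permutationsD[OF P] by (intro eq_vecI) (auto simp: permute_vec_def)
    then have zero: "permute_vec m \<rho> ` {0\<^sub>v m :: real vec} = {0\<^sub>v m}" by simp
    have "{0\<^sub>v m} \<subseteq> carrier_vec m" by simp
    note orbit = permute_point_orbit[OF P this, unfolded zero]
    show ?thesis
      unfolding hom_def fan_torus_def permute_point_def
      using orbit zero by (auto simp: fun_eq_iff)
  qed
  ultimately show ?thesis unfolding toric_morphism_def by (simp add: fan_variety_def)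
qed

lemma permute_point_inverse:
  assumes P: "inverse_permutations m \<pi> \<rho>" and \<tau>: "\<tau> \<subseteq> carrier_vec m" and x: "x \<in> cone_orbit m \<tau>"
  shows "permute_point m \<rho> \<pi> (permute_point m \<pi> \<rho> (\<tau>, x)) = (\<tau>, x)"
proof -
  \<comment> \<open>Equal points are equal as functions on vectors of every dimension; outside
    dimension \<open>m\<close> both sides are 0.\<close>
  have "x u = 0" if "u \<notin> carrier_vec m" for u
    using x that by (auto simp: cone_orbit_def cone_perp_def)
  moreover have inv: "permute_vec m \<pi> (permute_vec m \<rho> u) = u" if "u \<in> carrier_vec m" for u :: "int vec"
    by (rule permute_vec_inverse[OF P that])
  moreover have carr: "permute_vec m \<rho> u \<in> carrier_vec m" for u :: "int vec" by (rule permute_vec_carrier)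
  ultimately have "(\<lambda>u. if u \<in> carrier_vec m then if permute_vec m \<rho> u \<in> carrier_vec m
      then x (permute_vec m \<pi> (permute_vec m \<rho> u)) else 0 else 0) = x"
    using inv carr by (intro ext) simp
  then show ?thesis
    unfolding permute_point_def case_prod_conv using permute_vec_image_inverse[OF P \<tau>] by (simp only:)
qed

lemma toric_isomorphic_permute:
  assumes P: "inverse_permutations m \<pi> \<rho>" and \<Sigma>: "\<And>\<tau>. \<tau> \<in> \<Sigma> \<Longrightarrow> \<tau> \<subseteq> carrier_vec m"
  shows "toric_isomorphic (fan_variety m \<Sigma>) (fan_variety m ((`) (permute_vec m \<rho>) ` \<Sigma>))"
proof -
  let ?\<Sigma>' = "(`) (permute_vec m \<rho>) ` \<Sigma>"
  note P' = inverse_permutations_sym[OF P]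
  have \<Sigma>': "\<tau> \<subseteq> carrier_vec m" if "\<tau> \<in> ?\<Sigma>'" for \<tau> using that permute_vec_carrier by blast
  have "permute_vec m \<pi> ` permute_vec m \<rho> ` \<tau> = \<tau>" if "\<tau> \<in> \<Sigma>" for \<tau>
    using permute_vec_image_inverse[OF P \<Sigma>[OF that]] .
  then have eq: "(`) (permute_vec m \<pi>) ` ?\<Sigma>' = \<Sigma>" by (auto simp: image_iff)
  have 2: "toric_morphism (fan_variety m ?\<Sigma>') (fan_variety m \<Sigma>) (permute_point m \<rho> \<pi>)"
    using toric_morphism_permute[of m \<rho> \<pi> ?\<Sigma>', OF P'] \<Sigma>' unfolding eq by (simp only:)
  have 1: "toric_morphism (fan_variety m \<Sigma>) (fan_variety m ?\<Sigma>') (permute_point m \<pi> \<rho>)"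
    by (rule toric_morphism_permute[OF P]) (rule \<Sigma>)
  have 3: "\<forall>p\<in>points (fan_variety m \<Sigma>). permute_point m \<rho> \<pi> (permute_point m \<pi> \<rho> p) = p"
    using permute_point_inverse[OF P \<Sigma>] by (auto simp: points_fan_variety)
  have 4: "\<forall>p\<in>points (fan_variety m ?\<Sigma>'). permute_point m \<pi> \<rho> (permute_point m \<rho> \<pi> p) = p"
    using permute_point_inverse[OF P' \<Sigma>'] by (auto simp: points_fan_variety)
  show ?thesis
    unfolding toric_isomorphic_def
    by (intro exI[of _ "permute_point m \<pi> \<rho>"] exI[of _ "permute_point m \<rho> \<pi>"] conjI 1 2 3 4)
qed

section \<open>Permuted Bott matrices and the effect of 2-moves\<close>

text \<open>Coefficients become functions of the index instead of the vector, which injectivity of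
  \<open>w\<close> allows. Cones with different generators can then be compared coefficient by
  coefficient.\<close>

lemma cone_spanned_image:
  assumes "finite K" "inj_on w K"
  shows "cone_spanned m (w ` K) = {vec m (\<lambda>j. \<Sum>k\<in>K. c k * real_of_int (w k $ j)) | c. \<forall>k\<in>K. 0 \<le> c k}"
proof (intro equalityI subsetI)
  fix x assume "x \<in> cone_spanned m (w ` K)"
  then obtain c where c: "x = vec m (\<lambda>j. \<Sum>s\<in>w ` K. c s * real_of_int (s $ j))" "\<forall>s\<in>w ` K. 0 \<le> c s"
    unfolding cone_spanned_def by blast
  have "x = vec m (\<lambda>j. \<Sum>k\<in>K. (c \<circ> w) k * real_of_int (w k $ j))"
    unfolding c(1) by (simp add: sum.reindex[OF assms(2)])
  moreover have "\<forall>k\<in>K. 0 \<le> (c \<circ> w) k" using c(2) by simp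
  ultimately show "x \<in> {vec m (\<lambda>j. \<Sum>k\<in>K. c k * real_of_int (w k $ j)) | c. \<forall>k\<in>K. 0 \<le> c k}" by blast
next
  fix x assume "x \<in> {vec m (\<lambda>j. \<Sum>k\<in>K. c k * real_of_int (w k $ j)) | c. \<forall>k\<in>K. 0 \<le> c k}"
  then obtain c where c: "x = vec m (\<lambda>j. \<Sum>k\<in>K. c k * real_of_int (w k $ j))" "\<forall>k\<in>K. 0 \<le> c k" by blast
  define d where "d = c \<circ> inv_into K w"
  have d: "d (w k) = c k" if "k \<in> K" for k using that assms(2) by (simp add: d_def)
  have "x = vec m (\<lambda>j. \<Sum>s\<in>w ` K. d s * real_of_int (s $ j))"
    unfolding c(1) by (simp add: sum.reindex[OF assms(2)] d)
  moreover have "\<forall>s\<in>w ` K. 0 \<le> d s" using c(2) d by simp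
  ultimately show "x \<in> cone_spanned m (w ` K)" unfolding cone_spanned_def by blast
qed

lemma inj_on_ray:
  assumes B: "bott_matrix m B" and K: "K \<subseteq> {..<m}"
  shows "inj_on (\<lambda>k. ray B (\<epsilon> k) k) K"
  by (intro inj_onI) (use ray_inject(1)[OF B] K in blast)

text \<open>The fan of \<open>B'\<close> is that of \<open>B\<close> in permuted coordinates: ray
  \<open>k\<close> goes to the ray of the same kind at \<open>\<pi> k\<close>, so a choice
  \<open>\<epsilon>\<close> becomes \<open>\<epsilon>\<close> composed with
  \<open>\<rho>\<close>.\<close>

lemma bott_manifold_permutation_isomorphic:
  assumes B: "bott_matrix m B" and B': "bott_matrix m B'" and P: "inverse_permutations m \<pi> \<rho>"
    and eq: "\<And>j k. j < m \<Longrightarrow> k < m \<Longrightarrow> B' $$ (\<pi> j, \<pi> k) = B $$ (j, k)"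
  shows "toric_isomorphic (bott_manifold B) (bott_manifold B')"
proof -
  note D = inverse_permutationsD[OF P]
  have ray: "ray B' b (\<pi> k) $ j = ray B b k $ \<rho> j" if "k < m" "j < m" for b k j
  proof (cases b)
    case True
    have "B' $$ (j, \<pi> k) = B $$ (\<rho> j, k)" using eq[OF D(2)[OF that(2)] that(1)] D(3)[OF that(2)] by simp
    then show ?thesis using True that D bott_matrix_dims[OF B] bott_matrix_dims[OF B'] by (simp add: ray_def)
  next
    case False
    have "j = \<pi> k \<longleftrightarrow> \<rho> j = k" using D that by metis
    then show ?thesis using False that D bott_matrix_dims[OF B] bott_matrix_dims[OF B'] by (simp add: ray_def)
  qed
  have cone: "permute_vec m \<rho> ` cone_spanned m ((\<lambda>k. ray B (\<epsilon> k) k) ` K) =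
      cone_spanned m ((\<lambda>k. ray B' (\<epsilon> (\<rho> k)) k) ` \<pi> ` K)" if K: "K \<subseteq> {..<m}" for \<epsilon> K
  proof -
    have fin: "finite K" using K finite_subset by blast
    have inj: "inj_on \<pi> K" by (rule inj_on_subset[OF bij_betw_imp_inj_on[OF inverse_permutations_bij[OF P]] K])
    have img: "(\<lambda>k. ray B' (\<epsilon> (\<rho> k)) k) ` \<pi> ` K = (\<lambda>k. ray B' (\<epsilon> k) (\<pi> k)) ` K"
      unfolding image_image using K D(4) by (intro image_cong) auto
    have inj': "inj_on (\<lambda>k. ray B' (\<epsilon> k) (\<pi> k)) K"
    proof (rule inj_onI)
      fix k l assume kl: "k \<in> K" "l \<in> K" "ray B' (\<epsilon> k) (\<pi> k) = ray B' (\<epsilon> l) (\<pi> l)"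
      then have "\<pi> k = \<pi> l" using ray_inject(1)[OF B' _ _ kl(3)] D(1) K by blast
      then show "k = l" using inj kl by (simp add: inj_on_eq_iff)
    qed
    have pv: "permute_vec m \<rho> (vec m (\<lambda>j. \<Sum>k\<in>K. c k * real_of_int (ray B (\<epsilon> k) k $ j))) =
        vec m (\<lambda>j. \<Sum>k\<in>K. c k * real_of_int (ray B' (\<epsilon> k) (\<pi> k) $ j))" for c
    proof (rule eq_vecI)
      fix j assume "j < dim_vec (vec m (\<lambda>j. \<Sum>k\<in>K. c k * real_of_int (ray B' (\<epsilon> k) (\<pi> k) $ j)))"
      then have j: "j < m" by simp
      have "(\<Sum>k\<in>K. c k * real_of_int (ray B (\<epsilon> k) k $ \<rho> j)) = (\<Sum>k\<in>K. c k * real_of_int (ray B' (\<epsilon> k) (\<pi> k) $ j))"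
        using ray[OF _ j] K by (intro sum.cong refl) auto
      then show "permute_vec m \<rho> (vec m (\<lambda>j. \<Sum>k\<in>K. c k * real_of_int (ray B (\<epsilon> k) k $ j))) $ j =
          vec m (\<lambda>j. \<Sum>k\<in>K. c k * real_of_int (ray B' (\<epsilon> k) (\<pi> k) $ j)) $ j"
        using j D(2)[OF j] by (simp add: permute_vec_def)
    qed (simp add: permute_vec_def)
    show ?thesis
      unfolding img cone_spanned_image[OF fin inj_on_ray[OF B K]] cone_spanned_image[OF fin inj']
    proof (intro equalityI subsetI)
      fix x assume "x \<in> permute_vec m \<rho> `
        {vec m (\<lambda>j. \<Sum>k\<in>K. c k * real_of_int (ray B (\<epsilon> k) k $ j)) |c. \<forall>k\<in>K. 0 \<le> c k}"
      then obtain c where c: "\<forall>k\<in>K. 0 \<le> c k"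
        "x = permute_vec m \<rho> (vec m (\<lambda>j. \<Sum>k\<in>K. c k * real_of_int (ray B (\<epsilon> k) k $ j)))" by blast
      show "x \<in> {vec m (\<lambda>j. \<Sum>k\<in>K. c k * real_of_int (ray B' (\<epsilon> k) (\<pi> k) $ j)) |c. \<forall>k\<in>K. 0 \<le> c k}"
        using c(1) unfolding c(2) pv by blast
    next
      fix x assume "x \<in> {vec m (\<lambda>j. \<Sum>k\<in>K. c k * real_of_int (ray B' (\<epsilon> k) (\<pi> k) $ j)) |c. \<forall>k\<in>K. 0 \<le> c k}"
      then obtain c where c: "\<forall>k\<in>K. 0 \<le> c k"
        "x = vec m (\<lambda>j. \<Sum>k\<in>K. c k * real_of_int (ray B' (\<epsilon> k) (\<pi> k) $ j))" by blast
      show "x \<in> permute_vec m \<rho> `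
        {vec m (\<lambda>j. \<Sum>k\<in>K. c k * real_of_int (ray B (\<epsilon> k) k $ j)) |c. \<forall>k\<in>K. 0 \<le> c k}"
        using c(1) unfolding c(2) pv[symmetric] by blast
    qed
  qed
  have "(`) (permute_vec m \<rho>) ` bott_fan B = bott_fan B'"
  proof (intro equalityI subsetI)
    fix \<sigma> assume "\<sigma> \<in> (`) (permute_vec m \<rho>) ` bott_fan B"
    then obtain \<epsilon> K where K: "K \<subseteq> {..<m}" "\<sigma> = permute_vec m \<rho> ` cone_spanned m ((\<lambda>k. ray B (\<epsilon> k) k) ` K)"
      unfolding bott_fan_eq[OF B] by blast
    have "\<pi> ` K \<subseteq> {..<m}" using K(1) D(1) by blast
    then show "\<sigma> \<in> bott_fan B'"
      unfolding K(2) cone[OF K(1)] bott_fan_eq[OF B']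
      by (intro CollectI exI[of _ "\<lambda>k. \<epsilon> (\<rho> k)"] exI[of _ "\<pi> ` K"] conjI refl)
  next
    fix \<sigma> assume "\<sigma> \<in> bott_fan B'"
    then obtain \<epsilon> K where K: "K \<subseteq> {..<m}" "\<sigma> = cone_spanned m ((\<lambda>k. ray B' (\<epsilon> k) k) ` K)"
      unfolding bott_fan_eq[OF B'] by blast
    have K': "\<rho> ` K \<subseteq> {..<m}" using K(1) D(2) by blast
    have "\<pi> ` \<rho> ` K = K" using K(1) D(3) by (force simp: image_image)
    moreover have "(\<lambda>k. ray B' (\<epsilon> (\<pi> (\<rho> k))) k) ` K = (\<lambda>k. ray B' (\<epsilon> k) k) ` K"
      using K(1) D(3) by (intro image_cong) auto
    ultimately have "\<sigma> = permute_vec m \<rho> ` cone_spanned m ((\<lambda>k. ray B (\<epsilon> (\<pi> k)) k) ` \<rho> ` K)"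
      unfolding K(2) cone[OF K', of "\<lambda>k. \<epsilon> (\<pi> k)"] by simp
    moreover have "cone_spanned m ((\<lambda>k. ray B (\<epsilon> (\<pi> k)) k) ` \<rho> ` K) \<in> bott_fan B"
      unfolding bott_fan_eq[OF B]
      by (intro CollectI exI[of _ "\<lambda>k. \<epsilon> (\<pi> k)"] exI[of _ "\<rho> ` K"] conjI refl K')
    ultimately show "\<sigma> \<in> (`) (permute_vec m \<rho>) ` bott_fan B" by blast
  qed
  moreover have "toric_isomorphic (fan_variety m (bott_fan B))
      (fan_variety m ((`) (permute_vec m \<rho>) ` bott_fan B))"
    by (rule toric_isomorphic_permute[OF P]) (rule cone_familyD(2)[OF cone_family_bott_fan[OF B]])
  ultimately show ?thesis
    unfolding bott_manifold_def bott_matrix_dims(1)[OF B] bott_matrix_dims(1)[OF B'] by (simp only:)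
qed

text \<open>The exchange conjugates the matrix by a transposition. Only the two entries between
  positions \<open>j\<close> and \<open>Suc j\<close> change sides of the diagonal, and they are 0
  because these letters are far apart.\<close>

lemma two_move_isomorphic:
  assumes "two_move i i'"
  shows "toric_isomorphic (bott_manifold (seq_matrix i)) (bott_manifold (seq_matrix i'))"
  using assms
proof (cases rule: two_move.cases)
  case (1 j)
  let ?t = "\<lambda>k. if k = j then Suc j else if k = Suc j then j else k"
  let ?m = "length i"
  have len: "length i' = ?m" using 1(1) by simp
  have nth: "i' ! ?t k = i ! k" if "k < ?m" for k
    using 1 that by (simp add: nth_list_update)
  have B': "bott_matrix ?m (seq_matrix i')" using bott_matrix_seq_matrix[of i'] len by simp
  have P: "inverse_permutations ?m ?t ?t" using 1(2) by (auto simp: inverse_permutations_def)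
  show ?thesis
  proof (rule bott_manifold_permutation_isomorphic[OF bott_matrix_seq_matrix[of i] B' P])
    fix a b assume ab: "a < ?m" "b < ?m"
    note ta = inverse_permutationsD(1)[OF P ab(1)] and tb = inverse_permutationsD(1)[OF P ab(2)]
    have far: "\<not> \<bar>i ! j - i ! Suc j\<bar> \<le> 1" using 1(3) by simp
    have entry: "seq_matrix u $$ (a, b) = (if a < b then 0 else if a = b then -1
      else if u ! a = u ! b then -2 else if \<bar>u ! a - u ! b\<bar> = 1 then 1 else 0)"
      if "a < length u" "b < length u" for u a b using that by (simp add: seq_matrix_def)
    have eq: "seq_matrix i' $$ (?t a, ?t b) = (if ?t a < ?t b then 0 else if ?t a = ?t b then -1
      else if i ! a = i ! b then -2 else if \<bar>i ! a - i ! b\<bar> = 1 then 1 else 0)"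
      using entry[of "?t a" i' "?t b"] ta tb len nth[OF ab(1)] nth[OF ab(2)] by presburger
    show "seq_matrix i' $$ (?t a, ?t b) = seq_matrix i $$ (a, b)"
    proof (cases "(a = j \<and> b = Suc j) \<or> (a = Suc j \<and> b = j)")
      case True
      then have "i ! a \<noteq> i ! b \<and> \<bar>i ! a - i ! b\<bar> \<noteq> 1 \<and> a \<noteq> b \<and> ?t a \<noteq> ?t b" using far by auto
      then show ?thesis unfolding eq entry[OF ab] by simp
    next
      case False
      then have "?t a < ?t b \<longleftrightarrow> a < b" "?t a = ?t b \<longleftrightarrow> a = b" by auto
      then show ?thesis unfolding eq entry[OF ab] by (simp only:)
    qed
  qed
qed

lemma two_moves_isomorphic:
  assumes "two_move\<^sup>*\<^sup>* i i'"
  shows "toric_isomorphic (bott_manifold (seq_matrix i)) (bott_manifold (seq_matrix i'))"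
  using assms
proof (induction rule: rtranclp_induct)
  case base
  show ?case by (rule toric_isomorphic_refl)
next
  case (step u v)
  show ?case by (rule toric_isomorphic_trans[OF step.IH two_move_isomorphic[OF step.hyps(2)]])
qed

section \<open>Products of fans\<close>

definition cone_join :: "real vec set \<Rightarrow> real vec set \<Rightarrow> real vec set" where
  "cone_join \<sigma> \<tau> = {a @\<^sub>v b | a b. a \<in> \<sigma> \<and> b \<in> \<tau>}"

lemma cone_joinE:
  assumes "x \<in> cone_join \<sigma> \<tau>"
  obtains a b where "x = a @\<^sub>v b" "a \<in> \<sigma>" "b \<in> \<tau>"
  using assms unfolding cone_join_def by blast

lemma cone_joinI: "a \<in> \<sigma> \<Longrightarrow> b \<in> \<tau> \<Longrightarrow> a @\<^sub>v b \<in> cone_join \<sigma> \<tau>"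
  unfolding cone_join_def by blast

lemma vec_first_append_eq: "a \<in> carrier_vec m \<Longrightarrow> vec_first (a @\<^sub>v b) m = a"
  by (intro eq_vecI) (auto simp: vec_first_def)

lemma vec_last_append_eq: "b \<in> carrier_vec m \<Longrightarrow> vec_last (a @\<^sub>v b) m = b"
  by (intro eq_vecI) (auto simp: vec_last_def)

lemma append_zero_vec: "0\<^sub>v m @\<^sub>v 0\<^sub>v n = 0\<^sub>v (m + n)"
  by (intro eq_vecI) auto

text \<open>The zero vectors matter: they make each factor a projection of the join, and a condition
  on all concatenations \<open>a @\<^sub>v b\<close> splits into one on each factor by putting the
  other part equal to zero.\<close>

locale cone_pair =
  fixes m1 m2 :: nat and \<sigma>1 \<sigma>2 :: "real vec set"
  assumes \<sigma>1: "\<sigma>1 \<subseteq> carrier_vec m1" "0\<^sub>v m1 \<in> \<sigma>1" and \<sigma>2: "\<sigma>2 \<subseteq> carrier_vec m2" "0\<^sub>v m2 \<in> \<sigma>2"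
begin

lemma join_carrier: "cone_join \<sigma>1 \<sigma>2 \<subseteq> carrier_vec (m1 + m2)"
  using \<sigma>1 \<sigma>2 by (auto elim!: cone_joinE)

lemma first_join: "(\<lambda>a. vec_first a m1) ` cone_join \<sigma>1 \<sigma>2 = \<sigma>1"
proof (intro equalityI subsetI)
  fix a assume "a \<in> \<sigma>1"
  then have "a @\<^sub>v 0\<^sub>v m2 \<in> cone_join \<sigma>1 \<sigma>2" "vec_first (a @\<^sub>v 0\<^sub>v m2) m1 = a"
    using \<sigma>1 \<sigma>2 by (auto intro: cone_joinI vec_first_append_eq)
  then show "a \<in> (\<lambda>a. vec_first a m1) ` cone_join \<sigma>1 \<sigma>2" by (metis imageI)
qed (use \<sigma>1 in \<open>auto elim!: cone_joinE simp: vec_first_append_eq subset_iff\<close>)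

lemma last_join: "(\<lambda>a. vec_last a m2) ` cone_join \<sigma>1 \<sigma>2 = \<sigma>2"
proof (intro equalityI subsetI)
  fix a assume "a \<in> \<sigma>2"
  then have "0\<^sub>v m1 @\<^sub>v a \<in> cone_join \<sigma>1 \<sigma>2" "vec_last (0\<^sub>v m1 @\<^sub>v a) m2 = a"
    using \<sigma>1 \<sigma>2 by (auto intro: cone_joinI vec_last_append_eq)
  then show "a \<in> (\<lambda>a. vec_last a m2) ` cone_join \<sigma>1 \<sigma>2" by (metis imageI)
qed (use \<sigma>2 in \<open>auto elim!: cone_joinE simp: vec_last_append_eq subset_iff\<close>)

lemma pairing_append:
  assumes "u \<in> carrier_vec m1" "v \<in> carrier_vec m2" "a \<in> carrier_vec m1" "b \<in> carrier_vec m2"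
  shows "pairing (u @\<^sub>v v) (a @\<^sub>v b) = pairing u a + pairing v b"
proof -
  have "map_vec real_of_int (u @\<^sub>v v) = map_vec real_of_int u @\<^sub>v map_vec real_of_int v"
    by (intro eq_vecI) auto
  then show ?thesis
    unfolding pairing_def using assms
    by (simp add: scalar_prod_append[of _ m1 _ m2])
qed

lemma cone_semigroup_join:
  assumes uv: "u \<in> carrier_vec m1" "v \<in> carrier_vec m2"
  shows "u @\<^sub>v v \<in> cone_semigroup (m1 + m2) (cone_join \<sigma>1 \<sigma>2) \<longleftrightarrow>
    u \<in> cone_semigroup m1 \<sigma>1 \<and> v \<in> cone_semigroup m2 \<sigma>2"
proof -
  have pa: "pairing (u @\<^sub>v v) (a @\<^sub>v b) = pairing u a + pairing v b" if "a \<in> \<sigma>1" "b \<in> \<sigma>2" for a b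
    using pairing_append[OF uv] that \<sigma>1 \<sigma>2 by blast
  have "(\<forall>x\<in>cone_join \<sigma>1 \<sigma>2. 0 \<le> pairing (u @\<^sub>v v) x) \<longleftrightarrow>
      (\<forall>a\<in>\<sigma>1. \<forall>b\<in>\<sigma>2. 0 \<le> pairing u a + pairing v b)"
    using pa by (auto elim!: cone_joinE dest!: bspec[OF _ cone_joinI])
  also have "\<dots> \<longleftrightarrow> (\<forall>a\<in>\<sigma>1. 0 \<le> pairing u a) \<and> (\<forall>b\<in>\<sigma>2. 0 \<le> pairing v b)"
    using \<sigma>1(2) \<sigma>2(2) pairing_zero[OF uv(1)] pairing_zero[OF uv(2)]
    by (metis add_nonneg_nonneg add.left_neutral add.right_neutral)
  finally show ?thesis using uv by (simp add: cone_semigroup_def)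
qed

lemma cone_perp_join:
  assumes uv: "u \<in> carrier_vec m1" "v \<in> carrier_vec m2"
  shows "u @\<^sub>v v \<in> cone_perp (m1 + m2) (cone_join \<sigma>1 \<sigma>2) \<longleftrightarrow>
    u \<in> cone_perp m1 \<sigma>1 \<and> v \<in> cone_perp m2 \<sigma>2"
proof -
  have pa: "pairing (u @\<^sub>v v) (a @\<^sub>v b) = pairing u a + pairing v b" if "a \<in> \<sigma>1" "b \<in> \<sigma>2" for a b
    using pairing_append[OF uv] that \<sigma>1 \<sigma>2 by blast
  have "(\<forall>x\<in>cone_join \<sigma>1 \<sigma>2. pairing (u @\<^sub>v v) x = 0) \<longleftrightarrow>
      (\<forall>a\<in>\<sigma>1. \<forall>b\<in>\<sigma>2. pairing u a + pairing v b = 0)"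
    using pa by (auto elim!: cone_joinE dest!: bspec[OF _ cone_joinI])
  also have "\<dots> \<longleftrightarrow> (\<forall>a\<in>\<sigma>1. pairing u a = 0) \<and> (\<forall>b\<in>\<sigma>2. pairing v b = 0)"
    using \<sigma>1(2) \<sigma>2(2) pairing_zero[OF uv(1)] pairing_zero[OF uv(2)]
    by (metis add.left_neutral add.right_neutral)
  finally show ?thesis using uv by (simp add: cone_perp_def)
qed

lemma cone_orbit_join:
  assumes x: "x \<in> cone_orbit m1 \<sigma>1" and y: "y \<in> cone_orbit m2 \<sigma>2"
  shows "(\<lambda>u. if u \<in> carrier_vec (m1 + m2) then x (vec_first u m1) * y (vec_last u m2) else 0)
    \<in> cone_orbit (m1 + m2) (cone_join \<sigma>1 \<sigma>2)" (is "?z \<in> _")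
proof -
  have perp: "u \<in> cone_perp (m1 + m2) (cone_join \<sigma>1 \<sigma>2) \<longleftrightarrow>
      vec_first u m1 \<in> cone_perp m1 \<sigma>1 \<and> vec_last u m2 \<in> cone_perp m2 \<sigma>2"
    if "u \<in> carrier_vec (m1 + m2)" for u
    using cone_perp_join[of "vec_first u m1" "vec_last u m2"] that by simp
  have carr: "u \<in> carrier_vec (m1 + m2)" if "u \<in> cone_perp (m1 + m2) (cone_join \<sigma>1 \<sigma>2)" for u
    using that by (simp add: cone_perp_def)
  have nz: "?z u \<noteq> 0 \<longleftrightarrow> u \<in> cone_perp (m1 + m2) (cone_join \<sigma>1 \<sigma>2)" for u
  proof (cases "u \<in> carrier_vec (m1 + m2)")
    case True
    then show ?thesis using perp[OF True] x y by (simp add: cone_orbit_def)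
  qed (use carr in auto)
  have "?z (u + v) = ?z u * ?z v"
    if "u \<in> cone_perp (m1 + m2) (cone_join \<sigma>1 \<sigma>2)" "v \<in> cone_perp (m1 + m2) (cone_join \<sigma>1 \<sigma>2)" for u v
  proof -
    note uv = carr[OF that(1)] carr[OF that(2)]
    have "vec_first (u + v) m1 = vec_first u m1 + vec_first v m1"
      "vec_last (u + v) m2 = vec_last u m2 + vec_last v m2"
      using uv by (auto simp: vec_first_def vec_last_def)
    moreover have "x (vec_first u m1 + vec_first v m1) = x (vec_first u m1) * x (vec_first v m1)"
      "y (vec_last u m2 + vec_last v m2) = y (vec_last u m2) * y (vec_last v m2)"
      using that perp uv x y by (auto simp: cone_orbit_def)
    ultimately show ?thesis using uv by simp
  qed
  with nz show ?thesis unfolding cone_orbit_def by simp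
qed

lemma cone_orbit_first:
  assumes x: "x \<in> cone_orbit (m1 + m2) (cone_join \<sigma>1 \<sigma>2)"
  shows "(\<lambda>u. if u \<in> carrier_vec m1 then x (u @\<^sub>v 0\<^sub>v m2) else 0) \<in> cone_orbit m1 \<sigma>1"
proof (rule cone_orbit_pullback[OF x])
  show "u @\<^sub>v 0\<^sub>v m2 \<in> cone_perp (m1 + m2) (cone_join \<sigma>1 \<sigma>2) \<longleftrightarrow> u \<in> cone_perp m1 \<sigma>1"
    if "u \<in> carrier_vec m1" for u
    using cone_perp_join[OF that, of "0\<^sub>v m2"] zero_in_cone_perp[OF \<sigma>2(1)] by simp
  show "(u + v) @\<^sub>v 0\<^sub>v m2 = (u @\<^sub>v 0\<^sub>v m2) + (v @\<^sub>v 0\<^sub>v m2)"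
    if "u \<in> carrier_vec m1" "v \<in> carrier_vec m1" for u v :: "int vec"
    using append_vec_add[OF that, of "0\<^sub>v m2" m2 "0\<^sub>v m2"] by simp
qed

lemma cone_orbit_last:
  assumes x: "x \<in> cone_orbit (m1 + m2) (cone_join \<sigma>1 \<sigma>2)"
  shows "(\<lambda>u. if u \<in> carrier_vec m2 then x (0\<^sub>v m1 @\<^sub>v u) else 0) \<in> cone_orbit m2 \<sigma>2"
proof (rule cone_orbit_pullback[OF x])
  show "0\<^sub>v m1 @\<^sub>v u \<in> cone_perp (m1 + m2) (cone_join \<sigma>1 \<sigma>2) \<longleftrightarrow> u \<in> cone_perp m2 \<sigma>2"
    if "u \<in> carrier_vec m2" for u
    using cone_perp_join[OF _ that, of "0\<^sub>v m1"] zero_in_cone_perp[OF \<sigma>1(1)] by simp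
  show "0\<^sub>v m1 @\<^sub>v (u + v) = (0\<^sub>v m1 @\<^sub>v u) + (0\<^sub>v m1 @\<^sub>v v)"
    if "u \<in> carrier_vec m2" "v \<in> carrier_vec m2" for u v :: "int vec"
    using append_vec_add[OF _ _ that, of "0\<^sub>v m1" m1 "0\<^sub>v m1"] by simp
qed

end

section \<open>Points and charts of a product\<close>

text \<open>A character of the product torus is a pair of characters, and its value is the product
  of theirs. \<open>split_point\<close> recovers the parts from the characters that are trivial on
  the other factor.\<close>

definition join_point :: "nat \<Rightarrow> nat \<Rightarrow> toric_point \<times> toric_point \<Rightarrow> toric_point" where
  "join_point m1 m2 = (\<lambda>((\<tau>1, x), (\<tau>2, y)). (cone_join \<tau>1 \<tau>2,
     \<lambda>u. if u \<in> carrier_vec (m1 + m2) then x (vec_first u m1) * y (vec_last u m2) else 0))"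

definition split_point :: "nat \<Rightarrow> nat \<Rightarrow> toric_point \<Rightarrow> toric_point \<times> toric_point" where
  "split_point m1 m2 = (\<lambda>(\<tau>, x).
     (((\<lambda>a. vec_first a m1) ` \<tau>, \<lambda>u. if u \<in> carrier_vec m1 then x (u @\<^sub>v 0\<^sub>v m2) else 0),
      ((\<lambda>a. vec_last a m2) ` \<tau>, \<lambda>u. if u \<in> carrier_vec m2 then x (0\<^sub>v m1 @\<^sub>v u) else 0)))"

lemma (in cone_pair) split_join_point:
  assumes x: "x \<in> cone_orbit m1 \<sigma>1" and y: "y \<in> cone_orbit m2 \<sigma>2"
  shows "split_point m1 m2 (join_point m1 m2 ((\<sigma>1, x), (\<sigma>2, y))) = ((\<sigma>1, x), (\<sigma>2, y))"
proof -
  have 0: "x u = 0" if "u \<notin> carrier_vec m1" for u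
    using x that by (auto simp: cone_orbit_def cone_perp_def)
  have 1: "y u = 0" if "u \<notin> carrier_vec m2" for u
    using y that by (auto simp: cone_orbit_def cone_perp_def)
  note one = cone_orbit_at_zero[OF x \<sigma>1(1)] cone_orbit_at_zero[OF y \<sigma>2(1)]
  show ?thesis
    unfolding join_point_def split_point_def
    using 0 1 one by (auto simp: first_join last_join vec_first_append_eq vec_last_append_eq fun_eq_iff)
qed

text \<open>On an orthogonal vector \<open>x\<close> is multiplicative, and the vector is the sum of
  its two parts padded by zeros. For any other vector one padded part fails to be orthogonal, and
  both sides are 0.\<close>

lemma (in cone_pair) join_split_point:
  assumes x: "x \<in> cone_orbit (m1 + m2) (cone_join \<sigma>1 \<sigma>2)"
  shows "join_point m1 m2 (split_point m1 m2 (cone_join \<sigma>1 \<sigma>2, x)) = (cone_join \<sigma>1 \<sigma>2, x)"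
proof -
  have 0: "x u = 0" if "u \<notin> carrier_vec (m1 + m2)" for u
    using x that by (auto simp: cone_orbit_def cone_perp_def)
  have "x (vec_first u m1 @\<^sub>v 0\<^sub>v m2) * x (0\<^sub>v m1 @\<^sub>v vec_last u m2) = x u"
    if u: "u \<in> carrier_vec (m1 + m2)" for u
  proof (cases "u \<in> cone_perp (m1 + m2) (cone_join \<sigma>1 \<sigma>2)")
    case True
    have perp: "vec_first u m1 \<in> cone_perp m1 \<sigma>1" "vec_last u m2 \<in> cone_perp m2 \<sigma>2"
      using cone_perp_join[of "vec_first u m1" "vec_last u m2"] u True by simp_all
    have "(vec_first u m1 @\<^sub>v 0\<^sub>v m2) + (0\<^sub>v m1 @\<^sub>v vec_last u m2) = u"
      using append_vec_add[of "vec_first u m1" m1 "0\<^sub>v m1" "0\<^sub>v m2" m2 "vec_last u m2"] u by simp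
    moreover have "vec_first u m1 @\<^sub>v 0\<^sub>v m2 \<in> cone_perp (m1 + m2) (cone_join \<sigma>1 \<sigma>2)"
      "0\<^sub>v m1 @\<^sub>v vec_last u m2 \<in> cone_perp (m1 + m2) (cone_join \<sigma>1 \<sigma>2)"
      using perp zero_in_cone_perp[OF \<sigma>1(1)] zero_in_cone_perp[OF \<sigma>2(1)] by (simp_all add: cone_perp_join)
    moreover have "x (v + w) = x v * x w" if "v \<in> cone_perp (m1 + m2) (cone_join \<sigma>1 \<sigma>2)"
      "w \<in> cone_perp (m1 + m2) (cone_join \<sigma>1 \<sigma>2)" for v w
      using x that by (simp add: cone_orbit_def)
    ultimately show ?thesis by metis
  next
    case False
    then have "\<not> (vec_first u m1 \<in> cone_perp m1 \<sigma>1 \<and> vec_last u m2 \<in> cone_perp m2 \<sigma>2)"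
      using cone_perp_join[of "vec_first u m1" "vec_last u m2"] u by simp
    then have "vec_first u m1 @\<^sub>v 0\<^sub>v m2 \<notin> cone_perp (m1 + m2) (cone_join \<sigma>1 \<sigma>2) \<or>
        0\<^sub>v m1 @\<^sub>v vec_last u m2 \<notin> cone_perp (m1 + m2) (cone_join \<sigma>1 \<sigma>2)"
      by (simp add: cone_perp_join)
    moreover have "x w = 0" if "w \<notin> cone_perp (m1 + m2) (cone_join \<sigma>1 \<sigma>2)" for w
      using x that by (auto simp: cone_orbit_def)
    ultimately show ?thesis using False by auto
  qed
  then have "(\<lambda>u. if u \<in> carrier_vec (m1 + m2)
      then x (vec_first u m1 @\<^sub>v 0\<^sub>v m2) * x (0\<^sub>v m1 @\<^sub>v vec_last u m2) else 0) = x"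
    using 0 by (intro ext) simp
  then show ?thesis
    unfolding split_point_def join_point_def case_prod_conv first_join last_join by (simp cong: if_cong)
qed

lemma charts_toric_product:
  "(W, C) \<in> charts (toric_product X Y) \<longleftrightarrow> (\<exists>U A V B. W = U \<times> V \<and> C = tensor_functions A B \<and>
     (U, A) \<in> charts X \<and> (V, B) \<in> charts Y)"
  by (simp add: toric_product_def)

lemma points_iff: "p \<in> points X \<longleftrightarrow> (\<exists>U A. (U, A) \<in> charts X \<and> p \<in> U)"
  by (auto simp: points_def)

lemma points_toric_product: "points (toric_product X Y) = points X \<times> points Y"
proof (intro Set.set_eqI)
  fix z :: "'a \<times> 'b"
  obtain p q where z: "z = (p, q)" by (cases z)
  show "z \<in> points (toric_product X Y) \<longleftrightarrow> z \<in> points X \<times> points Y"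
    unfolding z mem_Times_iff fst_conv snd_conv points_iff charts_toric_product by blast
qed

locale cone_family_pair =
  fixes m1 m2 :: nat and \<Sigma>1 \<Sigma>2 :: "real vec set set"
  assumes \<Sigma>1: "cone_family m1 \<Sigma>1" and \<Sigma>2: "cone_family m2 \<Sigma>2"
begin

definition join_fan :: "real vec set set" where
  "join_fan = {cone_join \<sigma>1 \<sigma>2 | \<sigma>1 \<sigma>2. \<sigma>1 \<in> \<Sigma>1 \<and> \<sigma>2 \<in> \<Sigma>2}"

abbreviation "prod_variety \<equiv> toric_product (fan_variety m1 \<Sigma>1) (fan_variety m2 \<Sigma>2)"
abbreviation "join_variety \<equiv> fan_variety (m1 + m2) join_fan"

lemma cone_pair: "\<sigma>1 \<in> \<Sigma>1 \<Longrightarrow> \<sigma>2 \<in> \<Sigma>2 \<Longrightarrow> cone_pair m1 m2 \<sigma>1 \<sigma>2"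
  using cone_familyD[OF \<Sigma>1] cone_familyD[OF \<Sigma>2] by unfold_locales auto

lemma points_prod: "points prod_variety = points (fan_variety m1 \<Sigma>1) \<times> points (fan_variety m2 \<Sigma>2)"
  by (rule points_toric_product)

lemma join_subset_iff:
  assumes "\<sigma>1 \<in> \<Sigma>1" "\<sigma>2 \<in> \<Sigma>2" "\<tau>1 \<in> \<Sigma>1" "\<tau>2 \<in> \<Sigma>2"
  shows "cone_join \<tau>1 \<tau>2 \<subseteq> cone_join \<sigma>1 \<sigma>2 \<longleftrightarrow> \<tau>1 \<subseteq> \<sigma>1 \<and> \<tau>2 \<subseteq> \<sigma>2"
proof -
  interpret s: cone_pair m1 m2 \<sigma>1 \<sigma>2 using assms by (intro cone_pair)
  interpret t: cone_pair m1 m2 \<tau>1 \<tau>2 using assms by (intro cone_pair)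
  show ?thesis
  proof
    assume "cone_join \<tau>1 \<tau>2 \<subseteq> cone_join \<sigma>1 \<sigma>2"
    then show "\<tau>1 \<subseteq> \<sigma>1 \<and> \<tau>2 \<subseteq> \<sigma>2"
      using s.first_join s.last_join t.first_join t.last_join by (metis image_mono)
  qed (auto simp: cone_join_def)
qed

lemma points_join_iff:
  "p \<in> points join_variety \<longleftrightarrow> (\<exists>\<tau>1\<in>\<Sigma>1. \<exists>\<tau>2\<in>\<Sigma>2. \<exists>x\<in>cone_orbit (m1 + m2) (cone_join \<tau>1 \<tau>2). p = (cone_join \<tau>1 \<tau>2, x))"
  by (cases p) (auto simp: points_fan_variety join_fan_def)

lemma points_prod_iff:
  "p \<in> points prod_variety \<longleftrightarrow> (\<exists>\<tau>1\<in>\<Sigma>1. \<exists>\<tau>2\<in>\<Sigma>2. \<exists>x\<in>cone_orbit m1 \<tau>1. \<exists>y\<in>cone_orbit m2 \<tau>2. p = ((\<tau>1, x), (\<tau>2, y)))"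
  by (cases p) (auto simp: points_prod points_fan_variety)

lemma charts_prod_iff:
  "(W, C) \<in> charts prod_variety \<longleftrightarrow> (\<exists>\<sigma>1\<in>\<Sigma>1. \<exists>\<sigma>2\<in>\<Sigma>2.
     W = affine_chart m1 \<Sigma>1 \<sigma>1 \<times> affine_chart m2 \<Sigma>2 \<sigma>2 \<and>
     C = tensor_functions (coordinate_ring m1 \<sigma>1) (coordinate_ring m2 \<sigma>2))"
  unfolding charts_toric_product charts_fan_variety by blast

lemma charts_join_iff:
  "(W, C) \<in> charts join_variety \<longleftrightarrow> (\<exists>\<sigma>1\<in>\<Sigma>1. \<exists>\<sigma>2\<in>\<Sigma>2.
     W = affine_chart (m1 + m2) join_fan (cone_join \<sigma>1 \<sigma>2) \<and>
     C = coordinate_ring (m1 + m2) (cone_join \<sigma>1 \<sigma>2))"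
  by (auto simp: charts_fan_variety join_fan_def)

lemma split_point_join:
  assumes "\<tau>1 \<in> \<Sigma>1" "\<tau>2 \<in> \<Sigma>2" "x \<in> cone_orbit (m1 + m2) (cone_join \<tau>1 \<tau>2)"
  obtains y z where "y \<in> cone_orbit m1 \<tau>1" "z \<in> cone_orbit m2 \<tau>2"
    "split_point m1 m2 (cone_join \<tau>1 \<tau>2, x) = ((\<tau>1, y), (\<tau>2, z))"
proof -
  interpret cone_pair m1 m2 \<tau>1 \<tau>2 using assms by (intro cone_pair)
  show thesis
    by (rule that[OF cone_orbit_first[OF assms(3)] cone_orbit_last[OF assms(3)]])
      (simp add: split_point_def first_join last_join)
qed

lemma join_point_prod:
  assumes "\<tau>1 \<in> \<Sigma>1" "\<tau>2 \<in> \<Sigma>2" "x \<in> cone_orbit m1 \<tau>1" "y \<in> cone_orbit m2 \<tau>2"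
  obtains z where "z \<in> cone_orbit (m1 + m2) (cone_join \<tau>1 \<tau>2)"
    "join_point m1 m2 ((\<tau>1, x), (\<tau>2, y)) = (cone_join \<tau>1 \<tau>2, z)"
proof -
  interpret cone_pair m1 m2 \<tau>1 \<tau>2 using assms by (intro cone_pair)
  show thesis
    by (rule that[OF cone_orbit_join[OF assms(3,4)]]) (simp add: join_point_def)
qed

lemma split_point_in_chart_iff:
  assumes \<sigma>: "\<sigma>1 \<in> \<Sigma>1" "\<sigma>2 \<in> \<Sigma>2" and p: "p \<in> points join_variety"
  shows "split_point m1 m2 p \<in> affine_chart m1 \<Sigma>1 \<sigma>1 \<times> affine_chart m2 \<Sigma>2 \<sigma>2 \<longleftrightarrow>
    p \<in> affine_chart (m1 + m2) join_fan (cone_join \<sigma>1 \<sigma>2)"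
proof -
  obtain \<tau>1 \<tau>2 x where t: "\<tau>1 \<in> \<Sigma>1" "\<tau>2 \<in> \<Sigma>2" "x \<in> cone_orbit (m1 + m2) (cone_join \<tau>1 \<tau>2)"
    "p = (cone_join \<tau>1 \<tau>2, x)" using p unfolding points_join_iff by blast
  have J: "cone_join \<tau>1 \<tau>2 \<in> join_fan" using t(1,2) unfolding join_fan_def by blast
  obtain y z where yz: "y \<in> cone_orbit m1 \<tau>1" "z \<in> cone_orbit m2 \<tau>2"
    "split_point m1 m2 p = ((\<tau>1, y), (\<tau>2, z))"
    using split_point_join[OF t(1,2,3)] unfolding t(4) by blast
  show ?thesis
    unfolding yz(3) unfolding t(4) affine_chart_def
    using t(1-3) yz(1,2) J join_subset_iff[OF \<sigma> t(1,2)] by simp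
qed

lemma join_point_in_chart_iff:
  assumes \<sigma>: "\<sigma>1 \<in> \<Sigma>1" "\<sigma>2 \<in> \<Sigma>2" and p: "p \<in> points prod_variety"
  shows "join_point m1 m2 p \<in> affine_chart (m1 + m2) join_fan (cone_join \<sigma>1 \<sigma>2) \<longleftrightarrow>
    p \<in> affine_chart m1 \<Sigma>1 \<sigma>1 \<times> affine_chart m2 \<Sigma>2 \<sigma>2"
proof -
  obtain \<tau>1 \<tau>2 x y where t: "\<tau>1 \<in> \<Sigma>1" "\<tau>2 \<in> \<Sigma>2" "x \<in> cone_orbit m1 \<tau>1" "y \<in> cone_orbit m2 \<tau>2"
    "p = ((\<tau>1, x), (\<tau>2, y))" using p unfolding points_prod_iff by blast
  have J: "cone_join \<tau>1 \<tau>2 \<in> join_fan" using t(1,2) unfolding join_fan_def by blast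
  obtain z where z: "z \<in> cone_orbit (m1 + m2) (cone_join \<tau>1 \<tau>2)"
    "join_point m1 m2 p = (cone_join \<tau>1 \<tau>2, z)"
    using join_point_prod[OF t(1-4)] unfolding t(5) by blast
  show ?thesis
    unfolding z(2) unfolding t(5) affine_chart_def
    using t(1-4) z(1) J join_subset_iff[OF \<sigma> t(1,2)] by simp
qed

lemma split_point_points: "split_point m1 m2 ` points join_variety \<subseteq> points prod_variety"
proof
  fix q assume "q \<in> split_point m1 m2 ` points join_variety"
  then obtain \<tau>1 \<tau>2 x where t: "\<tau>1 \<in> \<Sigma>1" "\<tau>2 \<in> \<Sigma>2" "x \<in> cone_orbit (m1 + m2) (cone_join \<tau>1 \<tau>2)"
    "q = split_point m1 m2 (cone_join \<tau>1 \<tau>2, x)" unfolding image_iff Bex_def points_join_iff by blast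
  from split_point_join[OF t(1-3)] show "q \<in> points prod_variety"
    unfolding t(4) points_prod_iff using t(1,2) by metis
qed

lemma join_point_points: "join_point m1 m2 ` points prod_variety \<subseteq> points join_variety"
proof
  fix q assume "q \<in> join_point m1 m2 ` points prod_variety"
  then obtain \<tau>1 \<tau>2 x y where t: "\<tau>1 \<in> \<Sigma>1" "\<tau>2 \<in> \<Sigma>2" "x \<in> cone_orbit m1 \<tau>1" "y \<in> cone_orbit m2 \<tau>2"
    "q = join_point m1 m2 ((\<tau>1, x), (\<tau>2, y))" unfolding image_iff Bex_def points_prod_iff by blast
  from join_point_prod[OF t(1-4)] show "q \<in> points join_variety"
    unfolding t(5) points_join_iff using t(1,2) by metis
qed

text \<open>A tensor function is a sum of products of functions on the factors. These pull back
  along the projections, but a product lies in the coordinate ring only up to equality on the chart,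
  so the summands \<open>h k\<close> are chosen one by one.\<close>

lemma variety_morphism_split: "variety_morphism join_variety prod_variety (split_point m1 m2)"
proof (rule variety_morphismI[OF split_point_points])
  fix V C assume "(V, C) \<in> charts prod_variety"
  then obtain \<sigma>1 \<sigma>2 where \<sigma>: "\<sigma>1 \<in> \<Sigma>1" "\<sigma>2 \<in> \<Sigma>2"
    and V: "V = affine_chart m1 \<Sigma>1 \<sigma>1 \<times> affine_chart m2 \<Sigma>2 \<sigma>2"
    and C: "C = tensor_functions (coordinate_ring m1 \<sigma>1) (coordinate_ring m2 \<sigma>2)"
    unfolding charts_prod_iff by blast
  interpret cone_pair m1 m2 \<sigma>1 \<sigma>2 using \<sigma> by (rule cone_pair)
  let ?m = "m1 + m2" and ?\<sigma> = "cone_join \<sigma>1 \<sigma>2"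
  let ?U = "affine_chart ?m join_fan ?\<sigma>" and ?A = "coordinate_ring ?m ?\<sigma>"
  have "?U \<subseteq> points join_variety"
    by (auto simp: affine_chart_def points_fan_variety)
  moreover have "split_point m1 m2 p \<in> V \<longleftrightarrow> p \<in> ?U" if "p \<in> points join_variety" for p
    unfolding V by (rule split_point_in_chart_iff[OF \<sigma> that])
  ultimately have U: "?U = {p \<in> points join_variety. split_point m1 m2 p \<in> V}"
    by blast
  have fst: "\<exists>a\<in>?A. \<forall>p. a p = f (fst (split_point m1 m2 p))" if f: "f \<in> coordinate_ring m1 \<sigma>1" for f
  proof -
    have "u @\<^sub>v 0\<^sub>v m2 \<in> cone_semigroup ?m ?\<sigma>" if "u \<in> cone_semigroup m1 \<sigma>1" for u
      using that zero_in_cone_semigroup[OF \<sigma>2(1)] cone_semigroup_join[of u "0\<^sub>v m2"]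
      by (auto simp: cone_semigroup_def)
    from coordinate_ring_pullback[where h = "\<lambda>u. u @\<^sub>v 0\<^sub>v m2", OF f this] obtain a where a: "a \<in> ?A"
      "\<And>\<tau> \<tau>' x. a (\<tau>, x) = f (\<tau>', \<lambda>u. if u \<in> carrier_vec m1 then x (u @\<^sub>v 0\<^sub>v m2) else 0)" by blast
    show ?thesis by (intro bexI[OF _ a(1)] allI) (auto simp: split_point_def a(2))
  qed
  have snd: "\<exists>a\<in>?A. \<forall>p. a p = f (snd (split_point m1 m2 p))" if f: "f \<in> coordinate_ring m2 \<sigma>2" for f
  proof -
    have "0\<^sub>v m1 @\<^sub>v u \<in> cone_semigroup ?m ?\<sigma>" if "u \<in> cone_semigroup m2 \<sigma>2" for u
      using that zero_in_cone_semigroup[OF \<sigma>1(1)] cone_semigroup_join[of "0\<^sub>v m1" u]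
      by (auto simp: cone_semigroup_def)
    from coordinate_ring_pullback[where h = "\<lambda>u. 0\<^sub>v m1 @\<^sub>v u", OF f this] obtain a where a: "a \<in> ?A"
      "\<And>\<tau> \<tau>' x. a (\<tau>, x) = f (\<tau>', \<lambda>u. if u \<in> carrier_vec m2 then x (0\<^sub>v m1 @\<^sub>v u) else 0)" by blast
    show ?thesis by (intro bexI[OF _ a(1)] allI) (auto simp: split_point_def a(2))
  qed
  have "\<exists>a\<in>?A. \<forall>p\<in>?U. a p = c (split_point m1 m2 p)" if "c \<in> C" for c
  proof -
    obtain N :: nat and f g where fg: "\<forall>k<N. f k \<in> coordinate_ring m1 \<sigma>1 \<and> g k \<in> coordinate_ring m2 \<sigma>2"
      and c: "c = (\<lambda>(p, q). \<Sum>k<N. f k p * g k q)"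
      using \<open>c \<in> C\<close> unfolding C tensor_functions_def by blast
    have "\<exists>h\<in>?A. \<forall>p\<in>?U. h p = f k (fst (split_point m1 m2 p)) * g k (snd (split_point m1 m2 p))"
      if "k \<in> {..<N}" for k
    proof -
      have fgk: "f k \<in> coordinate_ring m1 \<sigma>1" "g k \<in> coordinate_ring m2 \<sigma>2" using fg that by auto
      obtain a where a: "a \<in> ?A" "\<forall>p. a p = f k (fst (split_point m1 m2 p))" using fst[OF fgk(1)] by blast
      obtain b where b: "b \<in> ?A" "\<forall>p. b p = g k (snd (split_point m1 m2 p))" using snd[OF fgk(2)] by blast
      show ?thesis using coordinate_ring_mult[OF join_carrier a(1) b(1), of join_fan] a(2) b(2) by simp
    qed
    then have "\<forall>k\<in>{..<N}. \<exists>h. h \<in> ?A \<and> (\<forall>p\<in>?U. h p = f k (fst (split_point m1 m2 p)) * g k (snd (split_point m1 m2 p)))"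
      by blast
    from bchoice[OF this] obtain h where h: "\<forall>k\<in>{..<N}. h k \<in> ?A \<and>
        (\<forall>p\<in>?U. h k p = f k (fst (split_point m1 m2 p)) * g k (snd (split_point m1 m2 p)))" by blast
    have "(\<lambda>p. \<Sum>k<N. h k p) \<in> ?A" using h by (intro coordinate_ring_sum) auto
    moreover have "(\<Sum>k<N. h k p) = c (split_point m1 m2 p)" if "p \<in> ?U" for p
      unfolding c case_prod_unfold using h that by (intro sum.cong refl) blast
    ultimately show ?thesis by (intro bexI[of _ "\<lambda>p. \<Sum>k<N. h k p"] ballI)
  qed
  moreover have "(?U, ?A) \<in> charts join_variety" unfolding charts_join_iff using \<sigma> by blast
  ultimately show "\<exists>(U, A)\<in>charts join_variety. U = {p \<in> points join_variety. split_point m1 m2 p \<in> V} \<and>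
      (\<forall>c\<in>C. \<exists>a\<in>A. \<forall>p\<in>U. a p = c (split_point m1 m2 p))"
    using U by (intro bexI[of _ "(?U, ?A)"] case_prodI conjI ballI) auto
qed

text \<open>On a joined point a character is the product of the values of its two parts, so each
  monomial is a pure tensor.\<close>

lemma variety_morphism_join: "variety_morphism prod_variety join_variety (join_point m1 m2)"
proof (rule variety_morphismI[OF join_point_points])
  fix V C assume "(V, C) \<in> charts join_variety"
  then obtain \<sigma>1 \<sigma>2 where \<sigma>: "\<sigma>1 \<in> \<Sigma>1" "\<sigma>2 \<in> \<Sigma>2"
    and V: "V = affine_chart (m1 + m2) join_fan (cone_join \<sigma>1 \<sigma>2)"
    and C: "C = coordinate_ring (m1 + m2) (cone_join \<sigma>1 \<sigma>2)"
    unfolding charts_join_iff by blast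
  interpret cone_pair m1 m2 \<sigma>1 \<sigma>2 using \<sigma> by (rule cone_pair)
  let ?U = "affine_chart m1 \<Sigma>1 \<sigma>1 \<times> affine_chart m2 \<Sigma>2 \<sigma>2"
  let ?A = "tensor_functions (coordinate_ring m1 \<sigma>1) (coordinate_ring m2 \<sigma>2)"
  have "?U \<subseteq> points prod_variety"
    by (auto simp: affine_chart_def points_fan_variety points_prod)
  moreover have "join_point m1 m2 p \<in> V \<longleftrightarrow> p \<in> ?U" if "p \<in> points prod_variety" for p
    unfolding V by (rule join_point_in_chart_iff[OF \<sigma> that])
  ultimately have U: "?U = {p \<in> points prod_variety. join_point m1 m2 p \<in> V}"
    by blast
  have "\<exists>a\<in>?A. \<forall>p\<in>?U. a p = c (join_point m1 m2 p)" if "c \<in> C" for c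
  proof -
    obtain F d where F: "finite F" "F \<subseteq> cone_semigroup (m1 + m2) (cone_join \<sigma>1 \<sigma>2)"
      "c = (\<lambda>(\<tau>, x). \<Sum>u\<in>F. d u * x u)"
      using \<open>c \<in> C\<close> unfolding C coordinate_ring_def by blast
    have carr: "u \<in> carrier_vec (m1 + m2)" if "u \<in> F" for u using that F(2) by (auto simp: cone_semigroup_def)
    \<comment> \<open>\<open>tensor_functions\<close> numbers its summands, hence this enumeration
      of \<open>F\<close>; the coefficients go into the left factors.\<close>
    obtain e where e: "bij_betw e {..<card F} F"
      using ex_bij_betw_nat_finite[OF F(1)] by (auto simp: atLeast0LessThan)
    have eF: "e k \<in> F" if "k < card F" for k using bij_betwE[OF e] that by blast
    have sg: "vec_first u m1 \<in> cone_semigroup m1 \<sigma>1 \<and> vec_last u m2 \<in> cone_semigroup m2 \<sigma>2" if "u \<in> F" for u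
      using cone_semigroup_join[of "vec_first u m1" "vec_last u m2"] carr[OF that] that F(2) by auto
    let ?f = "\<lambda>k. \<lambda>(\<tau> :: real vec set, x). d (e k) * x (vec_first (e k) m1)"
    let ?g = "\<lambda>k. \<lambda>(\<tau> :: real vec set, x). 1 * x (vec_last (e k) m2)"
    let ?a = "\<lambda>(p, q). \<Sum>k<card F. ?f k p * ?g k q"
    have "\<forall>k<card F. ?f k \<in> coordinate_ring m1 \<sigma>1 \<and> ?g k \<in> coordinate_ring m2 \<sigma>2"
      using sg[OF eF] by (intro allI impI conjI coordinate_ring_monomial) blast+
    then have "?a \<in> ?A" unfolding tensor_functions_def
      by (intro CollectI exI[of _ "card F"] exI[of _ ?f] exI[of _ ?g] conjI refl)
    moreover have "?a p = c (join_point m1 m2 p)" for p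
    proof -
      obtain \<tau>1 x \<tau>2 y where p: "p = ((\<tau>1, x), (\<tau>2, y))" by (metis surj_pair)
      have "c (join_point m1 m2 p) = (\<Sum>u\<in>F. d u * (x (vec_first u m1) * y (vec_last u m2)))"
        unfolding F(3) p join_point_def case_prod_conv by (intro sum.cong refl) (simp add: carr)
      also have "\<dots> = (\<Sum>k<card F. d (e k) * (x (vec_first (e k) m1) * y (vec_last (e k) m2)))"
        by (rule sum.reindex_bij_betw[OF e, symmetric])
      also have "\<dots> = ?a p" unfolding p by (simp add: mult.assoc)
      finally show ?thesis by simp
    qed
    ultimately show ?thesis by (intro bexI[of _ ?a] ballI)
  qed
  moreover have "(?U, ?A) \<in> charts prod_variety" unfolding charts_prod_iff using \<sigma> by blast
  ultimately show "\<exists>(U, A)\<in>charts prod_variety. U = {p \<in> points prod_variety. join_point m1 m2 p \<in> V} \<and>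
      (\<forall>c\<in>C. \<exists>a\<in>A. \<forall>p\<in>U. a p = c (join_point m1 m2 p))"
    using U by (intro bexI[of _ "(?U, ?A)"] case_prodI conjI ballI) auto
qed

lemma toric_isomorphic_join: "toric_isomorphic join_variety prod_variety"
proof -
  interpret cone_pair m1 m2 "{0\<^sub>v m1}" "{0\<^sub>v m2}" by unfold_locales auto
  have zero: "cone_join {0\<^sub>v m1} {0\<^sub>v m2} = {0\<^sub>v (m1 + m2)}"
    by (auto simp: cone_join_def append_zero_vec)
  note first = cone_orbit_first[unfolded zero] and last = cone_orbit_last[unfolded zero]
    and join = cone_orbit_join[unfolded zero]
  have first_zero: "vec_first (0\<^sub>v (m1 + m2)) m1 = (0\<^sub>v m1 :: real vec)"
    by (intro eq_vecI) (auto simp: vec_first_def)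
  have last_zero: "vec_last (0\<^sub>v (m1 + m2)) m2 = (0\<^sub>v m2 :: real vec)"
    by (intro eq_vecI) (auto simp: vec_last_def)
  have "split_point m1 m2 \<in> hom (fan_torus (m1 + m2)) (fan_torus m1 \<times>\<times> fan_torus m2)"
    unfolding hom_def fan_torus_def split_point_def
    using first last by (auto simp: first_zero last_zero fun_eq_iff)
  then have 1: "toric_morphism join_variety prod_variety (split_point m1 m2)"
    using variety_morphism_split by (simp add: toric_morphism_def toric_product_def fan_variety_def)
  have "join_point m1 m2 \<in> hom (fan_torus m1 \<times>\<times> fan_torus m2) (fan_torus (m1 + m2))"
    unfolding hom_def fan_torus_def join_point_def
    using join by (auto simp: zero fun_eq_iff)
  then have 2: "toric_morphism prod_variety join_variety (join_point m1 m2)"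
    using variety_morphism_join by (simp add: toric_morphism_def toric_product_def fan_variety_def)
  have 3: "join_point m1 m2 (split_point m1 m2 p) = p" if "p \<in> points join_variety" for p
    using that cone_pair.join_split_point[OF cone_pair] unfolding points_join_iff by blast
  have 4: "split_point m1 m2 (join_point m1 m2 p) = p" if "p \<in> points prod_variety" for p
    using that cone_pair.split_join_point[OF cone_pair] unfolding points_prod_iff by blast
  show ?thesis
    unfolding toric_isomorphic_def
    by (intro exI[of _ "split_point m1 m2"] exI[of _ "join_point m1 m2"] conjI 1 2 ballI 3 4)
qed

end

section \<open>Block diagonal Bott matrices\<close>

text \<open>The upper right block vanishes by triangularity, so \<open>off\<close> concerns the
  lower left one.\<close>

locale block_diagonal_bott =
  fixes m1 m2 :: nat and B B1 B2 :: "int mat"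
  assumes B: "bott_matrix (m1 + m2) B" and B1: "bott_matrix m1 B1" and B2: "bott_matrix m2 B2"
    and block1: "\<And>j k. j < m1 \<Longrightarrow> k < m1 \<Longrightarrow> B $$ (j, k) = B1 $$ (j, k)"
    and block2: "\<And>j k. j < m2 \<Longrightarrow> k < m2 \<Longrightarrow> B $$ (m1 + j, m1 + k) = B2 $$ (j, k)"
    and off: "\<And>j k. j < m2 \<Longrightarrow> k < m1 \<Longrightarrow> B $$ (m1 + j, k) = 0"
begin

lemma ray_first:
  assumes "k < m1" "j < m1 + m2"
  shows "ray B b k $ j = (if j < m1 then ray B1 b k $ j else 0)"
proof (cases "j < m1")
  case True
  then show ?thesis using assms block1 by (simp add: ray_index[OF B] ray_index[OF B1])
next
  case False
  then obtain l where "j = m1 + l" "l < m2" using assms(2) by (metis add_less_cancel_left le_Suc_ex not_less)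
  then show ?thesis using assms off by (simp add: ray_index[OF B])
qed

lemma ray_last:
  assumes "k < m2" "j < m1 + m2"
  shows "ray B b (m1 + k) $ j = (if j < m1 then 0 else ray B2 b k $ (j - m1))"
proof (cases "j < m1")
  case True
  then show ?thesis using assms by (simp add: ray_index[OF B])
next
  case False
  then obtain l where "j = m1 + l" "l < m2" using assms(2) by (metis add_less_cancel_left le_Suc_ex not_less)
  then show ?thesis using assms block2 by (simp add: ray_index[OF B] ray_index[OF B2])
qed

lemma combination_append:
  assumes K: "K1 \<subseteq> {..<m1}" "K2 \<subseteq> {..<m2}"
  shows "vec (m1 + m2) (\<lambda>j. \<Sum>k\<in>K1 \<union> (+) m1 ` K2. c k * real_of_int (ray B (\<epsilon> k) k $ j)) =
    vec m1 (\<lambda>j. \<Sum>k\<in>K1. c k * real_of_int (ray B1 (\<epsilon> k) k $ j)) @\<^sub>v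
    vec m2 (\<lambda>j. \<Sum>k\<in>K2. c (m1 + k) * real_of_int (ray B2 (\<epsilon> (m1 + k)) k $ j))" (is "?l = ?r")
proof (rule eq_vecI)
  fix j assume "j < dim_vec ?r"
  then have j: "j < m1 + m2" by simp
  have fin: "finite K1" "finite K2" using K finite_subset by blast+
  have "K1 \<inter> (+) m1 ` K2 = {}" using K by auto
  then have "?l $ j = (\<Sum>k\<in>K1. c k * real_of_int (ray B (\<epsilon> k) k $ j)) +
      (\<Sum>k\<in>K2. c (m1 + k) * real_of_int (ray B (\<epsilon> (m1 + k)) (m1 + k) $ j))"
    using fin j by (simp add: sum.union_disjoint sum.reindex)
  also have "(\<Sum>k\<in>K1. c k * real_of_int (ray B (\<epsilon> k) k $ j)) =
      (\<Sum>k\<in>K1. if j < m1 then c k * real_of_int (ray B1 (\<epsilon> k) k $ j) else 0)"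
    using K(1) ray_first[OF _ j] by (intro sum.cong) auto
  also have "(\<Sum>k\<in>K2. c (m1 + k) * real_of_int (ray B (\<epsilon> (m1 + k)) (m1 + k) $ j)) =
      (\<Sum>k\<in>K2. if j < m1 then 0 else c (m1 + k) * real_of_int (ray B2 (\<epsilon> (m1 + k)) k $ (j - m1)))"
    using K(2) ray_last[OF _ j] by (intro sum.cong) auto
  finally show "?l $ j = ?r $ j" using j by simp
qed simp

lemma cone_spanned_append:
  assumes K: "K1 \<subseteq> {..<m1}" "K2 \<subseteq> {..<m2}"
  shows "cone_spanned (m1 + m2) ((\<lambda>k. ray B (\<epsilon> k) k) ` (K1 \<union> (+) m1 ` K2)) =
    cone_join (cone_spanned m1 ((\<lambda>k. ray B1 (\<epsilon> k) k) ` K1))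
      (cone_spanned m2 ((\<lambda>k. ray B2 (\<epsilon> (m1 + k)) k) ` K2))"
proof -
  let ?K = "K1 \<union> (+) m1 ` K2"
  have fin: "finite K1" "finite K2" using K finite_subset by blast+
  have sub: "?K \<subseteq> {..<m1 + m2}" using K by auto
  have inj2: "inj_on (\<lambda>k. ray B2 (\<epsilon> (m1 + k)) k) K2"
    using inj_on_ray[OF B2 K(2), of "\<lambda>k. \<epsilon> (m1 + k)"] .
  have fin': "finite ?K" using fin by simp
  note eq = cone_spanned_image[OF fin' inj_on_ray[OF B sub]]
    cone_spanned_image[OF fin(1) inj_on_ray[OF B1 K(1)]] cone_spanned_image[OF fin(2) inj2]
  let ?C = "{vec (m1 + m2) (\<lambda>j. \<Sum>k\<in>?K. c k * real_of_int (ray B (\<epsilon> k) k $ j)) |c. \<forall>k\<in>?K. 0 \<le> c k}"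
  let ?C1 = "{vec m1 (\<lambda>j. \<Sum>k\<in>K1. c k * real_of_int (ray B1 (\<epsilon> k) k $ j)) |c. \<forall>k\<in>K1. 0 \<le> c k}"
  let ?C2 = "{vec m2 (\<lambda>j. \<Sum>k\<in>K2. c k * real_of_int (ray B2 (\<epsilon> (m1 + k)) k $ j)) |c. \<forall>k\<in>K2. 0 \<le> c k}"
  have "x \<in> cone_join ?C1 ?C2" if mem: "x \<in> ?C" for x
  proof -
    obtain c where c: "x = vec (m1 + m2) (\<lambda>j. \<Sum>k\<in>?K. c k * real_of_int (ray B (\<epsilon> k) k $ j))"
      "\<forall>k\<in>?K. 0 \<le> c k" using mem by blast
    show ?thesis
      unfolding c(1) combination_append[OF K]
    proof (rule cone_joinI)
      show "vec m1 (\<lambda>j. \<Sum>k\<in>K1. c k * real_of_int (ray B1 (\<epsilon> k) k $ j)) \<in> ?C1"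
        by (intro CollectI exI[of _ c] conjI refl) (use c(2) in blast)
      show "vec m2 (\<lambda>j. \<Sum>k\<in>K2. c (m1 + k) * real_of_int (ray B2 (\<epsilon> (m1 + k)) k $ j)) \<in> ?C2"
        by (intro CollectI exI[of _ "\<lambda>k. c (m1 + k)"] conjI refl) (use c(2) in blast)
    qed
  qed
  moreover have "x \<in> ?C" if mem: "x \<in> cone_join ?C1 ?C2" for x
  proof -
    obtain c1 c2 where x: "x = vec m1 (\<lambda>j. \<Sum>k\<in>K1. c1 k * real_of_int (ray B1 (\<epsilon> k) k $ j)) @\<^sub>v
        vec m2 (\<lambda>j. \<Sum>k\<in>K2. c2 k * real_of_int (ray B2 (\<epsilon> (m1 + k)) k $ j))"
      and nonneg: "\<forall>k\<in>K1. 0 \<le> c1 k" "\<forall>k\<in>K2. 0 \<le> c2 k" using mem by (elim cone_joinE) blast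
    define c where "c = (\<lambda>k. if k < m1 then c1 k else c2 (k - m1))"
    have c: "c k = c1 k" if "k \<in> K1" for k using that K(1) by (auto simp: c_def)
    have c': "c (m1 + k) = c2 k" for k by (simp add: c_def)
    have "x = vec (m1 + m2) (\<lambda>j. \<Sum>k\<in>?K. c k * real_of_int (ray B (\<epsilon> k) k $ j))"
      unfolding combination_append[OF K] x by (simp add: c c')
    moreover have "\<forall>k\<in>?K. 0 \<le> c k" using nonneg c c' by auto
    ultimately show ?thesis by blast
  qed
  ultimately show ?thesis unfolding eq by (intro equalityI subsetI)
qed

sublocale cone_family_pair m1 m2 "bott_fan B1" "bott_fan B2"
  using cone_family_bott_fan[OF B1] cone_family_bott_fan[OF B2] by unfold_locales

text \<open>A set of indices splits at \<open>m1\<close>, index \<open>l\<close> of the second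
  factor being \<open>m1 + l\<close> in the whole; choices of rays are split and glued in the same
  way.\<close>

lemma bott_fan_eq_join_fan: "bott_fan B = join_fan"
proof (intro equalityI subsetI)
  fix \<sigma> assume "\<sigma> \<in> bott_fan B"
  then obtain \<epsilon> K where K: "K \<subseteq> {..<m1 + m2}" "\<sigma> = cone_spanned (m1 + m2) ((\<lambda>k. ray B (\<epsilon> k) k) ` K)"
    unfolding bott_fan_eq[OF B] by blast
  define K1 K2 where "K1 = K \<inter> {..<m1}" and "K2 = {l. m1 + l \<in> K}"
  have sub: "K1 \<subseteq> {..<m1}" "K2 \<subseteq> {..<m2}" using K(1) by (auto simp: K1_def K2_def)
  have "K = K1 \<union> (+) m1 ` K2"
  proof (intro equalityI subsetI)
    fix k assume "k \<in> K"
    moreover have "k = m1 + (k - m1)" if "\<not> k < m1" using that by simp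
    ultimately show "k \<in> K1 \<union> (+) m1 ` K2" unfolding K1_def K2_def by (cases "k < m1") (auto simp: image_iff intro!: exI[of _ "k - m1"])
  qed (auto simp: K1_def K2_def)
  then have "\<sigma> = cone_join (cone_spanned m1 ((\<lambda>k. ray B1 (\<epsilon> k) k) ` K1))
      (cone_spanned m2 ((\<lambda>k. ray B2 (\<epsilon> (m1 + k)) k) ` K2))"
    unfolding K(2) using cone_spanned_append[OF sub] by simp
  moreover have "cone_spanned m1 ((\<lambda>k. ray B1 (\<epsilon> k) k) ` K1) \<in> bott_fan B1"
    unfolding bott_fan_eq[OF B1] using sub(1) by blast
  moreover have "cone_spanned m2 ((\<lambda>k. ray B2 (\<epsilon> (m1 + k)) k) ` K2) \<in> bott_fan B2"
    unfolding bott_fan_eq[OF B2]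
    by (intro CollectI exI[of _ "\<lambda>k. \<epsilon> (m1 + k)"] exI[of _ K2] conjI refl sub(2))
  ultimately show "\<sigma> \<in> join_fan" unfolding join_fan_def by blast
next
  fix \<sigma> assume "\<sigma> \<in> join_fan"
  then obtain \<sigma>1 \<sigma>2 where \<sigma>: "\<sigma> = cone_join \<sigma>1 \<sigma>2" "\<sigma>1 \<in> bott_fan B1" "\<sigma>2 \<in> bott_fan B2"
    unfolding join_fan_def by blast
  obtain \<epsilon>1 K1 where 1: "K1 \<subseteq> {..<m1}" "\<sigma>1 = cone_spanned m1 ((\<lambda>k. ray B1 (\<epsilon>1 k) k) ` K1)"
    using \<sigma>(2) unfolding bott_fan_eq[OF B1] by blast
  obtain \<epsilon>2 K2 where 2: "K2 \<subseteq> {..<m2}" "\<sigma>2 = cone_spanned m2 ((\<lambda>k. ray B2 (\<epsilon>2 k) k) ` K2)"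
    using \<sigma>(3) unfolding bott_fan_eq[OF B2] by blast
  define \<epsilon> where "\<epsilon> = (\<lambda>k. if k < m1 then \<epsilon>1 k else \<epsilon>2 (k - m1))"
  have \<epsilon>: "(\<lambda>k. ray B1 (\<epsilon> k) k) ` K1 = (\<lambda>k. ray B1 (\<epsilon>1 k) k) ` K1"
    "(\<lambda>k. ray B2 (\<epsilon> (m1 + k)) k) ` K2 = (\<lambda>k. ray B2 (\<epsilon>2 k) k) ` K2"
    using 1(1) by (auto simp: \<epsilon>_def intro!: image_cong)
  have "\<sigma> = cone_spanned (m1 + m2) ((\<lambda>k. ray B (\<epsilon> k) k) ` (K1 \<union> (+) m1 ` K2))"
    unfolding cone_spanned_append[OF 1(1) 2(1)] \<sigma>(1) 1(2) 2(2) \<epsilon> by (rule refl)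
  moreover have "K1 \<union> (+) m1 ` K2 \<subseteq> {..<m1 + m2}" using 1(1) 2(1) by auto
  ultimately show "\<sigma> \<in> bott_fan B" unfolding bott_fan_eq[OF B] by blast
qed

lemma bott_manifold_isomorphic_product:
  "toric_isomorphic (bott_manifold B) (toric_product (bott_manifold B1) (bott_manifold B2))"
  using toric_isomorphic_join
  unfolding bott_manifold_def bott_matrix_dims(1)[OF B] bott_matrix_dims(1)[OF B1] bott_matrix_dims(1)[OF B2]
    bott_fan_eq_join_fan .

end

section \<open>Decomposable words and the classification\<close>

lemma seq_matrix_append_isomorphic_product:
  assumes far: "\<And>a b. a \<in> set u \<Longrightarrow> b \<in> set v \<Longrightarrow> \<bar>a - b\<bar> > 1"
  shows "toric_isomorphic (bott_manifold (seq_matrix (u @ v)))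
    (toric_product (bott_manifold (seq_matrix u)) (bott_manifold (seq_matrix v)))"
proof -
  interpret block_diagonal_bott "length u" "length v" "seq_matrix (u @ v)" "seq_matrix u" "seq_matrix v"
  proof
    show "bott_matrix (length u + length v) (seq_matrix (u @ v))"
      using bott_matrix_seq_matrix[of "u @ v"] by simp
    show "bott_matrix (length u) (seq_matrix u)" "bott_matrix (length v) (seq_matrix v)"
      by (rule bott_matrix_seq_matrix)+
    show "seq_matrix (u @ v) $$ (j, k) = seq_matrix u $$ (j, k)" if "j < length u" "k < length u" for j k
      using that by (simp add: seq_matrix_def nth_append)
    show "seq_matrix (u @ v) $$ (length u + j, length u + k) = seq_matrix v $$ (j, k)"
      if "j < length v" "k < length v" for j k
      using that by (simp add: seq_matrix_def)
    show "seq_matrix (u @ v) $$ (length u + j, k) = 0" if "j < length v" "k < length u" for j k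
      using that far[of "u ! k" "v ! j"] by (auto simp: seq_matrix_below_diag nth_append)
  qed
  show ?thesis by (rule bott_manifold_isomorphic_product)
qed

lemma indecomposable_imp_interval:
  assumes ind: "indecomposable_bott (seq_matrix i)" and ne: "i \<noteq> []"
  shows "set i = {Min (set i)..Max (set i)}"
proof (rule ccontr)
  assume "set i \<noteq> {Min (set i)..Max (set i)}"
  moreover have "set i \<subseteq> {Min (set i)..Max (set i)}" by auto
  ultimately obtain c where "c \<in> {Min (set i)..Max (set i)}" and "c \<notin> set i" by blast
  then have c: "Min (set i) \<le> c" "c \<le> Max (set i)" "c \<notin> set i" by simp_all
  let ?u = "filter (\<lambda>a. a < c) i" and ?v = "filter (\<lambda>a. c < a) i"
  have mem: "Min (set i) \<in> set i" "Max (set i) \<in> set i" using ne by auto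
  \<comment> \<open>The least and the greatest letter differ from \<open>c\<close>, so each is
    missing from one of the two parts and both factors have smaller dimension.\<close>
  then have "Min (set i) < c" "c < Max (set i)" using c by (metis order_le_less)+
  then have short: "length ?u < length i" "length ?v < length i"
    using length_filter_less[OF mem(2), of "\<lambda>a. a < c"] length_filter_less[OF mem(1), of "\<lambda>a. c < a"]
    by simp_all
  have "toric_isomorphic (bott_manifold (seq_matrix i)) (bott_manifold (seq_matrix (?u @ ?v)))"
    by (rule two_moves_isomorphic[OF two_moves_split_at_gap[OF c(3)]])
  moreover have "toric_isomorphic (bott_manifold (seq_matrix (?u @ ?v)))
      (toric_product (bott_manifold (seq_matrix ?u)) (bott_manifold (seq_matrix ?v)))"
    by (rule seq_matrix_append_isomorphic_product) auto
  ultimately have "toric_isomorphic (bott_manifold (seq_matrix i))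
      (toric_product (bott_manifold (seq_matrix ?u)) (bott_manifold (seq_matrix ?v)))"
    by (rule toric_isomorphic_trans)
  then show False
    using ind short bott_matrix_seq_matrix[of ?u] bott_matrix_seq_matrix[of ?v]
      bott_matrix_dims(1)[OF bott_matrix_seq_matrix[of i]]
    unfolding indecomposable_bott_def by metis
qed

theorem theorem5p13:
  fixes n m :: nat and i i' :: "int list"
  assumes "n > 0" and "m > 0"
    and "length i = m" and "set i \<subseteq> {1..int n}"
    and "length i' = m" and "set i' \<subseteq> {1..int n}"
    and "indecomposable_bott (seq_matrix i)"
    and "indecomposable_bott (seq_matrix i')"
  shows "toric_isomorphic (bott_manifold (seq_matrix i)) (bott_manifold (seq_matrix i')) \<longleftrightarrow>
    two_move\<^sup>*\<^sup>* (standardization i) (standardization i') \<or>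
    two_move\<^sup>*\<^sup>* (standardization i) (standardization (iota n i'))"
proof
  assume "toric_isomorphic (bott_manifold (seq_matrix i)) (bott_manifold (seq_matrix i'))"
  moreover have "i \<noteq> []" using assms(2,3) by auto
  ultimately show "two_move\<^sup>*\<^sup>* (standardization i) (standardization i') \<or>
      two_move\<^sup>*\<^sup>* (standardization i) (standardization (iota n i'))"
    using seq_matrix_isomorphic_imp_two_moves[OF assms(3,5,2)] indecomposable_imp_interval[OF assms(7)] by blast
next
  assume "two_move\<^sup>*\<^sup>* (standardization i) (standardization i') \<or>
    two_move\<^sup>*\<^sup>* (standardization i) (standardization (iota n i'))"
  then show "toric_isomorphic (bott_manifold (seq_matrix i)) (bott_manifold (seq_matrix i'))"
    by (auto dest!: two_moves_isomorphic simp: seq_matrix_standardization seq_matrix_iota)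
qed

end
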